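(* Let $F$ be a free group, $R\trianglelefteq F$ and $G=F/R$. Let $w$ be an infinite-order element of $G$ and let $\bar w\in F$ be a preimage of $w$ under $F\to F/R$. Then there is an isomorphism \[ H_2(G,[w];\mathbb{Z})\cong\langle\bar w\rangle R\cap[F,F]\,/\,[F,R]. \]
   Context: $H_2(G,[w];\mathbb{Z}):=H_2(X_\gamma,S^1;\mathbb{Z})$, where $X$ is a $K(G,1)$ space, $\gamma:S^1\to X$ is a loop representing (the conjugacy class of) $w$, and $X_\gamma=(X\sqcup(S^1\times[0,1]))/((u,0)\sim\gamma(u))$ is the mapping cylinder with $S^1$ identified with $S^1\times\{1\}$. *)

theory Defs
  imports "HOL-Analysis.Analysis" "HOL-Homology.Homology" "HOL-Algebra.Algebra"
begin

fun reduced_word :: "(bool \<times> 'a) list \<Rightarrow> bool" where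
  "reduced_word [] = True"
| "reduced_word [x] = True"
| "reduced_word (x # y # xs) =
     (\<not> (fst x \<noteq> fst y \<and> snd x = snd y) \<and> reduced_word (y # xs))"

definition word_eval :: "('a, 'b) monoid_scheme \<Rightarrow> (bool \<times> 'a) list \<Rightarrow> 'a" where
  "word_eval F ws = foldr (\<lambda>(b, a) acc. (if b then a else inv\<^bsub>F\<^esub> a) \<otimes>\<^bsub>F\<^esub> acc) ws \<one>\<^bsub>F\<^esub>"

definition free_group :: "('a, 'b) monoid_scheme \<Rightarrow> bool" where
  "free_group F \<longleftrightarrow> group F \<and>
     (\<exists>B \<subseteq> carrier F. generate F B = carrier F \<and>
        (\<forall>ws. ws \<noteq> [] \<and> reduced_word ws \<and> snd ` set ws \<subseteq> B \<longrightarrow> word_eval F ws \<noteq> \<one>\<^bsub>F\<^esub>))"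

definition comm_subgroup :: "('a, 'b) monoid_scheme \<Rightarrow> 'a set \<Rightarrow> 'a set \<Rightarrow> 'a set" where
  "comm_subgroup F A B = generate F (\<Union>a\<in>A. \<Union>b\<in>B.
      {a \<otimes>\<^bsub>F\<^esub> b \<otimes>\<^bsub>F\<^esub> inv\<^bsub>F\<^esub> a \<otimes>\<^bsub>F\<^esub> inv\<^bsub>F\<^esub> b})"

definition path_join :: "(real \<Rightarrow> 'a) \<Rightarrow> (real \<Rightarrow> 'a) \<Rightarrow> real \<Rightarrow> 'a" where
  "path_join g h = (\<lambda>t. if t \<le> 1/2 then g (2 * t) else h (2 * t - 1))"

definition is_loop :: "'a topology \<Rightarrow> 'a \<Rightarrow> (real \<Rightarrow> 'a) \<Rightarrow> bool" where
  "is_loop T x0 g \<longleftrightarrow> continuous_map (top_of_set {0..1}) T g \<and> g 0 = x0 \<and> g 1 = x0"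

definition loop_class :: "'a topology \<Rightarrow> 'a \<Rightarrow> (real \<Rightarrow> 'a) \<Rightarrow> (real \<Rightarrow> 'a) set" where
  "loop_class T x0 g =
     {h. homotopic_with (\<lambda>k. k 0 = x0 \<and> k 1 = x0) (top_of_set {0..1}) T g h}"

definition fundamental_group :: "'a topology \<Rightarrow> 'a \<Rightarrow> (real \<Rightarrow> 'a) set monoid" where
  "fundamental_group T x0 =
     \<lparr>carrier = {loop_class T x0 g | g. is_loop T x0 g},
      monoid.mult = (\<lambda>A B. loop_class T x0 (path_join (SOME g. g \<in> A) (SOME h. h \<in> B))),
      one = loop_class T x0 (\<lambda>t. x0)\<rparr>"

definition aspherical :: "'a topology \<Rightarrow> bool" where
  "aspherical T \<longleftrightarrow> (\<forall>n\<ge>2. \<forall>f. continuous_map (nsphere n) T f \<longrightarrow>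
       (\<exists>c. homotopic_with (\<lambda>_. True) (nsphere n) T f (\<lambda>_. c)))"

definition K_G_1 :: "'a topology \<Rightarrow> 'a \<Rightarrow> ('g, 'c) monoid_scheme \<Rightarrow> ((real \<Rightarrow> 'a) set \<Rightarrow> 'g) \<Rightarrow> bool" where
  "K_G_1 T x0 G phi \<longleftrightarrow> path_connected_space T \<and> x0 \<in> topspace T \<and> aspherical T \<and>
      phi \<in> iso (fundamental_group T x0) G"

abbreviation circle :: "complex topology" where
  "circle \<equiv> top_of_set (sphere 0 1)"

definition disjoint_union_topology :: "'a topology \<Rightarrow> 'b topology \<Rightarrow> ('a + 'b) topology" where
  "disjoint_union_topology T Y = topology (\<lambda>U.
      U \<subseteq> Inl ` topspace T \<union> Inr ` topspace Y \<and> openin T (Inl -` U) \<and> openin Y (Inr -` U))"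

definition quotient_topology :: "'a topology \<Rightarrow> ('a \<Rightarrow> 'b) \<Rightarrow> 'b topology" where
  "quotient_topology D q = topology (\<lambda>U.
      U \<subseteq> q ` topspace D \<and> openin D {x \<in> topspace D. q x \<in> U})"

definition cyl_map :: "(complex \<Rightarrow> 'a) \<Rightarrow> 'a + (complex \<times> real) \<Rightarrow> 'a + (complex \<times> real)" where
  "cyl_map \<gamma> p = (case p of Inl x \<Rightarrow> Inl x
                       | Inr (u, t) \<Rightarrow> (if t = 0 then Inl (\<gamma> u) else Inr (u, t)))"

definition mapping_cylinder :: "'a topology \<Rightarrow> (complex \<Rightarrow> 'a) \<Rightarrow> ('a + (complex \<times> real)) topology" where
  "mapping_cylinder T \<gamma> = quotient_topology
      (disjoint_union_topology T (prod_topology circle (top_of_set {0..1}))) (cyl_map \<gamma>)"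

definition cylinder_end :: "('a + (complex \<times> real)) set" where
  "cylinder_end = (\<lambda>u. Inr (u, 1)) ` sphere 0 1"

text \<open>gamma : S^1 -> T represents the conjugacy class of w under phi: gamma is freely homotopic
  to a based loop g at x0 whose class is mapped to w.\<close>
definition represents_class ::
  "'a topology \<Rightarrow> 'a \<Rightarrow> ((real \<Rightarrow> 'a) set \<Rightarrow> 'g) \<Rightarrow> (complex \<Rightarrow> 'a) \<Rightarrow> 'g \<Rightarrow> bool" where
  "represents_class T x0 phi \<gamma> w \<longleftrightarrow> continuous_map circle T \<gamma> \<and>
     (\<exists>g. is_loop T x0 g \<and> phi (loop_class T x0 g) = w \<and>
        homotopic_with (\<lambda>_. True) circle T \<gamma> (\<lambda>z. g (Arg2pi z / (2 * pi))))"

end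

theory Submission
  imports Defs
begin

text \<open>
  Give every point of the mapping cylinder \<open>M\<close> a path to the base point. Then each singular edge of
  \<open>M\<close> has a label in \<open>G = F/R\<close>, multiplicative on triangles, and the paths can be chosen on the end
  circle \<open>A\<close> so that edges in \<open>A\<close> have labels \<open>w\<^sup>k\<close>. Since \<open>\<pi>\<^sub>1 = G\<close> and \<open>\<pi>\<^sub>2 = 0\<close>, a triangle of edges
  with compatible labels bounds a 2-simplex and four matching 2-simplices bound a 3-simplex.
  Choosing a loop \<open>e g\<close> for each \<open>g\<close> and a 2-simplex \<open>t g h\<close> on the edges \<open>e g\<close>, \<open>e h\<close>, \<open>e (g h)\<close> thus
  gives a 2-cocycle of \<open>G\<close> with values in \<open>Q = C\<^sub>2(M) / (B\<^sub>2(M) + C\<^sub>2(A))\<close>. As \<open>F\<close> is free, \<open>F \<rightarrow> G\<close> lifts to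
  the corresponding central extension of \<open>G\<close> by \<open>Q\<close>. The \<open>Q\<close>-component of the lift is a homomorphism
  on \<open>\<langle>wbar\<rangle>R\<close> that kills \<open>[F,R]\<close>; on \<open>\<langle>wbar\<rangle>R \<inter> [F,F]\<close> it takes values in \<open>H\<^sub>2(M,A)\<close> and is onto because a
  prism deforms every 2-simplex to some \<open>t g h\<close>. Its kernel is detected by the cocycle that a section
  \<open>s\<close> of \<open>F \<rightarrow> G\<close> with \<open>s (w\<^sup>k) = wbar\<^sup>k\<close>, which exists because \<open>w\<close> has infinite order, defines with values
  in \<open>R/[F,R]\<close>.
\<close>

section \<open>Free groups\<close>

text \<open>The cocycle lives in all 2-chains modulo \<open>B_2(M) + C_2(A)\<close>, not in
  \<open>H_2(M,A)\<close>, because \<open>t g h\<close> need not be a relative cycle: its boundary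
  is the coboundary of \<open>g |-> e g\<close>. Commutators do not see this coboundary, and so the
  intersection with \<open>[F,F]\<close> leads back to homology. One mechanism serves throughout: a
  homomorphism on \<open>Q\<close> that sends the cocycle to the defect of a map on \<open>G\<close>
  extends to the central extension and pulls back to \<open>F\<close>. Boundary chains, exponents of
  \<open>w\<close> and \<open>F/[F,R]\<close> are its three targets. Two obstacles shape the
  topology. The loop \<gamma> need not be injective, so the argument runs in the cylinder, where the
  circle is embedded and null-homotopies can be carried back from \<open>X\<close>. And \<gamma> is
  only freely homotopic to a loop of class \<open>w\<close>, so labels read off in \<open>X\<close>
  need not be powers of \<open>w\<close> on the circle; a twist at the end points, equivalent to
  other paths to the base point, makes them so. Infinite order then lets a label determine the
  winding of an edge, which is what allows triangles of the circle to be filled inside the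
  circle.\<close>

lemma not_reduced_word_cancel:
  "\<not> reduced_word ws \<Longrightarrow> \<exists>us b a vs. ws = us @ (b, a) # (\<not> b, a) # vs"
proof (induction ws rule: reduced_word.induct)
  case (3 x y xs)
  show ?case
  proof (cases "fst x \<noteq> fst y \<and> snd x = snd y")
    case True
    then have "x # y # xs = [] @ (fst x, snd x) # (\<not> fst x, snd x) # xs"
      by (cases x; cases y) auto
    then show ?thesis by blast
  next
    case False
    then have "\<not> reduced_word (y # xs)"
      using 3 by simp
    then obtain us b a vs where "y # xs = us @ (b, a) # (\<not> b, a) # vs"
      using 3 False by blast
    then have "x # y # xs = (x # us) @ (b, a) # (\<not> b, a) # vs" by simp
    then show ?thesis by blast
  qed
qed auto

context group
begin

lemma word_eval_Nil [simp]: "word_eval G [] = \<one>"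
  by (simp add: word_eval_def)

lemma word_eval_Cons [simp]:
  "word_eval G ((b, a) # ws) = (if b then a else inv a) \<otimes> word_eval G ws"
  by (simp add: word_eval_def)

lemma word_eval_closed: "snd ` set ws \<subseteq> carrier G \<Longrightarrow> word_eval G ws \<in> carrier G"
  by (induction ws) auto

lemma word_eval_append:
  "\<lbrakk>snd ` set us \<subseteq> carrier G; snd ` set vs \<subseteq> carrier G\<rbrakk>
    \<Longrightarrow> word_eval G (us @ vs) = word_eval G us \<otimes> word_eval G vs"
  by (induction us) (auto simp: m_assoc word_eval_closed)

lemma word_eval_cancel:
  assumes "snd ` set us \<subseteq> carrier G" "snd ` set vs \<subseteq> carrier G" "a \<in> carrier G"
  shows "word_eval G (us @ (b, a) # (\<not> b, a) # vs) = word_eval G (us @ vs)"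
  using assms by (simp add: word_eval_append word_eval_closed inv_solve_right' m_assoc r_inv_ex
      flip: m_assoc) (auto simp: word_eval_closed m_assoc)

lemma word_eval_inverse:
  "snd ` set ws \<subseteq> carrier G \<Longrightarrow> word_eval G (rev (map (apfst Not) ws)) = inv (word_eval G ws)"
proof (induction ws)
  case (Cons x ws)
  obtain b a where x: "x = (b, a)" by (cases x)
  have "snd ` set (rev (map (apfst Not) ws)) \<subseteq> carrier G"
    using Cons.prems by auto
  then show ?case
    using Cons by (auto simp: x word_eval_append inv_mult_group word_eval_closed)
qed auto

lemma generate_imp_word_eval:
  assumes "B \<subseteq> carrier G" "x \<in> generate G B"
  shows "\<exists>ws. snd ` set ws \<subseteq> B \<and> word_eval G ws = x"
  using assms(2)
proof (induction rule: generate.induct)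
  case one
  show ?case by (rule exI[of _ "[]"]) auto
next
  case (incl h)
  then show ?case using assms by (intro exI[of _ "[(True, h)]"]) auto
next
  case (inv h)
  then show ?case using assms by (intro exI[of _ "[(False, h)]"]) auto
next
  case (eng h1 h2)
  then obtain us vs where "snd ` set us \<subseteq> B" "word_eval G us = h1"
      "snd ` set vs \<subseteq> B" "word_eval G vs = h2"
    by blast
  then show ?case
    using assms by (intro exI[of _ "us @ vs"]) (auto simp: word_eval_append)
qed

end

text \<open>By induction on the length: freeness makes a nonempty word of trivial value non-reduced,
  so it contains a cancelling pair, and deleting this pair changes neither the value in
  \<open>F\<close> nor, after substitution, the value in \<open>E\<close>.\<close>

lemma word_eval_trivial_transfer:
  assumes F: "group F" and E: "group E" and B: "B \<subseteq> carrier F"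
    and free: "\<And>ws. \<lbrakk>ws \<noteq> []; reduced_word ws; snd ` set ws \<subseteq> B\<rbrakk> \<Longrightarrow> word_eval F ws \<noteq> \<one>\<^bsub>F\<^esub>"
    and f: "f ` B \<subseteq> carrier E"
    and "snd ` set ws \<subseteq> B" "word_eval F ws = \<one>\<^bsub>F\<^esub>"
  shows "word_eval E (map (apsnd f) ws) = \<one>\<^bsub>E\<^esub>"
  using assms(6,7)
proof (induction ws rule: length_induct)
  case (1 ws)
  interpret F: group F by fact
  interpret E: group E by fact
  show ?case
  proof (cases "ws = []")
    case False
    then have "\<not> reduced_word ws" using free 1 by blast
    then obtain us b a vs where ws: "ws = us @ (b, a) # (\<not> b, a) # vs"
      using not_reduced_word_cancel by blast
    then have sub: "snd ` set us \<subseteq> B" "snd ` set vs \<subseteq> B" "a \<in> B"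
      using 1 by auto
    then have "word_eval F (us @ vs) = \<one>\<^bsub>F\<^esub>"
      using 1(3) B F.word_eval_cancel[of us vs a b] unfolding ws by (metis subset_iff)
    then have "word_eval E (map (apsnd f) (us @ vs)) = \<one>\<^bsub>E\<^esub>"
      using 1(1)[rule_format, of "us @ vs"] sub by (simp add: ws image_Un)
    moreover have "snd ` set (map (apsnd f) us) \<subseteq> carrier E" "snd ` set (map (apsnd f) vs) \<subseteq> carrier E"
      "f a \<in> carrier E"
      using sub f by (auto simp: image_subset_iff)
    ultimately show ?thesis
      using E.word_eval_cancel[of "map (apsnd f) us" "map (apsnd f) vs" "f a" b] by (simp add: ws)
  qed auto
qed

text \<open>Preimages of the basis elements are chosen in \<open>E\<close> and words are evaluated
  on them. Two spellings of one element differ by a word of trivial value, which stays trivial in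
  \<open>E\<close>, so the result depends on the element only.\<close>

theorem free_group_projective:
  assumes "free_group F" and E: "group E" and G: "group G"
    and q: "q \<in> hom E G" "q ` carrier E = carrier G" and p: "p \<in> hom F G"
  shows "\<exists>h \<in> hom F E. \<forall>x \<in> carrier F. q (h x) = p x"
proof -
  obtain B where F: "group F" and B: "B \<subseteq> carrier F" and gen: "generate F B = carrier F"
    and free: "\<And>ws. \<lbrakk>ws \<noteq> []; reduced_word ws; snd ` set ws \<subseteq> B\<rbrakk> \<Longrightarrow> word_eval F ws \<noteq> \<one>\<^bsub>F\<^esub>"
    using assms(1) unfolding free_group_def by blast
  interpret F: group F by fact
  interpret E: group E by fact
  interpret G: group G by fact
  interpret q: group_hom E G q by unfold_locales (use q in auto)
  interpret p: group_hom F G p by unfold_locales (use p in auto)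
  have "\<forall>b \<in> B. \<exists>y \<in> carrier E. q y = p b"
    using q(2) B by (metis image_iff p.hom_closed subsetD)
  then obtain f where f: "\<And>b. b \<in> B \<Longrightarrow> f b \<in> carrier E" "\<And>b. b \<in> B \<Longrightarrow> q (f b) = p b"
    by metis
  have fB: "f ` B \<subseteq> carrier E" using f by auto
  let ?ev = "\<lambda>ws. word_eval E (map (apsnd f) ws)"
  have sE: "snd ` set (map (apsnd f) ws) \<subseteq> carrier E" if "snd ` set ws \<subseteq> B" for ws
    using that f by (auto simp: image_subset_iff)
  have sF: "snd ` set ws \<subseteq> carrier F" if "snd ` set ws \<subseteq> B" for ws
    using that B by auto
  have ev_cong: "?ev us = ?ev vs"
    if us: "snd ` set us \<subseteq> B" and vs: "snd ` set vs \<subseteq> B" and eq: "word_eval F us = word_eval F vs" for us vs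
  proof -
    let ?iv = "rev (map (apfst Not) vs)"
    have iv: "snd ` set ?iv \<subseteq> B" using vs by auto
    have "word_eval F (us @ ?iv) = \<one>\<^bsub>F\<^esub>"
      using F.word_eval_append[OF sF[OF us] sF[OF iv]] F.word_eval_inverse[OF sF[OF vs]]
        F.word_eval_closed[OF sF[OF vs]] eq by simp
    then have "?ev (us @ ?iv) = \<one>\<^bsub>E\<^esub>"
      by (rule word_eval_trivial_transfer[OF F E B free fB, rotated 4]) (use us vs in auto)
    moreover have "map (apsnd f) ?iv = rev (map (apfst Not) (map (apsnd f) vs))"
      by (simp add: rev_map comp_def apfst_def apsnd_def map_prod_def case_prod_unfold)
    ultimately have "?ev us \<otimes>\<^bsub>E\<^esub> inv\<^bsub>E\<^esub> (?ev vs) = \<one>\<^bsub>E\<^esub>"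
      using sE[OF us] sE[OF vs] sE[OF iv] E.word_eval_inverse[OF sE[OF vs]]
      by (metis E.word_eval_append map_append)
    then show ?thesis
      using E.word_eval_closed[OF sE[OF us]] E.word_eval_closed[OF sE[OF vs]]
      by (simp add: E.inv_solve_right')
  qed
  have ex: "\<exists>ws. snd ` set ws \<subseteq> B \<and> word_eval F ws = x" if "x \<in> carrier F" for x
    using F.generate_imp_word_eval[OF B] that gen by blast
  define W where "W x = (SOME ws. snd ` set ws \<subseteq> B \<and> word_eval F ws = x)" for x
  have W: "snd ` set (W x) \<subseteq> B" "word_eval F (W x) = x" if "x \<in> carrier F" for x
    using someI_ex[OF ex[OF that]] unfolding W_def by auto
  have "(\<lambda>x. ?ev (W x)) \<in> hom F E"
  proof (rule homI)
    show "?ev (W x) \<in> carrier E" if "x \<in> carrier F" for x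
      using E.word_eval_closed[OF sE[OF W(1)[OF that]]] .
    fix x y assume x: "x \<in> carrier F" and y: "y \<in> carrier F"
    have "?ev (W (x \<otimes>\<^bsub>F\<^esub> y)) = ?ev (W x @ W y)"
    proof (rule ev_cong)
      show "snd ` set (W (x \<otimes>\<^bsub>F\<^esub> y)) \<subseteq> B" "snd ` set (W x @ W y) \<subseteq> B"
        using W(1)[OF F.m_closed[OF x y]] W(1)[OF x] W(1)[OF y] by (auto simp: image_Un)
      show "word_eval F (W (x \<otimes>\<^bsub>F\<^esub> y)) = word_eval F (W x @ W y)"
        using F.word_eval_append[OF sF[OF W(1)[OF x]] sF[OF W(1)[OF y]]] x y by (simp add: W(2))
    qed
    then show "?ev (W (x \<otimes>\<^bsub>F\<^esub> y)) = ?ev (W x) \<otimes>\<^bsub>E\<^esub> ?ev (W y)"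
      using E.word_eval_append[OF sE[OF W(1)[OF x]] sE[OF W(1)[OF y]]] by simp
  qed
  moreover have "q (?ev ws) = p (word_eval F ws)" if "snd ` set ws \<subseteq> B" for ws
    using that
  proof (induction ws)
    case (Cons x ws)
    obtain b a where x: "x = (b, a)" by (cases x)
    have "?ev ws \<in> carrier E" "word_eval F ws \<in> carrier F" "a \<in> carrier F"
      using Cons.prems E.word_eval_closed[OF sE] F.word_eval_closed[OF sF] B by (auto simp: x)
    then show ?case using Cons f by (auto simp: x)
  qed auto
  then have "q (?ev (W x)) = p x" if "x \<in> carrier F" for x
    using W[OF that] by simp
  ultimately show ?thesis
    by (intro bexI[of _ "\<lambda>x. ?ev (W x)"] ballI)
qed

section \<open>Central extensions given by cocycles\<close>

text \<open>The factor-set model: \<open>g |-> (1, g)\<close> is a set-theoretic section whose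
  defect is exactly \<open>t\<close>.\<close>

definition cocycle_extension ::
  "('q, 'c) monoid_scheme \<Rightarrow> ('g, 'd) monoid_scheme \<Rightarrow> ('g \<Rightarrow> 'g \<Rightarrow> 'q) \<Rightarrow> ('q \<times> 'g) monoid" where
  "cocycle_extension Q G t =
     \<lparr>carrier = carrier Q \<times> carrier G,
      monoid.mult = (\<lambda>(a, g) (b, h). (a \<otimes>\<^bsub>Q\<^esub> b \<otimes>\<^bsub>Q\<^esub> t g h, g \<otimes>\<^bsub>G\<^esub> h)),
      one = (\<one>\<^bsub>Q\<^esub>, \<one>\<^bsub>G\<^esub>)\<rparr>"

locale cocycle = Q: comm_group Q + G: group G
  for Q :: "('q, 'c) monoid_scheme" (structure) and G :: "('g, 'd) monoid_scheme" (structure) +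
  fixes t :: "'g \<Rightarrow> 'g \<Rightarrow> 'q"
  assumes t_closed: "\<lbrakk>g \<in> carrier G; h \<in> carrier G\<rbrakk> \<Longrightarrow> t g h \<in> carrier Q"
    and t_cocycle: "\<lbrakk>g \<in> carrier G; h \<in> carrier G; k \<in> carrier G\<rbrakk>
      \<Longrightarrow> t g h \<otimes>\<^bsub>Q\<^esub> t (g \<otimes>\<^bsub>G\<^esub> h) k = t h k \<otimes>\<^bsub>Q\<^esub> t g (h \<otimes>\<^bsub>G\<^esub> k)"
    and t_one_one: "t \<one>\<^bsub>G\<^esub> \<one>\<^bsub>G\<^esub> = \<one>\<^bsub>Q\<^esub>"
begin

abbreviation E where "E \<equiv> cocycle_extension Q G t"

text \<open>The normalisation at one pair of units spreads to all pairs \<open>(1, g)\<close> by the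
  cocycle identity at the triple \<open>1, 1, g\<close>; the mirror image uses
  \<open>g, 1, 1\<close>.\<close>

lemma t_one_left: "g \<in> carrier G \<Longrightarrow> t \<one>\<^bsub>G\<^esub> g = \<one>\<^bsub>Q\<^esub>"
  using t_cocycle[of "\<one>\<^bsub>G\<^esub>" "\<one>\<^bsub>G\<^esub>" g] t_closed by (simp add: t_one_one)

lemma t_one_right: "g \<in> carrier G \<Longrightarrow> t g \<one>\<^bsub>G\<^esub> = \<one>\<^bsub>Q\<^esub>"
  using t_cocycle[of g "\<one>\<^bsub>G\<^esub>" "\<one>\<^bsub>G\<^esub>"] t_closed by (simp add: t_one_one)

lemma carrier_E: "carrier E = carrier Q \<times> carrier G"
  and mult_E: "(a, g) \<otimes>\<^bsub>E\<^esub> (b, h) = (a \<otimes>\<^bsub>Q\<^esub> b \<otimes>\<^bsub>Q\<^esub> t g h, g \<otimes>\<^bsub>G\<^esub> h)"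
  and one_E: "\<one>\<^bsub>E\<^esub> = (\<one>\<^bsub>Q\<^esub>, \<one>\<^bsub>G\<^esub>)"
  by (simp_all add: cocycle_extension_def)

lemma group_E: "group E"
proof (rule groupI)
  fix x y z assume "x \<in> carrier E" "y \<in> carrier E" "z \<in> carrier E"
  then obtain a g b h c k where *: "x = (a, g)" "y = (b, h)" "z = (c, k)"
    "a \<in> carrier Q" "b \<in> carrier Q" "c \<in> carrier Q" "g \<in> carrier G" "h \<in> carrier G" "k \<in> carrier G"
    by (auto simp: carrier_E)
  have "(a \<otimes>\<^bsub>Q\<^esub> b \<otimes>\<^bsub>Q\<^esub> t g h) \<otimes>\<^bsub>Q\<^esub> c \<otimes>\<^bsub>Q\<^esub> t (g \<otimes>\<^bsub>G\<^esub> h) k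
      = a \<otimes>\<^bsub>Q\<^esub> b \<otimes>\<^bsub>Q\<^esub> c \<otimes>\<^bsub>Q\<^esub> (t g h \<otimes>\<^bsub>Q\<^esub> t (g \<otimes>\<^bsub>G\<^esub> h) k)"
    using * by (simp add: t_closed Q.m_ac)
  also have "\<dots> = a \<otimes>\<^bsub>Q\<^esub> b \<otimes>\<^bsub>Q\<^esub> c \<otimes>\<^bsub>Q\<^esub> (t h k \<otimes>\<^bsub>Q\<^esub> t g (h \<otimes>\<^bsub>G\<^esub> k))"
    using * by (simp only: t_cocycle)
  also have "\<dots> = a \<otimes>\<^bsub>Q\<^esub> (b \<otimes>\<^bsub>Q\<^esub> c \<otimes>\<^bsub>Q\<^esub> t h k) \<otimes>\<^bsub>Q\<^esub> t g (h \<otimes>\<^bsub>G\<^esub> k)"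
    using * by (simp add: t_closed Q.m_ac)
  finally show "x \<otimes>\<^bsub>E\<^esub> y \<otimes>\<^bsub>E\<^esub> z = x \<otimes>\<^bsub>E\<^esub> (y \<otimes>\<^bsub>E\<^esub> z)"
    using * by (simp add: mult_E G.m_assoc)
next
  fix x assume "x \<in> carrier E"
  then obtain a g where *: "x = (a, g)" "a \<in> carrier Q" "g \<in> carrier G"
    by (auto simp: carrier_E)
  \<comment> \<open>The factor \<open>t (inv g) g\<close> is inverted in advance, since the product
    with \<open>x\<close> produces it.\<close>
  let ?y = "(inv\<^bsub>Q\<^esub> a \<otimes>\<^bsub>Q\<^esub> inv\<^bsub>Q\<^esub> t (inv\<^bsub>G\<^esub> g) g, inv\<^bsub>G\<^esub> g)"
  have "?y \<in> carrier E" using * by (simp add: carrier_E t_closed)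
  moreover have "?y \<otimes>\<^bsub>E\<^esub> x = \<one>\<^bsub>E\<^esub>"
  proof -
    let ?u = "t (inv\<^bsub>G\<^esub> g) g"
    have u: "?u \<in> carrier Q" using * by (simp add: t_closed)
    have "inv\<^bsub>Q\<^esub> a \<otimes>\<^bsub>Q\<^esub> inv\<^bsub>Q\<^esub> ?u \<otimes>\<^bsub>Q\<^esub> a \<otimes>\<^bsub>Q\<^esub> ?u = (inv\<^bsub>Q\<^esub> a \<otimes>\<^bsub>Q\<^esub> a) \<otimes>\<^bsub>Q\<^esub> (inv\<^bsub>Q\<^esub> ?u \<otimes>\<^bsub>Q\<^esub> ?u)"
      using * u by (simp only: Q.m_ac Q.inv_closed Q.m_closed)
    then show ?thesis using * u by (simp add: mult_E one_E)
  qed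
  ultimately show "\<exists>y\<in>carrier E. y \<otimes>\<^bsub>E\<^esub> x = \<one>\<^bsub>E\<^esub>" by blast
  show "\<one>\<^bsub>E\<^esub> \<otimes>\<^bsub>E\<^esub> x = x"
    using * by (simp add: mult_E one_E t_one_left)
qed (auto simp: carrier_E mult_E one_E t_closed)

lemma snd_hom_E: "snd \<in> hom E G"
  by (rule homI) (auto simp: carrier_E mult_E)

lemma central_E:
  assumes "a \<in> carrier Q" "x \<in> carrier E"
  shows "(a, \<one>\<^bsub>G\<^esub>) \<otimes>\<^bsub>E\<^esub> x = x \<otimes>\<^bsub>E\<^esub> (a, \<one>\<^bsub>G\<^esub>)"
  using assms by (auto simp: carrier_E mult_E t_one_left t_one_right Q.m_ac)

text \<open>Centrality lets the values of \<open>r\<close> pass those of \<open>S\<close>, and then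
  the defect of \<open>S\<close> absorbs the cocycle term. Composed with the lift of
  \<open>F\<close>, this turns homomorphisms on \<open>Q\<close> into homomorphisms on
  \<open>F\<close>.\<close>

lemma hom_E:
  assumes Y: "group Y" and r: "r \<in> hom Q Y" and S: "S \<in> carrier G \<rightarrow> carrier Y"
    and central: "\<And>q y. \<lbrakk>q \<in> carrier Q; y \<in> carrier Y\<rbrakk> \<Longrightarrow> r q \<otimes>\<^bsub>Y\<^esub> y = y \<otimes>\<^bsub>Y\<^esub> r q"
    and rt: "\<And>g h. \<lbrakk>g \<in> carrier G; h \<in> carrier G\<rbrakk> \<Longrightarrow> r (t g h) \<otimes>\<^bsub>Y\<^esub> S (g \<otimes>\<^bsub>G\<^esub> h) = S g \<otimes>\<^bsub>Y\<^esub> S h"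
  shows "(\<lambda>x. r (fst x) \<otimes>\<^bsub>Y\<^esub> S (snd x)) \<in> hom E Y"
proof -
  interpret Y: group Y by fact
  have rc: "r q \<in> carrier Y" if "q \<in> carrier Q" for q using r that by (auto simp: hom_def)
  have Sc: "S g \<in> carrier Y" if "g \<in> carrier G" for g using S that by auto
  have rm: "r (p \<otimes>\<^bsub>Q\<^esub> q) = r p \<otimes>\<^bsub>Y\<^esub> r q" if "p \<in> carrier Q" "q \<in> carrier Q" for p q
    using r that by (auto simp: hom_def)
  show ?thesis
  proof (rule homI)
    fix x y assume "x \<in> carrier E" "y \<in> carrier E"
    then obtain a g b h where *: "x = (a, g)" "y = (b, h)"
      "a \<in> carrier Q" "b \<in> carrier Q" "g \<in> carrier G" "h \<in> carrier G"
      by (auto simp: carrier_E)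
    have "r (a \<otimes>\<^bsub>Q\<^esub> b \<otimes>\<^bsub>Q\<^esub> t g h) \<otimes>\<^bsub>Y\<^esub> S (g \<otimes>\<^bsub>G\<^esub> h) = r a \<otimes>\<^bsub>Y\<^esub> (r b \<otimes>\<^bsub>Y\<^esub> S g) \<otimes>\<^bsub>Y\<^esub> S h"
      using * by (simp add: rm t_closed rc Sc rt Y.m_assoc)
    also have "r b \<otimes>\<^bsub>Y\<^esub> S g = S g \<otimes>\<^bsub>Y\<^esub> r b"
      using * by (simp add: central Sc)
    finally show "r (fst (x \<otimes>\<^bsub>E\<^esub> y)) \<otimes>\<^bsub>Y\<^esub> S (snd (x \<otimes>\<^bsub>E\<^esub> y)) =
       r (fst x) \<otimes>\<^bsub>Y\<^esub> S (snd x) \<otimes>\<^bsub>Y\<^esub> (r (fst y) \<otimes>\<^bsub>Y\<^esub> S (snd y))"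
      using * by (simp add: mult_E rc Sc Y.m_assoc)
  qed (auto simp: carrier_E rc Sc)
qed

end

section \<open>Homomorphisms on the commutator subgroup, and the centre\<close>

lemma hom_derived_trivial:
  assumes F: "group F" and Y: "comm_group Y" and h: "h \<in> hom F Y" and x: "x \<in> derived F (carrier F)"
  shows "h x = \<one>\<^bsub>Y\<^esub>"
proof -
  interpret F: group F by fact
  interpret Y: comm_group Y by fact
  interpret h: group_hom F Y h by unfold_locales (use h in auto)
  have "h x \<in> derived Y (h ` carrier F)"
    using h.derived_img[of "carrier F"] x by blast
  also have "\<dots> = {\<one>\<^bsub>Y\<^esub>}"
    using Y.derived_eq_singleton[of "h ` carrier F"] h.hom_closed by blast
  finally show ?thesis by simp
qed

definition group_center :: "('a, 'b) monoid_scheme \<Rightarrow> 'a set" where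
  "group_center Y = {z \<in> carrier Y. \<forall>y \<in> carrier Y. z \<otimes>\<^bsub>Y\<^esub> y = y \<otimes>\<^bsub>Y\<^esub> z}"

context group
begin

lemma group_centerI:
  "\<lbrakk>z \<in> carrier G; \<And>y. y \<in> carrier G \<Longrightarrow> z \<otimes> y = y \<otimes> z\<rbrakk> \<Longrightarrow> z \<in> group_center G"
  unfolding group_center_def by blast

lemma group_center_carrier: "z \<in> group_center G \<Longrightarrow> z \<in> carrier G"
  unfolding group_center_def by blast

lemma group_center_comm: "\<lbrakk>z \<in> group_center G; y \<in> carrier G\<rbrakk> \<Longrightarrow> z \<otimes> y = y \<otimes> z"
  unfolding group_center_def by blast

lemma subgroup_group_center: "subgroup (group_center G) G"
proof
  show "group_center G \<subseteq> carrier G" using group_center_carrier by blast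
  show "\<one> \<in> group_center G" by (rule group_centerI) auto
  show "a \<otimes> b \<in> group_center G" if ab: "a \<in> group_center G" "b \<in> group_center G" for a b
    by (rule group_centerI)
      (metis m_closed group_center_carrier ab, metis m_assoc group_center_carrier group_center_comm ab)
  show "inv a \<in> group_center G" if a: "a \<in> group_center G" for a
    by (rule group_centerI)
      (metis inv_closed group_center_carrier a,
       metis inv_closed inv_inv inv_mult_group group_center_carrier group_center_comm a)
qed

lemma comm_group_group_center: "comm_group (G\<lparr>carrier := group_center G\<rparr>)"
  by (rule group.group_comm_groupI[OF subgroup_imp_group[OF subgroup_group_center]])
    (simp, rule group_center_comm, assumption, rule group_center_carrier)

end

text \<open>Two homomorphisms that agree modulo the centre differ by a homomorphism into an abelian
  group.\<close>

lemma hom_eq_on_derived: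
  assumes F: "group F" and Y: "group Y" and h: "h \<in> hom F Y" "k \<in> hom F Y"
    and central: "\<And>x. x \<in> carrier F \<Longrightarrow> h x \<otimes>\<^bsub>Y\<^esub> inv\<^bsub>Y\<^esub> k x \<in> group_center Y"
    and x: "x \<in> derived F (carrier F)"
  shows "h x = k x"
proof -
  interpret F: group F by fact
  interpret Y: group Y by fact
  interpret h: group_hom F Y h by unfold_locales (use h in auto)
  interpret k: group_hom F Y k by unfold_locales (use h in auto)
  let ?Y = "Y\<lparr>carrier := group_center Y\<rparr>"
  have "(\<lambda>x. h x \<otimes>\<^bsub>Y\<^esub> inv\<^bsub>Y\<^esub> k x) \<in> hom F ?Y"
  proof (rule homI)
    show "h x \<otimes>\<^bsub>Y\<^esub> inv\<^bsub>Y\<^esub> k x \<in> carrier ?Y" if "x \<in> carrier F" for x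
      using central[OF that] by simp
  next
    fix x y assume xy: "x \<in> carrier F" "y \<in> carrier F"
    have "h (x \<otimes>\<^bsub>F\<^esub> y) \<otimes>\<^bsub>Y\<^esub> inv\<^bsub>Y\<^esub> k (x \<otimes>\<^bsub>F\<^esub> y) = h x \<otimes>\<^bsub>Y\<^esub> ((h y \<otimes>\<^bsub>Y\<^esub> inv\<^bsub>Y\<^esub> k y) \<otimes>\<^bsub>Y\<^esub> inv\<^bsub>Y\<^esub> k x)"
      using xy by (simp add: Y.inv_mult_group Y.m_assoc)
    also have "\<dots> = h x \<otimes>\<^bsub>Y\<^esub> (inv\<^bsub>Y\<^esub> k x \<otimes>\<^bsub>Y\<^esub> (h y \<otimes>\<^bsub>Y\<^esub> inv\<^bsub>Y\<^esub> k y))"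
      using Y.group_center_comm[OF central[OF xy(2)], of "inv\<^bsub>Y\<^esub> k x"] xy by simp
    finally show "h (x \<otimes>\<^bsub>F\<^esub> y) \<otimes>\<^bsub>Y\<^esub> inv\<^bsub>Y\<^esub> k (x \<otimes>\<^bsub>F\<^esub> y)
        = (h x \<otimes>\<^bsub>Y\<^esub> inv\<^bsub>Y\<^esub> k x) \<otimes>\<^bsub>?Y\<^esub> (h y \<otimes>\<^bsub>Y\<^esub> inv\<^bsub>Y\<^esub> k y)"
      using xy by (simp add: Y.m_assoc del: h.hom_mult k.hom_mult)
  qed
  then have "h x \<otimes>\<^bsub>Y\<^esub> inv\<^bsub>Y\<^esub> k x = \<one>\<^bsub>?Y\<^esub>"
    using hom_derived_trivial[OF F Y.comm_group_group_center _ x] by blast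
  moreover have "x \<in> carrier F"
    using F.derived_in_carrier x by blast
  ultimately show ?thesis
    by (simp add: Y.inv_solve_right')
qed

section \<open>Pairs of spaces with labelled edges\<close>

text \<open>Face \<open>k\<close> omits vertex \<open>k\<close>: the source of an edge is its face
  1, and the edge 02 of a triangle is its face 1 as well.\<close>

definition "edge_src \<sigma> = singular_face 1 1 \<sigma>"
definition "edge_tgt \<sigma> = singular_face 1 0 \<sigma>"
definition "tri_01 \<tau> = singular_face 2 2 \<tau>"
definition "tri_02 \<tau> = singular_face 2 1 \<tau>"
definition "tri_12 \<tau> = singular_face 2 0 \<tau>"

text \<open>Both sides precompose with the inclusion missing the vertices \<open>i\<close> and
  \<open>Suc j\<close>. Off the simplex both are undefined by \<open>restrict\<close>, so the
  simplicial identity is an equality of functions.\<close>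

lemma singular_face_singular_face:
  assumes "i \<le> j" "j < p" "2 \<le> p"
  shows "singular_face (p - 1) i (singular_face p (Suc j) f) = singular_face (p - 1) j (singular_face p i f)"
proof
  fix x
  show "singular_face (p - 1) i (singular_face p (Suc j) f) x = singular_face (p - 1) j (singular_face p i f) x"
  proof (cases "x \<in> standard_simplex (p - 1 - 1)")
    case True
    then have "simplical_face i x \<in> standard_simplex (p - 1)" "simplical_face j x \<in> standard_simplex (p - 1)"
      using assms by (auto intro!: simplical_face_in_standard_simplex)
    moreover have "simplical_face (Suc j) (simplical_face i x) = simplical_face i (simplical_face j x)"
      using assms by (auto simp: simplical_face_def fun_eq_iff)
    ultimately show ?thesis
      using True by (simp add: singular_face_def)
  qed (simp add: singular_face_def)
qed

lemma edge_simps: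
  "edge_src (tri_02 \<tau>) = edge_src (tri_01 \<tau>)"
  "edge_tgt (tri_01 \<tau>) = edge_src (tri_12 \<tau>)"
  "edge_tgt (tri_02 \<tau>) = edge_tgt (tri_12 \<tau>)"
  using singular_face_singular_face[of 1 1 2 \<tau>] singular_face_singular_face[of 0 1 2 \<tau>]
    singular_face_singular_face[of 0 0 2 \<tau>]
  by (simp_all add: edge_src_def edge_tgt_def tri_01_def tri_02_def tri_12_def numeral_2_eq_2)

lemma tetrahedron_edges:
  "tri_01 (singular_face 3 3 \<theta>) = tri_01 (singular_face 3 2 \<theta>)"
  "tri_02 (singular_face 3 3 \<theta>) = tri_01 (singular_face 3 1 \<theta>)"
  "tri_02 (singular_face 3 2 \<theta>) = tri_02 (singular_face 3 1 \<theta>)"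
  "tri_12 (singular_face 3 3 \<theta>) = tri_01 (singular_face 3 0 \<theta>)"
  "tri_12 (singular_face 3 2 \<theta>) = tri_02 (singular_face 3 0 \<theta>)"
  "tri_12 (singular_face 3 1 \<theta>) = tri_12 (singular_face 3 0 \<theta>)"
  using singular_face_singular_face[of 2 2 3 \<theta>] singular_face_singular_face[of 1 2 3 \<theta>]
    singular_face_singular_face[of 1 1 3 \<theta>] singular_face_singular_face[of 0 2 3 \<theta>]
    singular_face_singular_face[of 0 1 3 \<theta>] singular_face_singular_face[of 0 0 3 \<theta>]
  by (simp_all add: tri_01_def tri_02_def tri_12_def numeral_2_eq_2 numeral_3_eq_3)

lemma singular_simplex_edge:
  assumes "singular_simplex 1 Z \<sigma>"
  shows "singular_simplex 0 Z (edge_src \<sigma>)" "singular_simplex 0 Z (edge_tgt \<sigma>)"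
  using singular_simplex_singular_face[OF assms, of 0] singular_simplex_singular_face[OF assms, of 1]
  by (simp_all add: edge_src_def edge_tgt_def)

lemma singular_simplex_tri:
  assumes "singular_simplex 2 Z \<tau>"
  shows "singular_simplex 1 Z (tri_01 \<tau>)" "singular_simplex 1 Z (tri_02 \<tau>)" "singular_simplex 1 Z (tri_12 \<tau>)"
  using singular_simplex_singular_face[OF assms, of 0] singular_simplex_singular_face[OF assms, of 1]
    singular_simplex_singular_face[OF assms, of 2]
  by (simp_all add: tri_01_def tri_02_def tri_12_def numeral_2_eq_2)

lemma singular_simplex_tetra:
  assumes "singular_simplex 3 Z \<theta>" "k \<le> 3"
  shows "singular_simplex 2 Z (singular_face 3 k \<theta>)"
  using singular_simplex_singular_face[OF assms(1) _ assms(2)] by (simp add: numeral_2_eq_2 numeral_3_eq_3)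

lemma chain_boundary_2:
  "chain_boundary 2 (frag_of \<tau>) = frag_of (tri_12 \<tau>) - frag_of (tri_02 \<tau>) + frag_of (tri_01 \<tau>)"
proof -
  have "{..2::nat} = {0, 1, 2}" by auto
  then show ?thesis
    by (simp add: chain_boundary_of tri_01_def tri_02_def tri_12_def)
qed

lemma chain_boundary_3:
  "chain_boundary 3 (frag_of \<theta>) = frag_of (singular_face 3 0 \<theta>) - frag_of (singular_face 3 1 \<theta>)
     + frag_of (singular_face 3 2 \<theta>) - frag_of (singular_face 3 3 \<theta>)"
proof -
  have "{..3::nat} = {0, 1, 2, 3}" by auto
  then show ?thesis
    by (simp add: chain_boundary_of)
qed

text \<open>The combinatorial extract of the topology. \<open>gv_tri\<close> says that the labelling
  is flat, \<open>tri_ex\<close> that labels determine paths up to homotopy, and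
  \<open>tetra_ex\<close> that the second homotopy group vanishes. The assumptions ending in
  \<open>_sub\<close> say that \<open>A\<close> behaves like a circle whose loops are labelled by
  powers of \<open>w\<close>.\<close>

locale aspherical_pair = group G
  for G :: "('g, 'd) monoid_scheme" (structure) +
  fixes M :: "'m topology" and A :: "'m set" and gv :: "((nat \<Rightarrow> real) \<Rightarrow> 'm) \<Rightarrow> 'g" and w :: 'g
  assumes w_closed: "w \<in> carrier G"
    and w_inf: "\<And>k::int. w [^] k = \<one> \<Longrightarrow> k = 0"
    and gv_closed: "singular_simplex 1 M \<sigma> \<Longrightarrow> gv \<sigma> \<in> carrier G"
    and gv_tri: "singular_simplex 2 M \<tau> \<Longrightarrow> gv (tri_01 \<tau>) \<otimes> gv (tri_12 \<tau>) = gv (tri_02 \<tau>)"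
    and edge_ex: "\<lbrakk>singular_simplex 0 M x; singular_simplex 0 M y; g \<in> carrier G\<rbrakk>
      \<Longrightarrow> \<exists>\<sigma>. singular_simplex 1 M \<sigma> \<and> edge_src \<sigma> = x \<and> edge_tgt \<sigma> = y \<and> gv \<sigma> = g"
    and tri_ex: "\<lbrakk>singular_simplex 1 M \<alpha>; singular_simplex 1 M \<beta>; singular_simplex 1 M \<delta>;
        edge_src \<alpha> = edge_src \<delta>; edge_tgt \<alpha> = edge_src \<beta>; edge_tgt \<beta> = edge_tgt \<delta>;
        gv \<alpha> \<otimes> gv \<beta> = gv \<delta>\<rbrakk>
      \<Longrightarrow> \<exists>\<tau>. singular_simplex 2 M \<tau> \<and> tri_01 \<tau> = \<alpha> \<and> tri_12 \<tau> = \<beta> \<and> tri_02 \<tau> = \<delta>"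
    and tetra_ex: "\<lbrakk>singular_simplex 2 M a; singular_simplex 2 M b; singular_simplex 2 M c; singular_simplex 2 M d;
        tri_01 a = tri_01 b; tri_02 a = tri_01 c; tri_02 b = tri_02 c;
        tri_12 a = tri_01 d; tri_12 b = tri_02 d; tri_12 c = tri_12 d\<rbrakk>
      \<Longrightarrow> \<exists>\<theta>. singular_simplex 3 M \<theta> \<and> singular_face 3 3 \<theta> = a \<and> singular_face 3 2 \<theta> = b \<and>
             singular_face 3 1 \<theta> = c \<and> singular_face 3 0 \<theta> = d"
    and gv_sub: "singular_simplex 1 (subtopology M A) \<sigma> \<Longrightarrow> \<exists>k::int. gv \<sigma> = w [^] k"
    and edge_sub: "\<And>k::int. \<lbrakk>singular_simplex 0 (subtopology M A) x; singular_simplex 0 (subtopology M A) y\<rbrakk>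
      \<Longrightarrow> \<exists>\<sigma>. singular_simplex 1 (subtopology M A) \<sigma> \<and> edge_src \<sigma> = x \<and> edge_tgt \<sigma> = y \<and> gv \<sigma> = w [^] k"
    and tri_sub: "\<lbrakk>singular_simplex 1 (subtopology M A) \<alpha>; singular_simplex 1 (subtopology M A) \<beta>;
        singular_simplex 1 (subtopology M A) \<delta>;
        edge_src \<alpha> = edge_src \<delta>; edge_tgt \<alpha> = edge_src \<beta>; edge_tgt \<beta> = edge_tgt \<delta>;
        gv \<alpha> \<otimes> gv \<beta> = gv \<delta>\<rbrakk>
      \<Longrightarrow> \<exists>\<tau>. singular_simplex 2 (subtopology M A) \<tau> \<and> tri_01 \<tau> = \<alpha> \<and> tri_12 \<tau> = \<beta> \<and> tri_02 \<tau> = \<delta>"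
    and point_sub: "\<exists>x. singular_simplex 0 (subtopology M A) x"
begin

section \<open>Choices of edges and triangles compatible with \<open>A\<close>, and the
  prism\<close>

definition "W = range (\<lambda>k::int. w [^] k)"

lemma W_carrier: "g \<in> W \<Longrightarrow> g \<in> carrier G"
  by (auto simp: W_def w_closed)

lemma W_one: "\<one> \<in> W"
  unfolding W_def by (rule range_eqI[of _ _ 0]) simp

lemma W_mult: "\<lbrakk>g \<in> W; h \<in> W\<rbrakk> \<Longrightarrow> g \<otimes> h \<in> W"
  by (auto simp: W_def simp flip: int_pow_mult[OF w_closed])

lemma w_pow_inj: "w [^] (j::int) = w [^] k \<Longrightarrow> j = k"
  using w_inf[of "j - k"] by (simp add: w_closed int_pow_diff)

lemma sub_simplex: "singular_simplex p (subtopology M A) f \<Longrightarrow> singular_simplex p M f"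
  by (simp add: singular_simplex_subtopology)

abbreviation S where "S p \<equiv> singular_simplex p M"
abbreviation SA where "SA p \<equiv> singular_simplex p (subtopology M A)"

text \<open>A single choice serves \<open>M\<close> and \<open>A\<close> at once: the edge lies in
  \<open>A\<close> whenever its ends and its label allow this. Chains built from such edges and from
  the triangles \<open>tr\<close> over them then vanish modulo \<open>C_2(A)\<close>.\<close>

definition "ed x y g = (SOME \<sigma>. S 1 \<sigma> \<and> edge_src \<sigma> = x \<and> edge_tgt \<sigma> = y \<and> gv \<sigma> = g \<and>
   (SA 0 x \<and> SA 0 y \<and> g \<in> W \<longrightarrow> SA 1 \<sigma>))"

lemma ed:
  assumes "S 0 x" "S 0 y" "g \<in> carrier G"
  shows "S 1 (ed x y g)" "edge_src (ed x y g) = x" "edge_tgt (ed x y g) = y" "gv (ed x y g) = g"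
    "\<lbrakk>SA 0 x; SA 0 y; g \<in> W\<rbrakk> \<Longrightarrow> SA 1 (ed x y g)"
proof -
  have "\<exists>\<sigma>. S 1 \<sigma> \<and> edge_src \<sigma> = x \<and> edge_tgt \<sigma> = y \<and> gv \<sigma> = g \<and> (SA 0 x \<and> SA 0 y \<and> g \<in> W \<longrightarrow> SA 1 \<sigma>)"
  proof (cases "SA 0 x \<and> SA 0 y \<and> g \<in> W")
    case True
    then obtain k :: int where "g = w [^] k" by (auto simp: W_def)
    then show ?thesis using edge_sub[of x y k] True sub_simplex by blast
  next
    case False
    then show ?thesis using edge_ex[OF assms] by blast
  qed
  then have "S 1 (ed x y g) \<and> edge_src (ed x y g) = x \<and> edge_tgt (ed x y g) = y \<and> gv (ed x y g) = g \<and>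
     (SA 0 x \<and> SA 0 y \<and> g \<in> W \<longrightarrow> SA 1 (ed x y g))"
    unfolding ed_def by (rule someI_ex)
  then show "S 1 (ed x y g)" "edge_src (ed x y g) = x" "edge_tgt (ed x y g) = y" "gv (ed x y g) = g"
    "\<lbrakk>SA 0 x; SA 0 y; g \<in> W\<rbrakk> \<Longrightarrow> SA 1 (ed x y g)" by blast+
qed

definition "tr \<alpha> \<beta> \<delta> = (SOME \<tau>. S 2 \<tau> \<and> tri_01 \<tau> = \<alpha> \<and> tri_12 \<tau> = \<beta> \<and> tri_02 \<tau> = \<delta> \<and>
   (SA 1 \<alpha> \<and> SA 1 \<beta> \<and> SA 1 \<delta> \<longrightarrow> SA 2 \<tau>))"

lemma tr:
  assumes "S 1 \<alpha>" "S 1 \<beta>" "S 1 \<delta>"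
    "edge_src \<alpha> = edge_src \<delta>" "edge_tgt \<alpha> = edge_src \<beta>" "edge_tgt \<beta> = edge_tgt \<delta>"
    "gv \<alpha> \<otimes> gv \<beta> = gv \<delta>"
  shows "S 2 (tr \<alpha> \<beta> \<delta>)" "tri_01 (tr \<alpha> \<beta> \<delta>) = \<alpha>" "tri_12 (tr \<alpha> \<beta> \<delta>) = \<beta>" "tri_02 (tr \<alpha> \<beta> \<delta>) = \<delta>"
    "\<lbrakk>SA 1 \<alpha>; SA 1 \<beta>; SA 1 \<delta>\<rbrakk> \<Longrightarrow> SA 2 (tr \<alpha> \<beta> \<delta>)"
proof -
  have "\<exists>\<tau>. S 2 \<tau> \<and> tri_01 \<tau> = \<alpha> \<and> tri_12 \<tau> = \<beta> \<and> tri_02 \<tau> = \<delta> \<and> (SA 1 \<alpha> \<and> SA 1 \<beta> \<and> SA 1 \<delta> \<longrightarrow> SA 2 \<tau>)"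
  proof (cases "SA 1 \<alpha> \<and> SA 1 \<beta> \<and> SA 1 \<delta>")
    case True
    then show ?thesis using tri_sub[of \<alpha> \<beta> \<delta>] assms sub_simplex by blast
  next
    case False
    then show ?thesis using tri_ex[OF assms] by blast
  qed
  then have "S 2 (tr \<alpha> \<beta> \<delta>) \<and> tri_01 (tr \<alpha> \<beta> \<delta>) = \<alpha> \<and> tri_12 (tr \<alpha> \<beta> \<delta>) = \<beta> \<and> tri_02 (tr \<alpha> \<beta> \<delta>) = \<delta> \<and>
     (SA 1 \<alpha> \<and> SA 1 \<beta> \<and> SA 1 \<delta> \<longrightarrow> SA 2 (tr \<alpha> \<beta> \<delta>))"
    unfolding tr_def by (rule someI_ex)
  then show "S 2 (tr \<alpha> \<beta> \<delta>)" "tri_01 (tr \<alpha> \<beta> \<delta>) = \<alpha>" "tri_12 (tr \<alpha> \<beta> \<delta>) = \<beta>" "tri_02 (tr \<alpha> \<beta> \<delta>) = \<delta>"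
    "\<lbrakk>SA 1 \<alpha>; SA 1 \<beta>; SA 1 \<delta>\<rbrakk> \<Longrightarrow> SA 2 (tr \<alpha> \<beta> \<delta>)" by blast+
qed

definition "pt = (SOME x. SA 0 x)"
definition "e g = ed pt pt g"
definition "t g h = tr (e g) (e h) (e (g \<otimes> h))"
text \<open>These build a square over an edge \<sigma>: its bottom is the loop
  \<open>e (gv \<sigma>)\<close> at \<open>pt\<close>, its top is \<sigma>, its vertical sides are
  the edges \<open>p_edge\<close> of trivial label, and \<open>d_edge \<sigma>\<close> is its
  diagonal. \<open>U \<sigma>\<close> and \<open>V \<sigma>\<close> are the triangles above and
  below the diagonal, and \<open>q_chain \<sigma>\<close> is the square as a 2-chain.\<close>

definition "p_edge x = ed pt x \<one>"
definition "d_edge \<sigma> = ed pt (edge_tgt \<sigma>) (gv \<sigma>)"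
definition "U \<sigma> = tr (p_edge (edge_src \<sigma>)) \<sigma> (d_edge \<sigma>)"
definition "V \<sigma> = tr (e (gv \<sigma>)) (p_edge (edge_tgt \<sigma>)) (d_edge \<sigma>)"
definition "q_chain \<sigma> = frag_of (U \<sigma>) - frag_of (V \<sigma>)"

lemma pt: "SA 0 pt" "S 0 pt"
  using someI_ex[OF point_sub] sub_simplex unfolding pt_def by auto

lemma e:
  assumes "g \<in> carrier G"
  shows "S 1 (e g)" "edge_src (e g) = pt" "edge_tgt (e g) = pt" "gv (e g) = g" "g \<in> W \<Longrightarrow> SA 1 (e g)"
  using ed[OF pt(2) pt(2) assms] pt unfolding e_def by auto

lemma t:
  assumes "g \<in> carrier G" "h \<in> carrier G"
  shows "S 2 (t g h)" "tri_01 (t g h) = e g" "tri_12 (t g h) = e h" "tri_02 (t g h) = e (g \<otimes> h)"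
    "\<lbrakk>g \<in> W; h \<in> W\<rbrakk> \<Longrightarrow> SA 2 (t g h)"
  using tr[of "e g" "e h" "e (g \<otimes> h)"] e assms W_mult unfolding t_def by auto

lemma p_edge:
  assumes "S 0 x"
  shows "S 1 (p_edge x)" "edge_src (p_edge x) = pt" "edge_tgt (p_edge x) = x" "gv (p_edge x) = \<one>"
    "SA 0 x \<Longrightarrow> SA 1 (p_edge x)"
  using ed[OF pt(2) assms, of \<one>] pt W_one unfolding p_edge_def by auto

lemma gv_W: "SA 1 \<sigma> \<Longrightarrow> gv \<sigma> \<in> W"
  using gv_sub by (auto simp: W_def)

lemma d_edge:
  assumes "S 1 \<sigma>"
  shows "S 1 (d_edge \<sigma>)" "edge_src (d_edge \<sigma>) = pt" "edge_tgt (d_edge \<sigma>) = edge_tgt \<sigma>"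
    "gv (d_edge \<sigma>) = gv \<sigma>" "SA 1 \<sigma> \<Longrightarrow> SA 1 (d_edge \<sigma>)"
  using ed[OF pt(2) singular_simplex_edge(2)[OF assms] gv_closed[OF assms]] pt gv_W
    singular_simplex_edge(2) unfolding d_edge_def by auto

lemma U:
  assumes "S 1 \<sigma>"
  shows "S 2 (U \<sigma>)" "tri_01 (U \<sigma>) = p_edge (edge_src \<sigma>)" "tri_12 (U \<sigma>) = \<sigma>" "tri_02 (U \<sigma>) = d_edge \<sigma>"
    "SA 1 \<sigma> \<Longrightarrow> SA 2 (U \<sigma>)"
  using tr[of "p_edge (edge_src \<sigma>)" \<sigma> "d_edge \<sigma>"] assms p_edge[OF singular_simplex_edge(1)[OF assms]]
    d_edge[OF assms] gv_closed[OF assms] singular_simplex_edge(1) unfolding U_def by auto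

lemma V:
  assumes "S 1 \<sigma>"
  shows "S 2 (V \<sigma>)" "tri_01 (V \<sigma>) = e (gv \<sigma>)" "tri_12 (V \<sigma>) = p_edge (edge_tgt \<sigma>)" "tri_02 (V \<sigma>) = d_edge \<sigma>"
    "SA 1 \<sigma> \<Longrightarrow> SA 2 (V \<sigma>)"
  using tr[of "e (gv \<sigma>)" "p_edge (edge_tgt \<sigma>)" "d_edge \<sigma>"] assms p_edge[OF singular_simplex_edge(2)[OF assms]]
    d_edge[OF assms] gv_closed[OF assms] singular_simplex_edge(2) e[OF gv_closed[OF assms]] gv_W
  unfolding V_def by auto

lemma q_chain: "S 1 \<sigma> \<Longrightarrow> singular_chain 2 M (q_chain \<sigma>)"
  and q_chain_sub: "SA 1 \<sigma> \<Longrightarrow> singular_chain 2 (subtopology M A) (q_chain \<sigma>)"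
  using U V sub_simplex unfolding q_chain_def
  by (auto intro!: singular_chain_diff simp: singular_chain_of)

text \<open>The triangles \<open>a\<close>, \<open>b\<close>, \<open>c\<close>, \<open>d\<close> lie
  opposite the vertices 3, 2, 1, 0 of a tetrahedron, which exists by
  \<open>tetra_ex\<close>.\<close>

lemma tetra_boundary:
  assumes "S 2 a" "S 2 b" "S 2 c" "S 2 d"
    "tri_01 a = tri_01 b" "tri_02 a = tri_01 c" "tri_02 b = tri_02 c"
    "tri_12 a = tri_01 d" "tri_12 b = tri_02 d" "tri_12 c = tri_12 d"
  shows "singular_relboundary 2 M A (frag_of d - frag_of c + frag_of b - frag_of a)"
proof -
  obtain \<theta> where th: "S 3 \<theta>" "singular_face 3 3 \<theta> = a" "singular_face 3 2 \<theta> = b"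
      "singular_face 3 1 \<theta> = c" "singular_face 3 0 \<theta> = d"
    using tetra_ex[OF assms] by blast
  then have "chain_boundary 3 (frag_of \<theta>) = frag_of d - frag_of c + frag_of b - frag_of a"
    by (simp add: chain_boundary_3)
  moreover have "singular_chain 3 M (frag_of \<theta>)"
    using th by (simp add: singular_chain_of)
  ultimately show ?thesis
    unfolding singular_relboundary_def
    by (intro exI[of _ "frag_of \<theta>"]) (simp add: numeral_3_eq_3 numeral_2_eq_2)
qed

text \<open>The four triangles are the faces of a tetrahedron whose edges 01, 12, 23 are
  \<open>e g\<close>, \<open>e h\<close>, \<open>e k\<close>.\<close>

lemma t_cocycle_rel:
  assumes "g \<in> carrier G" "h \<in> carrier G" "k \<in> carrier G"
  shows "homologous_rel 2 M A (frag_of (t g h) + frag_of (t (g \<otimes> h) k)) (frag_of (t h k) + frag_of (t g (h \<otimes> k)))"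
proof -
  have "singular_relboundary 2 M A (frag_of (t h k) - frag_of (t (g \<otimes> h) k) + frag_of (t g (h \<otimes> k)) - frag_of (t g h))"
    by (rule tetra_boundary) (use assms in \<open>simp_all add: t m_assoc\<close>)
  then have "homologous_rel 2 M A (frag_of (t h k) + frag_of (t g (h \<otimes> k))) (frag_of (t g h) + frag_of (t (g \<otimes> h) k))"
    unfolding homologous_rel_def by (simp add: algebra_simps)
  then show ?thesis by (simp add: homologous_rel_sym)
qed

text \<open>The prism between a 2-simplex and the standard one with the same edge labels, cut into
  three tetrahedra.\<close>

lemma prism:
  assumes \<tau>: "S 2 \<tau>"
  shows "homologous_rel 2 M A (frag_of \<tau>)
     (frag_of (t (gv (tri_01 \<tau>)) (gv (tri_12 \<tau>))) + q_chain (tri_01 \<tau>) + q_chain (tri_12 \<tau>) - q_chain (tri_02 \<tau>))"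
proof -
  define \<alpha> \<beta> \<delta> where "\<alpha> = tri_01 \<tau>" and "\<beta> = tri_12 \<tau>" and "\<delta> = tri_02 \<tau>"
  have S: "S 1 \<alpha>" "S 1 \<beta>" "S 1 \<delta>"
    using singular_simplex_tri[OF \<tau>] by (auto simp: \<alpha>_def \<beta>_def \<delta>_def)
  have E: "edge_src \<delta> = edge_src \<alpha>" "edge_tgt \<alpha> = edge_src \<beta>" "edge_tgt \<delta> = edge_tgt \<beta>"
    by (simp_all add: \<alpha>_def \<beta>_def \<delta>_def edge_simps)
  have g: "gv \<alpha> \<otimes> gv \<beta> = gv \<delta>"
    using gv_tri[OF \<tau>] by (simp add: \<alpha>_def \<beta>_def \<delta>_def)
  note gc = gv_closed[OF S(1)] gv_closed[OF S(2)] gv_closed[OF S(3)]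
  \<comment> \<open>With bottom vertices b0, b1, b2 (all at \<open>pt\<close>) and top vertices v0,
    v1, v2, the interior walls of the prism are \<open>W1\<close> = b0 v1 v2 and \<open>W2\<close> =
    b0 b1 v2.\<close>
  define W1 where "W1 = tr (d_edge \<alpha>) \<beta> (d_edge \<delta>)"
  define W2 where "W2 = tr (e (gv \<alpha>)) (d_edge \<beta>) (d_edge \<delta>)"
  have W1: "S 2 W1" "tri_01 W1 = d_edge \<alpha>" "tri_12 W1 = \<beta>" "tri_02 W1 = d_edge \<delta>"
    unfolding W1_def using S E g by (auto intro!: tr simp: d_edge simp del: One_nat_def)
  have W2: "S 2 W2" "tri_01 W2 = e (gv \<alpha>)" "tri_12 W2 = d_edge \<beta>" "tri_02 W2 = d_edge \<delta>"
    unfolding W2_def using S E g gc by (auto intro!: tr simp: d_edge e simp del: One_nat_def)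
  \<comment> \<open>The tetrahedra are b0 v0 v1 v2, then b0 b1 v1 v2, then b0 b1 b2 v2.\<close>
  have 1: "singular_relboundary 2 M A (frag_of \<tau> - frag_of W1 + frag_of (U \<delta>) - frag_of (U \<alpha>))"
    by (rule tetra_boundary) (use S E \<tau> in \<open>simp_all add: U W1 flip: \<alpha>_def \<beta>_def \<delta>_def\<close>)
  have 2: "singular_relboundary 2 M A (frag_of (U \<beta>) - frag_of W1 + frag_of W2 - frag_of (V \<alpha>))"
    by (rule tetra_boundary) (use S E in \<open>simp_all add: U V W1 W2\<close>)
  have 3: "singular_relboundary 2 M A (frag_of (V \<beta>) - frag_of (V \<delta>) + frag_of W2 - frag_of (t (gv \<alpha>) (gv \<beta>)))"
    by (rule tetra_boundary) (use S E g gc in \<open>simp_all add: V W2 t\<close>)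
  \<comment> \<open>Taken with signs +, -, + the walls cancel, and the triangles \<open>U\<close>
    and \<open>V\<close> over each side combine to its square.\<close>
  have "singular_relboundary 2 M A (frag_of \<tau> - (frag_of (t (gv \<alpha>) (gv \<beta>)) + q_chain \<alpha> + q_chain \<beta> - q_chain \<delta>))"
    using singular_relboundary_add[OF singular_relboundary_diff[OF 1 2] 3]
    by (simp add: q_chain_def algebra_simps)
  then show ?thesis
    unfolding homologous_rel_def \<alpha>_def \<beta>_def \<delta>_def .
qed

end

lemma homologous_rel_set_0: "homologous_rel_set p Z B 0 = singular_relboundary_set p Z B"
  by (auto simp: homologous_rel_def singular_relboundary_minus)

context aspherical_pair
begin

section \<open>The group of 2-chains modulo relative boundaries, and the cocycle in it\<close>

lemma sub_chain: "singular_chain p (subtopology M A) c \<Longrightarrow> singular_chain p M c"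
  by (simp add: singular_chain_subtopology)

definition "Q = chain_group 2 M Mod singular_relboundary_set 2 M A"
definition "cls = homologous_rel_set 2 M A"

lemma normal_relboundary: "singular_relboundary_set 2 M A \<lhd> chain_group 2 M"
  by (simp add: comm_group.normal_iff_subgroup[OF abelian_chain_group] subgroup_singular_relboundary)

lemma comm_group_Q: "comm_group Q"
  unfolding Q_def
  by (rule comm_group.abelian_FactGroup[OF abelian_chain_group subgroup_singular_relboundary])

sublocale Q: comm_group Q by (rule comm_group_Q)

lemma r_coset_chain_group: "r_coset (chain_group 2 M) (singular_relboundary_set 2 M A) = cls"
  using right_coset_singular_relboundary[of 2 M A] unfolding fun_eq_iff r_coset_def cls_def by simp

lemma carrier_Q: "carrier Q = cls ` singular_chain_set 2 M"
  by (simp add: Q_def carrier_FactGroup r_coset_chain_group)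

lemma cls_closed: "singular_chain 2 M c \<Longrightarrow> cls c \<in> carrier Q"
  by (auto simp: carrier_Q)

lemma cls_hom: "cls \<in> hom (chain_group 2 M) Q"
  using normal.r_coset_hom_Mod[OF normal_relboundary] by (simp add: Q_def r_coset_chain_group eta_contract_eq)

lemma cls_add: "\<lbrakk>singular_chain 2 M a; singular_chain 2 M b\<rbrakk> \<Longrightarrow> cls (a + b) = cls a \<otimes>\<^bsub>Q\<^esub> cls b"
  using hom_mult[OF cls_hom, of a b] by simp

lemma cls_eq: "cls a = cls b \<longleftrightarrow> homologous_rel 2 M A a b"
  by (simp add: cls_def homologous_rel_set_eq)

lemma cls_0: "cls 0 = \<one>\<^bsub>Q\<^esub>"
  by (simp add: cls_def homologous_rel_set_0 Q_def)

lemma cls_eq_one: "cls c = \<one>\<^bsub>Q\<^esub> \<longleftrightarrow> singular_relboundary 2 M A c"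
  using cls_eq[of c 0] by (simp add: cls_0 homologous_rel_def)

lemma cls_minus: "singular_chain 2 M a \<Longrightarrow> cls (- a) = inv\<^bsub>Q\<^esub> cls a"
  using cls_add[of "- a" a] cls_closed
  by (intro Q.inv_equality[symmetric]) (simp_all add: singular_chain_minus cls_0)

lemma cls_diff: "\<lbrakk>singular_chain 2 M a; singular_chain 2 M b\<rbrakk> \<Longrightarrow> cls (a - b) = cls a \<otimes>\<^bsub>Q\<^esub> inv\<^bsub>Q\<^esub> cls b"
  using cls_add[of a "- b"] by (simp add: singular_chain_minus cls_minus)

lemma cls_sub: "singular_chain 2 (subtopology M A) c \<Longrightarrow> cls c = \<one>\<^bsub>Q\<^esub>"
  by (simp add: cls_eq_one singular_chain_imp_relboundary)

definition "T g h = cls (frag_of (t g h))"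

lemma t_chain: "\<lbrakk>g \<in> carrier G; h \<in> carrier G\<rbrakk> \<Longrightarrow> singular_chain 2 M (frag_of (t g h))"
  by (simp add: singular_chain_of t)

text \<open>For labels in \<open>W\<close> the triangle was chosen inside \<open>A\<close>. This is
  what makes the lift of \<open>F\<close> multiplicative over the powers of
  \<open>w\<close>.\<close>

lemma T_W: "\<lbrakk>g \<in> W; h \<in> W\<rbrakk> \<Longrightarrow> T g h = \<one>\<^bsub>Q\<^esub>"
  unfolding T_def by (rule cls_sub) (simp add: singular_chain_of t W_carrier)

sublocale T: cocycle Q G T
proof
  fix g h k assume g: "g \<in> carrier G" "h \<in> carrier G" "k \<in> carrier G"
  have "cls (frag_of (t g h) + frag_of (t (g \<otimes> h) k)) = cls (frag_of (t h k) + frag_of (t g (h \<otimes> k)))"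
    using t_cocycle_rel[OF g] by (simp add: cls_eq)
  then show "T g h \<otimes>\<^bsub>Q\<^esub> T (g \<otimes> h) k = T h k \<otimes>\<^bsub>Q\<^esub> T g (h \<otimes> k)"
    using g by (simp add: T_def cls_add t_chain)
qed (auto simp: T_W W_one, simp add: T_def cls_closed t_chain)

section \<open>Homomorphisms out of the group of relative chains\<close>

lemma hom_from_Q:
  assumes Y: "group Y" and h: "h \<in> hom (chain_group 2 M) Y"
    and b: "\<And>c. singular_relboundary 2 M A c \<Longrightarrow> h c = \<one>\<^bsub>Y\<^esub>"
  shows "\<exists>r \<in> hom Q Y. \<forall>c. singular_chain 2 M c \<longrightarrow> r (cls c) = h c"
proof -
  interpret Y: group Y by fact
  interpret h: group_hom "chain_group 2 M" Y h
    by (simp add: group_hom_def group_hom_axioms_def h Y)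
  have "h x = h y" if xy: "singular_chain 2 M x" "singular_chain 2 M y" and "cls x = cls y" for x y
  proof -
    have "h (x - y) = \<one>\<^bsub>Y\<^esub>"
      using that(3) b by (simp add: cls_eq homologous_rel_def)
    moreover have "h x = h (x - y) \<otimes>\<^bsub>Y\<^esub> h y"
      using h.hom_mult[of "x - y" y] xy by (simp add: singular_chain_diff)
    ultimately show ?thesis
      using h.hom_closed[of y] xy by simp
  qed
  then have "\<And>x y. \<lbrakk>x \<in> carrier (chain_group 2 M); y \<in> carrier (chain_group 2 M);
      r_coset (chain_group 2 M) (singular_relboundary_set 2 M A) x =
      r_coset (chain_group 2 M) (singular_relboundary_set 2 M A) y\<rbrakk> \<Longrightarrow> h x = h y"
    unfolding r_coset_chain_group carrier_chain_group mem_Collect_eq .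
  from FactGroup_universal[OF h normal_relboundary this] obtain r where "r \<in> hom Q Y"
      "\<And>x. x \<in> carrier (chain_group 2 M) \<Longrightarrow> r (cls x) = h x"
    unfolding Q_def r_coset_chain_group by metis
  then show ?thesis by (intro bexI[of _ r]) auto
qed

lemma hom_from_chain_group:
  assumes Y: "comm_group Y" and f: "\<And>\<sigma>. singular_simplex p M \<sigma> \<Longrightarrow> f \<sigma> \<in> carrier Y"
  shows "\<exists>h \<in> hom (chain_group p M) Y. \<forall>\<sigma>. singular_simplex p M \<sigma> \<longrightarrow> h (frag_of \<sigma>) = f \<sigma>"
proof -
  interpret Y: comm_group Y by fact
  have "f ` singular_simplex_set p M \<subseteq> carrier Y" using f by auto
  then show ?thesis
    unfolding chain_group_def
    by (rule Y.free_Abelian_group_universal) (metis mem_Collect_eq)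
qed

text \<open>A function on \<open>G\<close> that is multiplicative modulo the centre and on the powers of \<open>w\<close>
  defines, through its defect on the edge labels, a cocycle on the pair.\<close>

lemma defect_hom:
  assumes Y: "group Y" and s: "\<And>g. g \<in> carrier G \<Longrightarrow> s g \<in> carrier Y"
    and cent: "\<And>g h. \<lbrakk>g \<in> carrier G; h \<in> carrier G\<rbrakk> \<Longrightarrow> s g \<otimes>\<^bsub>Y\<^esub> s h \<otimes>\<^bsub>Y\<^esub> inv\<^bsub>Y\<^esub> s (g \<otimes> h) \<in> group_center Y"
    and sW: "\<And>g h. \<lbrakk>g \<in> W; h \<in> W\<rbrakk> \<Longrightarrow> s g \<otimes>\<^bsub>Y\<^esub> s h = s (g \<otimes> h)"
  shows "\<exists>r \<in> hom Q Y. (\<forall>q \<in> carrier Q. r q \<in> group_center Y) \<and>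
    (\<lambda>x. r (fst x) \<otimes>\<^bsub>Y\<^esub> s (snd x)) \<in> hom T.E Y"
proof -
  interpret Y: group Y by fact
  let ?C = "Y\<lparr>carrier := group_center Y\<rparr>"
  interpret C: comm_group ?C by (rule Y.comm_group_group_center)
  define f where "f g h = s g \<otimes>\<^bsub>Y\<^esub> s h \<otimes>\<^bsub>Y\<^esub> inv\<^bsub>Y\<^esub> s (g \<otimes> h)" for g h
  have fC: "f g h \<in> group_center Y" if "g \<in> carrier G" "h \<in> carrier G" for g h
    using cent[OF that] by (simp add: f_def)
  have fc: "f g h \<in> carrier Y" if "g \<in> carrier G" "h \<in> carrier G" for g h
    using Y.group_center_carrier fC that by blast
  have fs: "f g h \<otimes>\<^bsub>Y\<^esub> s (g \<otimes> h) = s g \<otimes>\<^bsub>Y\<^esub> s h" if "g \<in> carrier G" "h \<in> carrier G" for g h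
    using that s by (simp add: f_def Y.m_assoc)
  have f_cocycle: "f g h \<otimes>\<^bsub>Y\<^esub> f (g \<otimes> h) k = f h k \<otimes>\<^bsub>Y\<^esub> f g (h \<otimes> k)"
    if g: "g \<in> carrier G" "h \<in> carrier G" "k \<in> carrier G" for g h k
  proof -
    have "(f g h \<otimes>\<^bsub>Y\<^esub> f (g \<otimes> h) k) \<otimes>\<^bsub>Y\<^esub> s (g \<otimes> h \<otimes> k) = f g h \<otimes>\<^bsub>Y\<^esub> (s (g \<otimes> h) \<otimes>\<^bsub>Y\<^esub> s k)"
      using g s fc fs[of "g \<otimes> h" k] by (simp add: Y.m_assoc)
    also have "\<dots> = s g \<otimes>\<^bsub>Y\<^esub> (s h \<otimes>\<^bsub>Y\<^esub> s k)"
      using g s fc fs[of g h] by (simp flip: Y.m_assoc)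
    also have "\<dots> = s g \<otimes>\<^bsub>Y\<^esub> f h k \<otimes>\<^bsub>Y\<^esub> s (h \<otimes> k)"
      using g s fc fs[of h k] by (simp add: Y.m_assoc)
    also have "s g \<otimes>\<^bsub>Y\<^esub> f h k = f h k \<otimes>\<^bsub>Y\<^esub> s g"
      using Y.group_center_comm[OF fC[of h k]] g s by simp
    also have "f h k \<otimes>\<^bsub>Y\<^esub> s g \<otimes>\<^bsub>Y\<^esub> s (h \<otimes> k) = (f h k \<otimes>\<^bsub>Y\<^esub> f g (h \<otimes> k)) \<otimes>\<^bsub>Y\<^esub> s (g \<otimes> h \<otimes> k)"
      using g s fc fs[of g "h \<otimes> k"] by (simp add: Y.m_assoc m_assoc)
    finally show ?thesis
      using g s fc by simp
  qed
  \<comment> \<open>The defect \<open>f\<close>, a 2-cocycle of \<open>G\<close> with central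
    values, is evaluated on the first two edge labels of each triangle.\<close>
  obtain h where h: "h \<in> hom (chain_group 2 M) ?C"
    and hf: "\<And>\<tau>. S 2 \<tau> \<Longrightarrow> h (frag_of \<tau>) = f (gv (tri_01 \<tau>)) (gv (tri_12 \<tau>))"
    using hom_from_chain_group[OF C.comm_group_axioms, of 2 "\<lambda>\<tau>. f (gv (tri_01 \<tau>)) (gv (tri_12 \<tau>))"]
    by (auto simp: fC gv_closed singular_simplex_tri simp del: One_nat_def)
  interpret h: group_hom "chain_group 2 M" ?C h
    by (simp add: group_hom_def group_hom_axioms_def h C.is_group)
  have h_add: "h (a + b) = h a \<otimes>\<^bsub>Y\<^esub> h b" if "singular_chain 2 M a" "singular_chain 2 M b" for a b
    using h.hom_mult[of a b] that by simp
  have h0: "h 0 = \<one>\<^bsub>Y\<^esub>" using h.hom_one by simp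
  have hc: "h a \<in> carrier Y" if "singular_chain 2 M a" for a
    using h.hom_closed[of a] that Y.group_center_carrier by simp
  have h_diff_one: "h (a - b) = \<one>\<^bsub>Y\<^esub>" if "singular_chain 2 M a" "singular_chain 2 M b" "h a = h b" for a b
  proof -
    have "h a = h (a - b) \<otimes>\<^bsub>Y\<^esub> h b"
      using h_add[of "a - b" b] that by (simp add: singular_chain_diff)
    then show ?thesis
      using that hc singular_chain_diff Y.r_cancel_one by metis
  qed
  have h3: "h (chain_boundary 3 d) = \<one>\<^bsub>Y\<^esub>" if "singular_chain 3 M d" for d
  proof -
    \<comment> \<open>The induction carries membership in the chain group along, because
      \<open>h\<close> is additive only there.\<close>
    have "singular_chain 3 M d \<and> h (chain_boundary 3 d) = \<one>\<^bsub>Y\<^esub>"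
      using that unfolding singular_chain_def
    proof (induction rule: frag_induction)
      case (one \<theta>)
      then have \<theta>: "S 3 \<theta>" by simp
      let ?a = "singular_face 3 3 \<theta>" and ?b = "singular_face 3 2 \<theta>"
      let ?c = "singular_face 3 1 \<theta>" and ?d = "singular_face 3 0 \<theta>"
      have S2: "S 2 ?a" "S 2 ?b" "S 2 ?c" "S 2 ?d"
        using singular_simplex_tetra[OF \<theta>] by auto
      \<comment> \<open>These label the edges 01, 12, 23. The faces opposite the vertices 3, 2, 1, 0
        then carry the pairs (g, h), (g, hk), (gh, k), (h, k), so the boundary is killed by
        \<open>f_cocycle\<close>.\<close>
      let ?g = "gv (tri_01 ?a)" and ?h = "gv (tri_12 ?a)" and ?k = "gv (tri_12 ?d)"
      have cl: "?g \<in> carrier G" "?h \<in> carrier G" "?k \<in> carrier G"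
        using S2 singular_simplex_tri gv_closed by blast+
      have E: "tri_01 ?b = tri_01 ?a" "tri_01 ?c = tri_02 ?a" "tri_01 ?d = tri_12 ?a"
        "tri_12 ?c = tri_12 ?d" "tri_12 ?b = tri_02 ?d"
        using tetrahedron_edges[of \<theta>] by auto
      have "h (frag_of ?a) = f ?g ?h" "h (frag_of ?c) = f (?g \<otimes> ?h) ?k"
        "h (frag_of ?d) = f ?h ?k" "h (frag_of ?b) = f ?g (?h \<otimes> ?k)"
        using S2 gv_tri[OF S2(1)] gv_tri[OF S2(4)] by (simp_all add: hf E del: One_nat_def)
      then have "h (frag_of ?d + frag_of ?b) = h (frag_of ?a + frag_of ?c)"
        using S2 f_cocycle[OF cl] by (simp add: h_add singular_chain_of del: One_nat_def)
      then have "h ((frag_of ?d + frag_of ?b) - (frag_of ?a + frag_of ?c)) = \<one>\<^bsub>Y\<^esub>"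
        using S2 by (intro h_diff_one singular_chain_add) (simp_all add: singular_chain_of)
      then show ?case
        using \<theta> by (simp add: chain_boundary_3 algebra_simps)
    next
      case (diff a b)
      then have ab: "singular_chain 3 M a" "singular_chain 3 M b"
        by (auto simp: singular_chain_def)
      then have "singular_chain 2 M (chain_boundary 3 a)" "singular_chain 2 M (chain_boundary 3 b)"
        using singular_chain_boundary[of 3 M] by (simp_all add: numeral_2_eq_2 numeral_3_eq_3)
      then show ?case
        using diff singular_chain_diff[OF ab] by (auto simp: chain_boundary_diff singular_chain_def intro!: h_diff_one)
    qed (simp add: h0)
    then show ?thesis ..
  qed
  have hA: "h c = \<one>\<^bsub>Y\<^esub>" if "singular_chain 2 (subtopology M A) c" for c
  proof -
    have "singular_chain 2 (subtopology M A) c \<and> h c = \<one>\<^bsub>Y\<^esub>"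
      using that unfolding singular_chain_def
    proof (induction rule: frag_induction)
      case (one \<tau>)
      then have \<tau>: "SA 2 \<tau>" by simp
      then have "gv (tri_01 \<tau>) \<in> W" "gv (tri_12 \<tau>) \<in> W"
        using singular_simplex_tri gv_W by blast+
      then have "f (gv (tri_01 \<tau>)) (gv (tri_12 \<tau>)) = \<one>\<^bsub>Y\<^esub>"
        unfolding f_def using sW s W_carrier W_mult by simp
      then show ?case using \<tau> sub_simplex by (simp add: hf)
    next
      case (diff a b)
      then have "singular_chain 2 (subtopology M A) a" "singular_chain 2 (subtopology M A) b"
        by (auto simp: singular_chain_def)
      then have "h (a - b) = \<one>\<^bsub>Y\<^esub>" "singular_chain 2 (subtopology M A) (a - b)"
        using diff sub_chain singular_chain_diff h_diff_one by auto
      then show ?case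
        by (simp add: singular_chain_def)
    qed (simp add: h0)
    then show ?thesis ..
  qed
  have hb: "h c = \<one>\<^bsub>?C\<^esub>" if b: "singular_relboundary 2 M A c" for c
  proof -
    obtain d a where da: "singular_chain 3 M d" "singular_chain 2 (subtopology M A) a"
        "c = chain_boundary 3 d + a"
      using b by (auto simp: singular_relboundary numeral_2_eq_2 numeral_3_eq_3)
    have "singular_chain 2 M (chain_boundary 3 d)" "singular_chain 2 M a"
      using da singular_chain_boundary[of 3 M d]
      by (simp_all add: numeral_2_eq_2 numeral_3_eq_3 singular_chain_subtopology)
    then show ?thesis
      using da by (simp add: h_add h3 hA)
  qed
  obtain r where r: "r \<in> hom Q ?C" and rh: "\<And>c. singular_chain 2 M c \<Longrightarrow> r (cls c) = h c"
    using hom_from_Q[OF C.is_group h hb] by blast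
  have rC: "r q \<in> group_center Y" if "q \<in> carrier Q" for q
    using r that by (auto simp: hom_def)
  have rY: "r \<in> hom Q Y"
    using r rC Y.group_center_carrier by (auto simp: hom_def)
  have rT: "r (T g h) = f g h" if "g \<in> carrier G" "h \<in> carrier G" for g h
    using that by (simp add: T_def rh t_chain hf t e)
  have "(\<lambda>x. r (fst x) \<otimes>\<^bsub>Y\<^esub> s (snd x)) \<in> hom T.E Y"
    by (rule T.hom_E[OF Y rY]) (auto simp: s rT fs intro: Y.group_center_comm[OF rC])
  with rY rC show ?thesis by blast
qed

end

section \<open>The isomorphism for a presented group\<close>

locale presented_pair = aspherical_pair "F Mod R" M A gv w
  for F :: "('f, 'b) monoid_scheme" and R :: "'f set" and M :: "'m topology" and A :: "'m set"
    and gv :: "((nat \<Rightarrow> real) \<Rightarrow> 'm) \<Rightarrow> 'f set" and w :: "'f set" +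
  fixes wbar :: 'f
  assumes free: "free_group F" and normal_R: "R \<lhd> F"
    and wbar: "wbar \<in> carrier F" and w_eq: "w = R #>\<^bsub>F\<^esub> wbar"
begin

section \<open>The projection of \<open>F\<close> and the subgroup over the powers of
  \<open>w\<close>\<close>

abbreviation "\<pi> x \<equiv> R #>\<^bsub>F\<^esub> x"

sublocale F: group F
  using free by (simp add: free_group_def)

sublocale R: normal R F by (rule normal_R)

lemma pi_hom: "(\<lambda>x. \<pi> x) \<in> hom F (F Mod R)"
  by (rule R.r_coset_hom_Mod)

sublocale pi: group_hom F "F Mod R" "\<lambda>x. \<pi> x"
  by (simp add: group_hom_def group_hom_axioms_def pi_hom is_group)

lemma pi_surj: "g \<in> carrier (F Mod R) \<Longrightarrow> \<exists>x \<in> carrier F. \<pi> x = g"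
  by (auto simp: carrier_FactGroup)

lemma pi_mult: "\<lbrakk>x \<in> carrier F; y \<in> carrier F\<rbrakk> \<Longrightarrow> \<pi> (x \<otimes>\<^bsub>F\<^esub> y) = \<pi> x \<otimes>\<^bsub>F Mod R\<^esub> \<pi> y"
  by (rule pi.hom_mult)

lemma pi_eq_one: "x \<in> carrier F \<Longrightarrow> \<pi> x = \<one>\<^bsub>F Mod R\<^esub> \<longleftrightarrow> x \<in> R"
  using F.coset_join1[OF _ _ R.subgroup_axioms, of x] R.rcos_const[OF F.is_group, of x] R.subset by auto

lemma pi_wbar_pow: "\<pi> (wbar [^]\<^bsub>F\<^esub> (k::int)) = w [^]\<^bsub>F Mod R\<^esub> k"
  using R.FactGroup_int_pow[OF wbar, of k] by (simp add: w_eq)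

definition "J = generate F {wbar} <#>\<^bsub>F\<^esub> R"

text \<open>An element over a power of \<open>w\<close> differs from the same power of
  \<open>wbar\<close> by an element of \<open>R\<close>. As a full preimage, \<open>J\<close> is
  plainly a subgroup, and its elements have labels in \<open>W\<close>.\<close>

lemma J_eq: "J = {x \<in> carrier F. \<pi> x \<in> W}"
proof (intro Set.set_eqI iffI)
  fix x assume "x \<in> J"
  then obtain k :: int and r where x: "x = wbar [^]\<^bsub>F\<^esub> k \<otimes>\<^bsub>F\<^esub> r" and r: "r \<in> R"
    using F.generate_pow[OF wbar] by (auto simp: J_def set_mult_def)
  have rc: "r \<in> carrier F" using R.subset r by blast
  have "\<pi> x = w [^]\<^bsub>F Mod R\<^esub> k \<otimes>\<^bsub>F Mod R\<^esub> \<pi> r"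
    unfolding x using rc wbar by (simp only: pi_mult F.int_pow_closed pi_wbar_pow)
  also have "\<pi> r = \<one>\<^bsub>F Mod R\<^esub>" using pi_eq_one[OF rc] r by blast
  finally have "\<pi> x = w [^]\<^bsub>F Mod R\<^esub> k"
    using w_closed by (simp only: r_one int_pow_closed)
  then show "x \<in> {x \<in> carrier F. \<pi> x \<in> W}"
    using x rc wbar by (auto simp: W_def)
next
  fix x assume "x \<in> {x \<in> carrier F. \<pi> x \<in> W}"
  then obtain k :: int where x: "x \<in> carrier F" and k: "\<pi> x = w [^]\<^bsub>F Mod R\<^esub> k"
    by (auto simp: W_def)
  let ?u = "wbar [^]\<^bsub>F\<^esub> k"
  have u: "?u \<in> carrier F" using wbar by simp
  have "\<pi> (inv\<^bsub>F\<^esub> ?u \<otimes>\<^bsub>F\<^esub> x) = inv\<^bsub>F Mod R\<^esub> (\<pi> ?u) \<otimes>\<^bsub>F Mod R\<^esub> \<pi> x"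
    using x u by (simp only: pi_mult F.inv_closed pi.hom_inv)
  also have "\<dots> = \<one>\<^bsub>F Mod R\<^esub>"
    unfolding k pi_wbar_pow using w_closed by (simp only: l_inv int_pow_closed)
  finally have "inv\<^bsub>F\<^esub> ?u \<otimes>\<^bsub>F\<^esub> x \<in> R"
    using pi_eq_one[of "inv\<^bsub>F\<^esub> ?u \<otimes>\<^bsub>F\<^esub> x"] x u by simp
  moreover have "x = ?u \<otimes>\<^bsub>F\<^esub> (inv\<^bsub>F\<^esub> ?u \<otimes>\<^bsub>F\<^esub> x)"
    using x u by (simp add: F.inv_solve_left flip: F.m_assoc)
  moreover have "?u \<in> generate F {wbar}"
    using F.generate_pow[OF wbar] by auto
  ultimately show "x \<in> J"
    unfolding J_def set_mult_def by blast
qed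

lemma R_sub_J: "R \<subseteq> J"
proof
  fix x assume x: "x \<in> R"
  then have "x \<in> carrier F" using R.subset by blast
  moreover have "\<pi> x = \<one>\<^bsub>F Mod R\<^esub>" using pi_eq_one x calculation by blast
  ultimately show "x \<in> J" using W_one unfolding J_eq by simp
qed

lemma J_carrier: "x \<in> J \<Longrightarrow> x \<in> carrier F" and J_W: "x \<in> J \<Longrightarrow> \<pi> x \<in> W"
  by (auto simp: J_eq)

lemma W_inv: "g \<in> W \<Longrightarrow> inv\<^bsub>F Mod R\<^esub> g \<in> W"
  using int_pow_neg[OF w_closed] by (auto simp: W_def)

lemma subgroup_J: "subgroup J F"
proof
  show "x \<otimes>\<^bsub>F\<^esub> y \<in> J" if "x \<in> J" "y \<in> J" for x y
    using that W_mult by (auto simp: J_eq pi_mult)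
  show "inv\<^bsub>F\<^esub> x \<in> J" if "x \<in> J" for x
    using that W_inv[of "\<pi> x"] pi.hom_inv[of x] by (auto simp: J_eq)
  show "\<one>\<^bsub>F\<^esub> \<in> J"
    using R_sub_J R.one_closed by blast
qed (auto simp: J_eq)

lemma wbar_pow_J: "wbar [^]\<^bsub>F\<^esub> (k::int) \<in> J"
  using wbar by (auto simp: J_eq pi_wbar_pow W_def)

section \<open>The lift of the free group to the central extension\<close>

lemma lift_exists: "\<exists>\<Lambda> \<in> hom F T.E. \<forall>x \<in> carrier F. snd (\<Lambda> x) = \<pi> x"
proof (rule free_group_projective[OF free T.group_E is_group T.snd_hom_E _ pi_hom])
  show "snd ` carrier T.E = carrier (F Mod R)"
    using Q.one_closed by (force simp: T.carrier_E)
qed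

definition "\<Lambda> = (SOME \<Lambda>. \<Lambda> \<in> hom F T.E \<and> (\<forall>x \<in> carrier F. snd (\<Lambda> x) = \<pi> x))"
definition "lam x = fst (\<Lambda> x)"

lemma Lam_hom: "\<Lambda> \<in> hom F T.E" and snd_Lam: "x \<in> carrier F \<Longrightarrow> snd (\<Lambda> x) = \<pi> x"
  using someI_ex[of "\<lambda>\<Lambda>. \<Lambda> \<in> hom F T.E \<and> (\<forall>x \<in> carrier F. snd (\<Lambda> x) = \<pi> x)"] lift_exists
  unfolding \<Lambda>_def by blast+

sublocale Lam: group_hom F T.E \<Lambda>
  using T.group_E by (simp add: group_hom_def group_hom_axioms_def Lam_hom)

lemma Lam_eq: "x \<in> carrier F \<Longrightarrow> \<Lambda> x = (lam x, \<pi> x)"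
  by (simp add: lam_def prod_eq_iff snd_Lam)

lemma lam_closed: "x \<in> carrier F \<Longrightarrow> lam x \<in> carrier Q"
  using Lam.hom_closed[of x] by (simp add: lam_def T.carrier_E mem_Times_iff)

lemma lam_mult:
  assumes "x \<in> carrier F" "y \<in> carrier F"
  shows "lam (x \<otimes>\<^bsub>F\<^esub> y) = lam x \<otimes>\<^bsub>Q\<^esub> lam y \<otimes>\<^bsub>Q\<^esub> T (\<pi> x) (\<pi> y)"
  using Lam.hom_mult[OF assms] assms by (simp add: Lam_eq T.mult_E)

text \<open>The cocycle term of \<open>lam_mult\<close> disappears because it is trivial on pairs
  from \<open>W\<close>.\<close>

lemma lam_mult_J: "\<lbrakk>x \<in> J; y \<in> J\<rbrakk> \<Longrightarrow> lam (x \<otimes>\<^bsub>F\<^esub> y) = lam x \<otimes>\<^bsub>Q\<^esub> lam y"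
  by (simp add: lam_mult J_carrier J_W T_W lam_closed)

lemma lam_one: "lam \<one>\<^bsub>F\<^esub> = \<one>\<^bsub>Q\<^esub>"
  using Lam.hom_one by (simp add: lam_def T.one_E)

lemma lam_inv_J: "x \<in> J \<Longrightarrow> lam (inv\<^bsub>F\<^esub> x) = inv\<^bsub>Q\<^esub> lam x"
  using lam_mult_J[of "inv\<^bsub>F\<^esub> x" x] subgroup.m_inv_closed[OF subgroup_J, of x]
  by (intro Q.inv_equality[symmetric]) (simp_all add: J_carrier lam_closed lam_one)

section \<open>The subgroup \<open>[F,R]\<close> and the central image of \<open>R\<close> in its
  quotient\<close>

definition "K = comm_subgroup F (carrier F) R"

lemma K_incl: "subgroup N F \<Longrightarrow> (\<And>f r. \<lbrakk>f \<in> carrier F; r \<in> R\<rbrakk>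
    \<Longrightarrow> f \<otimes>\<^bsub>F\<^esub> r \<otimes>\<^bsub>F\<^esub> inv\<^bsub>F\<^esub> f \<otimes>\<^bsub>F\<^esub> inv\<^bsub>F\<^esub> r \<in> N) \<Longrightarrow> K \<subseteq> N"
  unfolding K_def comm_subgroup_def by (rule F.generate_subgroup_incl) auto

lemma comm_in_K: "\<lbrakk>f \<in> carrier F; r \<in> R\<rbrakk> \<Longrightarrow> f \<otimes>\<^bsub>F\<^esub> r \<otimes>\<^bsub>F\<^esub> inv\<^bsub>F\<^esub> f \<otimes>\<^bsub>F\<^esub> inv\<^bsub>F\<^esub> r \<in> K"
  unfolding K_def comm_subgroup_def by (rule generate.incl) auto

lemma subgroup_K: "subgroup K F"
  unfolding K_def comm_subgroup_def
  by (rule F.generate_is_subgroup) (use R.subset in auto)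

lemma K_sub_R: "K \<subseteq> R"
proof (rule K_incl[OF R.subgroup_axioms])
  fix f r assume f: "f \<in> carrier F" "r \<in> R"
  then show "f \<otimes>\<^bsub>F\<^esub> r \<otimes>\<^bsub>F\<^esub> inv\<^bsub>F\<^esub> f \<otimes>\<^bsub>F\<^esub> inv\<^bsub>F\<^esub> r \<in> R"
    using R.inv_op_closed2[of f r] by simp
qed

lemma K_sub_derived: "K \<subseteq> derived F (carrier F)"
proof (rule K_incl)
  show "subgroup (derived F (carrier F)) F" by (rule F.derived_is_subgroup) simp
  fix f r assume "f \<in> carrier F" "r \<in> R"
  then show "f \<otimes>\<^bsub>F\<^esub> r \<otimes>\<^bsub>F\<^esub> inv\<^bsub>F\<^esub> f \<otimes>\<^bsub>F\<^esub> inv\<^bsub>F\<^esub> r \<in> derived F (carrier F)"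
    unfolding derived_def using R.subset by (intro generate.incl) auto
qed

text \<open>A conjugate of \<open>k\<close> is the commutator of \<open>x\<close> and
  \<open>k\<close> times \<open>k\<close>, and this commutator lies in \<open>K\<close> because
  \<open>k\<close> lies in \<open>R\<close>.\<close>

lemma normal_K: "K \<lhd> F"
proof (rule F.normal_invI[OF subgroup_K])
  fix x k assume x: "x \<in> carrier F" and k: "k \<in> K"
  have kR: "k \<in> R" and kc: "k \<in> carrier F" using k K_sub_R R.subset by auto
  have "x \<otimes>\<^bsub>F\<^esub> k \<otimes>\<^bsub>F\<^esub> inv\<^bsub>F\<^esub> x = (x \<otimes>\<^bsub>F\<^esub> k \<otimes>\<^bsub>F\<^esub> inv\<^bsub>F\<^esub> x \<otimes>\<^bsub>F\<^esub> inv\<^bsub>F\<^esub> k) \<otimes>\<^bsub>F\<^esub> k"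
    using x kc by (simp add: F.m_assoc)
  then show "x \<otimes>\<^bsub>F\<^esub> k \<otimes>\<^bsub>F\<^esub> inv\<^bsub>F\<^esub> x \<in> K"
    using subgroup.m_closed[OF subgroup_K comm_in_K[OF x kR] k] by simp
qed

sublocale K: normal K F by (rule normal_K)

lemma K_coset_eq: "\<lbrakk>x \<in> carrier F\<rbrakk> \<Longrightarrow> K #>\<^bsub>F\<^esub> x = K \<longleftrightarrow> x \<in> K"
  using F.coset_join1[OF _ _ K.subgroup_axioms, of x] K.rcos_const[OF F.is_group, of x] K.subset by auto

text \<open>\<open>f r\<close> and \<open>r f\<close> differ by the commutator of \<open>f\<close>
  and \<open>r\<close>, a generator of \<open>K\<close>.\<close>

lemma coset_R_central:
  assumes r: "r \<in> R"
  shows "K #>\<^bsub>F\<^esub> r \<in> group_center (F Mod K)"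
proof -
  interpret FK: group "F Mod K" by (rule K.factorgroup_is_group)
  interpret k: group_hom F "F Mod K" "\<lambda>x. K #>\<^bsub>F\<^esub> x"
    by (simp add: group_hom_def group_hom_axioms_def K.r_coset_hom_Mod FK.is_group)
  have rc: "r \<in> carrier F" using r R.subset by auto
  show ?thesis
  proof (rule FK.group_centerI)
    show "K #>\<^bsub>F\<^esub> r \<in> carrier (F Mod K)" using k.hom_closed[OF rc] .
    fix y assume "y \<in> carrier (F Mod K)"
    then obtain f where f: "f \<in> carrier F" "y = K #>\<^bsub>F\<^esub> f" by (auto simp: carrier_FactGroup)
    have "f \<otimes>\<^bsub>F\<^esub> r = (f \<otimes>\<^bsub>F\<^esub> r \<otimes>\<^bsub>F\<^esub> inv\<^bsub>F\<^esub> f \<otimes>\<^bsub>F\<^esub> inv\<^bsub>F\<^esub> r) \<otimes>\<^bsub>F\<^esub> (r \<otimes>\<^bsub>F\<^esub> f)"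
      using f rc by (simp add: F.m_assoc F.inv_solve_left')
    then have "f \<otimes>\<^bsub>F\<^esub> r \<in> K #>\<^bsub>F\<^esub> (r \<otimes>\<^bsub>F\<^esub> f)"
      using comm_in_K[OF f(1) r] unfolding r_coset_def by blast
    from F.repr_independence[OF this _ K.subgroup_axioms]
    have "K #>\<^bsub>F\<^esub> (f \<otimes>\<^bsub>F\<^esub> r) = K #>\<^bsub>F\<^esub> (r \<otimes>\<^bsub>F\<^esub> f)"
      using F.m_closed[OF rc f(1)] by metis
    then show "(K #>\<^bsub>F\<^esub> r) \<otimes>\<^bsub>F Mod K\<^esub> y = y \<otimes>\<^bsub>F Mod K\<^esub> (K #>\<^bsub>F\<^esub> r)"
      using k.hom_mult[OF f(1) rc] k.hom_mult[OF rc f(1)] f by simp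
  qed
qed

text \<open>For \<open>r\<close> in \<open>R\<close> the lift \<open>\<Lambda> r\<close> has trivial
  second component, hence is central, so \<Lambda> kills every commutator of \<open>F\<close> with
  \<open>R\<close>.\<close>

lemma lam_K:
  assumes "x \<in> K" shows "lam x = \<one>\<^bsub>Q\<^esub>"
proof -
  have "K \<subseteq> kernel F T.E \<Lambda>"
  proof (rule K_incl)
    show "subgroup (kernel F T.E \<Lambda>) F" by (rule Lam.subgroup_kernel)
    fix f r assume f: "f \<in> carrier F" and r: "r \<in> R"
    have rc: "r \<in> carrier F" using r R.subset by auto
    have "\<Lambda> r = (lam r, \<one>\<^bsub>F Mod R\<^esub>)"
      using Lam_eq[OF rc] pi_eq_one[OF rc] r by simp
    then have "\<Lambda> f \<otimes>\<^bsub>T.E\<^esub> \<Lambda> r = \<Lambda> r \<otimes>\<^bsub>T.E\<^esub> \<Lambda> f"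
      using T.central_E[OF lam_closed[OF rc] Lam.hom_closed[OF f]] by simp
    then have "\<Lambda> (f \<otimes>\<^bsub>F\<^esub> r \<otimes>\<^bsub>F\<^esub> inv\<^bsub>F\<^esub> f \<otimes>\<^bsub>F\<^esub> inv\<^bsub>F\<^esub> r) = \<one>\<^bsub>T.E\<^esub>"
      using f rc Lam.hom_closed[OF f] Lam.hom_closed[OF rc]
      by (simp add: Lam.H.m_assoc)
    then show "f \<otimes>\<^bsub>F\<^esub> r \<otimes>\<^bsub>F\<^esub> inv\<^bsub>F\<^esub> f \<otimes>\<^bsub>F\<^esub> inv\<^bsub>F\<^esub> r \<in> kernel F T.E \<Lambda>"
      using f rc by (simp add: kernel_def del: Lam.hom_mult)
  qed
  then show ?thesis
    using assms by (auto simp: kernel_def lam_def T.one_E)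
qed

section \<open>A section of the projection that is multiplicative on the powers of
  \<open>w\<close>\<close>

definition "kf g = (THE k::int. g = w [^]\<^bsub>F Mod R\<^esub> k)"
definition "s g = (if g \<in> W then wbar [^]\<^bsub>F\<^esub> kf g else (SOME x. x \<in> carrier F \<and> \<pi> x = g))"

lemma kf: "kf (w [^]\<^bsub>F Mod R\<^esub> (k::int)) = k"
  unfolding kf_def by (rule the_equality) (simp, metis w_pow_inj)

lemma s: assumes "g \<in> carrier (F Mod R)" shows "s g \<in> carrier F" "\<pi> (s g) = g"
proof -
  have "s g \<in> carrier F \<and> \<pi> (s g) = g"
  proof (cases "g \<in> W")
    case True
    then obtain k :: int where "g = w [^]\<^bsub>F Mod R\<^esub> k" by (auto simp: W_def)
    then show ?thesis using True wbar by (simp add: s_def kf pi_wbar_pow)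
  next
    case False
    then show ?thesis
      using someI_ex[of "\<lambda>x. x \<in> carrier F \<and> \<pi> x = g"] pi_surj[OF assms] by (auto simp: s_def)
  qed
  then show "s g \<in> carrier F" "\<pi> (s g) = g" by auto
qed

lemma s_w: "s (w [^]\<^bsub>F Mod R\<^esub> (k::int)) = wbar [^]\<^bsub>F\<^esub> k"
  by (simp add: s_def W_def kf)

lemma s_W_mult: "\<lbrakk>g \<in> W; h \<in> W\<rbrakk> \<Longrightarrow> s (g \<otimes>\<^bsub>F Mod R\<^esub> h) = s g \<otimes>\<^bsub>F\<^esub> s h"
  using w_closed wbar by (auto simp: W_def s_w F.int_pow_mult simp del: mult_FactGroup simp flip: int_pow_mult)

lemma s_defect:
  assumes "g \<in> carrier (F Mod R)" "h \<in> carrier (F Mod R)"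
  shows "s g \<otimes>\<^bsub>F\<^esub> s h \<otimes>\<^bsub>F\<^esub> inv\<^bsub>F\<^esub> s (g \<otimes>\<^bsub>F Mod R\<^esub> h) \<in> R"
proof -
  note m = m_closed[OF assms]
  have "\<pi> (s g \<otimes>\<^bsub>F\<^esub> s h \<otimes>\<^bsub>F\<^esub> inv\<^bsub>F\<^esub> s (g \<otimes>\<^bsub>F Mod R\<^esub> h)) =
     (\<pi> (s g) \<otimes>\<^bsub>F Mod R\<^esub> \<pi> (s h)) \<otimes>\<^bsub>F Mod R\<^esub> inv\<^bsub>F Mod R\<^esub> \<pi> (s (g \<otimes>\<^bsub>F Mod R\<^esub> h))"
    using s(1)[OF assms(1)] s(1)[OF assms(2)] s(1)[OF m]
    by (simp only: pi_mult pi.hom_inv F.m_closed F.inv_closed)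
  also have "\<dots> = \<one>\<^bsub>F Mod R\<^esub>"
    unfolding s(2)[OF assms(1)] s(2)[OF assms(2)] s(2)[OF m] using m by (simp only: r_inv)
  finally show ?thesis
    by (rule pi_eq_one[THEN iffD1, rotated])
      (intro F.m_closed F.inv_closed s(1)[OF assms(1)] s(1)[OF assms(2)] s(1)[OF m])
qed

section \<open>Range, kernel and image of the lift on \<open>J \<inter> [F,F]\<close>\<close>

abbreviation "D \<equiv> derived F (carrier F)"
definition "H = J \<inter> D"

lemma subgroup_D: "subgroup D F"
  by (rule F.derived_is_subgroup) simp

lemma subgroup_H: "subgroup H F"
  unfolding H_def by (rule F.subgroups_Inter_pair[OF subgroup_J subgroup_D])

text \<open>Composition with \<Lambda> gives a homomorphism from \<open>F\<close> to an abelian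
  group. Each choice of \<open>h\<close> yields one equation between \<open>lam x\<close> and
  \<open>\<pi> x\<close>.\<close>

lemma hom_lift_trivial:
  assumes Y: "comm_group Y" and h: "h \<in> hom T.E Y" and x: "x \<in> D"
  shows "h (lam x, \<pi> x) = \<one>\<^bsub>Y\<^esub>"
proof -
  have "h \<circ> \<Lambda> \<in> hom F Y"
    using Group.hom_compose[OF Lam_hom h] .
  then have "(h \<circ> \<Lambda>) x = \<one>\<^bsub>Y\<^esub>"
    using hom_derived_trivial[OF F.is_group Y _ x] by blast
  moreover have "x \<in> carrier F" using F.derived_in_carrier[of "carrier F"] x by blast
  ultimately show ?thesis by (simp add: Lam_eq)
qed

text \<open>A model of \<open>C_1(M) -> C_1(M,A)\<close>: dropping the simplices in \<open>A\<close>
  splits this quotient, so no quotient group is needed as a target.\<close>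

definition "forget = frag_extend (\<lambda>\<sigma>. if SA 1 \<sigma> then 0 else frag_of \<sigma>)"

lemma forget_diff: "singular_chain 1 M c \<Longrightarrow> singular_chain 1 (subtopology M A) (c - forget c) \<and> singular_chain 1 M (forget c)"
proof -
  assume "singular_chain 1 M c"
  then have "singular_chain 1 M c \<and> singular_chain 1 (subtopology M A) (c - forget c) \<and> singular_chain 1 M (forget c)"
    unfolding singular_chain_def
  proof (induction rule: frag_induction)
    case (diff a b)
    then have ab: "singular_chain 1 M a" "singular_chain 1 M b" "singular_chain 1 M (forget a)" "singular_chain 1 M (forget b)"
      "singular_chain 1 (subtopology M A) (a - forget a)" "singular_chain 1 (subtopology M A) (b - forget b)"
      by (auto simp: singular_chain_def)
    have "(a - b) - forget (a - b) = (a - forget a) - (b - forget b)"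
      by (simp add: forget_def frag_extend_diff)
    moreover have "forget (a - b) = forget a - forget b"
      by (simp add: forget_def frag_extend_diff)
    ultimately show ?case
      using singular_chain_diff[OF ab(1,2)] singular_chain_diff[OF ab(3,4)] singular_chain_diff[OF ab(5,6)]
      unfolding singular_chain_def by metis
  qed (auto simp: forget_def)
  then show ?thesis by blast
qed

lemma forget_sub: "singular_chain 1 (subtopology M A) c \<Longrightarrow> forget c = 0"
  unfolding forget_def singular_chain_def
  by (rule frag_extend_eq_0) auto

text \<open>The boundary modulo \<open>A\<close> is a homomorphism on \<open>Q\<close> that takes
  the class of \<open>t g h\<close> to \<open>e g + e h - e (g h)\<close>, the defect of
  \<open>e\<close>. Hence on \<open>[F,F]\<close> the boundary of \<open>lam x\<close> is minus
  \<open>e (\<pi> x)\<close>, and this edge lies in \<open>A\<close> because \<open>\<pi> x\<close>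
  is a power of \<open>w\<close>.\<close>

lemma lam_relcycle:
  assumes x: "x \<in> H"
  shows "\<exists>c. singular_relcycle 2 M A c \<and> lam x = cls c"
proof -
  have xF: "x \<in> carrier F" and xJ: "x \<in> J" and xD: "x \<in> D"
    using x J_carrier by (auto simp: H_def)
  obtain c where c: "singular_chain 2 M c" "lam x = cls c"
    using lam_closed[OF xF] by (auto simp: carrier_Q)
  let ?Y = "chain_group 1 M"
  have bd: "singular_chain 1 M (chain_boundary 2 a)" if "singular_chain 2 M a" for a
    using singular_chain_boundary[OF that] by (simp add: numeral_2_eq_2)
  define h where "h c = forget (chain_boundary 2 c)" for c :: "'m chain"
  have h: "h \<in> hom (chain_group 2 M) ?Y"
  proof (rule homI)
    show "h c \<in> carrier ?Y" if "c \<in> carrier (chain_group 2 M)" for c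
      using forget_diff[OF bd] that by (simp add: h_def)
    show "h (a \<otimes>\<^bsub>chain_group 2 M\<^esub> b) = h a \<otimes>\<^bsub>?Y\<^esub> h b"
      if "a \<in> carrier (chain_group 2 M)" "b \<in> carrier (chain_group 2 M)" for a b
      by (simp add: h_def chain_boundary_add forget_def frag_extend_add)
  qed
  have hb: "h a = \<one>\<^bsub>?Y\<^esub>" if a: "singular_relboundary 2 M A a" for a
  proof -
    obtain d b where da: "singular_chain 3 M d" "singular_chain 2 (subtopology M A) b"
        "a = chain_boundary 3 d + b"
      using a by (auto simp: singular_relboundary numeral_2_eq_2 numeral_3_eq_3)
    have "chain_boundary 2 (chain_boundary 3 d) = 0"
      using chain_boundary_boundary[OF da(1)] by (simp add: numeral_2_eq_2 numeral_3_eq_3)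
    then have "chain_boundary 2 a = chain_boundary 2 b"
      by (simp add: da chain_boundary_add)
    moreover have "singular_chain 1 (subtopology M A) (chain_boundary 2 b)"
      using singular_chain_boundary[OF da(2)] by (simp add: numeral_2_eq_2)
    ultimately show ?thesis
      by (simp add: h_def forget_sub)
  qed
  obtain r where r: "r \<in> hom Q ?Y" and rh: "\<And>c. singular_chain 2 M c \<Longrightarrow> r (cls c) = h c"
    using hom_from_Q[OF group_chain_group h hb] by blast
  let ?s = "\<lambda>g. forget (frag_of (e g))"
  have eh: "(\<lambda>x. r (fst x) \<otimes>\<^bsub>?Y\<^esub> ?s (snd x)) \<in> hom T.E ?Y"
  proof (rule T.hom_E[OF group_chain_group r])
    show "?s \<in> carrier (F Mod R) \<rightarrow> carrier ?Y"
      using forget_diff e by (auto simp: singular_chain_of)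
    fix g h assume g: "g \<in> carrier (F Mod R)" "h \<in> carrier (F Mod R)"
    show "r (T g h) \<otimes>\<^bsub>?Y\<^esub> ?s (g \<otimes>\<^bsub>F Mod R\<^esub> h) = ?s g \<otimes>\<^bsub>?Y\<^esub> ?s h"
      using g by (simp add: T_def rh t_chain h_def chain_boundary_2 t forget_def frag_extend_add frag_extend_diff
          del: mult_FactGroup)
  qed (simp add: add.commute)
  have "r (lam x) + ?s (\<pi> x) = 0"
    using hom_lift_trivial[OF abelian_chain_group eh xD] by simp
  moreover have "?s (\<pi> x) = 0"
    using e(5)[OF W_carrier] J_W[OF xJ] by (intro forget_sub) (simp add: singular_chain_of)
  ultimately have "forget (chain_boundary 2 c) = 0"
    using c rh by (simp add: h_def)
  then have "singular_chain 1 (subtopology M A) (chain_boundary 2 c)"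
    using forget_diff[OF bd[OF c(1)]] by simp
  then show ?thesis using c by (auto simp: singular_relcycle)
qed

text \<open>The exponent of \<open>\<pi> x\<close> is detected first, by an integer-valued map, so
  that \<open>\<pi> x\<close> is trivial. The extension is then mapped to \<open>F/K\<close> by
  means of \<open>s\<close>: on \<open>[F,F]\<close> the composite with \<Lambda> is the coset map,
  while it sends an \<open>x\<close> with trivial \<open>lam x\<close> and trivial
  \<open>\<pi> x\<close> to the unit.\<close>

lemma lam_kernel:
  assumes x: "x \<in> H" and 1: "lam x = \<one>\<^bsub>Q\<^esub>"
  shows "x \<in> K"
proof -
  have xF: "x \<in> carrier F" and xJ: "x \<in> J" and xD: "x \<in> D"
    using x J_carrier by (auto simp: H_def)
  obtain k :: int where k: "\<pi> x = w [^]\<^bsub>F Mod R\<^esub> k"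
    using J_W[OF xJ] by (auto simp: W_def)
  \<comment> \<open>\<open>kf\<close> is unspecified off \<open>W\<close>. Integers are all central,
    so its defect is admissible everywhere, and on \<open>W\<close> exponents add.\<close>
  have "\<exists>r \<in> hom Q integer_group. (\<forall>q \<in> carrier Q. r q \<in> group_center integer_group) \<and>
    (\<lambda>x. r (fst x) \<otimes>\<^bsub>integer_group\<^esub> kf (snd x)) \<in> hom T.E integer_group"
  proof (rule defect_hom)
    show "kf g \<otimes>\<^bsub>integer_group\<^esub> kf h = kf (g \<otimes>\<^bsub>F Mod R\<^esub> h)" if "g \<in> W" "h \<in> W" for g h
      using that by (auto simp: W_def kf int_pow_mult[OF w_closed, symmetric] simp del: mult_FactGroup)
  qed (auto simp: group_center_def)
  then obtain r where r: "r \<in> hom Q integer_group"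
    and re: "(\<lambda>x. r (fst x) \<otimes>\<^bsub>integer_group\<^esub> kf (snd x)) \<in> hom T.E integer_group" by blast
  have "r (lam x) + kf (\<pi> x) = 0"
    using hom_lift_trivial[OF abelian_integer_group re xD] by simp
  moreover have "r (lam x) = 0"
    using hom_one[OF r Q.is_group] 1 by simp
  ultimately have "k = 0" by (simp add: k kf)
  then have pix: "\<pi> x = w [^]\<^bsub>F Mod R\<^esub> (0::int)" using k by simp
  let ?Y = "F Mod K"
  interpret Y: group ?Y by (rule K.factorgroup_is_group)
  interpret q: group_hom F ?Y "\<lambda>x. K #>\<^bsub>F\<^esub> x"
    by (simp add: group_hom_def group_hom_axioms_def K.r_coset_hom_Mod Y.is_group)
  \<comment> \<open>The defect of \<open>s\<close> lies in \<open>R\<close>, whose image in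
    \<open>F/K\<close> is central; on \<open>W\<close> it is trivial because powers of
    \<open>w\<close> go to powers of \<open>wbar\<close>.\<close>
  have "\<exists>r \<in> hom Q ?Y. (\<forall>q \<in> carrier Q. r q \<in> group_center ?Y) \<and>
    (\<lambda>x. r (fst x) \<otimes>\<^bsub>?Y\<^esub> (K #>\<^bsub>F\<^esub> s (snd x))) \<in> hom T.E ?Y"
  proof (rule defect_hom)
    show "K #>\<^bsub>F\<^esub> s g \<in> carrier ?Y" if "g \<in> carrier (F Mod R)" for g
      using q.hom_closed[OF s(1)[OF that]] .
    show "(K #>\<^bsub>F\<^esub> s g) \<otimes>\<^bsub>?Y\<^esub> (K #>\<^bsub>F\<^esub> s h) \<otimes>\<^bsub>?Y\<^esub> inv\<^bsub>?Y\<^esub> (K #>\<^bsub>F\<^esub> s (g \<otimes>\<^bsub>F Mod R\<^esub> h)) \<in> group_center ?Y"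
      if g: "g \<in> carrier (F Mod R)" "h \<in> carrier (F Mod R)" for g h
    proof -
      note sc = s(1)[OF g(1)] s(1)[OF g(2)] s(1)[OF m_closed[OF g]]
      have "(K #>\<^bsub>F\<^esub> s g) \<otimes>\<^bsub>?Y\<^esub> (K #>\<^bsub>F\<^esub> s h) \<otimes>\<^bsub>?Y\<^esub> inv\<^bsub>?Y\<^esub> (K #>\<^bsub>F\<^esub> s (g \<otimes>\<^bsub>F Mod R\<^esub> h)) =
        K #>\<^bsub>F\<^esub> (s g \<otimes>\<^bsub>F\<^esub> s h \<otimes>\<^bsub>F\<^esub> inv\<^bsub>F\<^esub> s (g \<otimes>\<^bsub>F Mod R\<^esub> h))"
        using sc by (simp only: q.hom_mult q.hom_inv F.m_closed F.inv_closed)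
      then show ?thesis using coset_R_central[OF s_defect[OF g]] by simp
    qed
    show "(K #>\<^bsub>F\<^esub> s g) \<otimes>\<^bsub>?Y\<^esub> (K #>\<^bsub>F\<^esub> s h) = K #>\<^bsub>F\<^esub> s (g \<otimes>\<^bsub>F Mod R\<^esub> h)" if "g \<in> W" "h \<in> W" for g h
      using q.hom_mult[OF s(1)[OF W_carrier[OF that(1)]] s(1)[OF W_carrier[OF that(2)]]] s_W_mult[OF that] by simp
  qed (rule Y.is_group)
  then obtain r where r: "r \<in> hom Q ?Y" and rc: "\<And>q. q \<in> carrier Q \<Longrightarrow> r q \<in> group_center ?Y"
    and re: "(\<lambda>x. r (fst x) \<otimes>\<^bsub>?Y\<^esub> (K #>\<^bsub>F\<^esub> s (snd x))) \<in> hom T.E ?Y" by blast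
  let ?h = "(\<lambda>x. r (fst x) \<otimes>\<^bsub>?Y\<^esub> (K #>\<^bsub>F\<^esub> s (snd x))) \<circ> \<Lambda>"
  \<comment> \<open>Up to the central factor \<open>r (lam y)\<close>, the map sends
    \<open>y\<close> to the coset of \<open>s (\<pi> y)\<close>, which differs from \<open>y\<close>
    by an element of \<open>R\<close>. So it agrees with the coset map modulo the centre, hence
    exactly on \<open>[F,F]\<close>.\<close>
  have "?h x = K #>\<^bsub>F\<^esub> x"
  proof (rule hom_eq_on_derived[OF F.is_group Y.is_group Group.hom_compose[OF Lam_hom re] K.r_coset_hom_Mod _ xD])
    fix y assume y: "y \<in> carrier F"
    note sc = s(1)[OF pi.hom_closed[OF y]]
    have "\<pi> (s (\<pi> y) \<otimes>\<^bsub>F\<^esub> inv\<^bsub>F\<^esub> y) = \<pi> (s (\<pi> y)) \<otimes>\<^bsub>F Mod R\<^esub> inv\<^bsub>F Mod R\<^esub> (\<pi> y)"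
      using sc y by (simp only: pi_mult pi.hom_inv F.inv_closed)
    also have "\<dots> = \<one>\<^bsub>F Mod R\<^esub>"
      unfolding s(2)[OF pi.hom_closed[OF y]] using y by (simp only: r_inv pi.hom_closed)
    finally have sR: "s (\<pi> y) \<otimes>\<^bsub>F\<^esub> inv\<^bsub>F\<^esub> y \<in> R"
      by (rule pi_eq_one[THEN iffD1, rotated]) (intro F.m_closed F.inv_closed sc y)
    have rl: "r (lam y) \<in> group_center ?Y" using rc[OF lam_closed[OF y]] .
    have "?h y \<otimes>\<^bsub>?Y\<^esub> inv\<^bsub>?Y\<^esub> (K #>\<^bsub>F\<^esub> y) = r (lam y) \<otimes>\<^bsub>?Y\<^esub> ((K #>\<^bsub>F\<^esub> s (\<pi> y)) \<otimes>\<^bsub>?Y\<^esub> inv\<^bsub>?Y\<^esub> (K #>\<^bsub>F\<^esub> y))"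
      using Y.m_assoc[OF Y.group_center_carrier[OF rl] q.hom_closed[OF sc] Y.inv_closed[OF q.hom_closed[OF y]]] y
      by (simp add: Lam_eq del: mult_FactGroup)
    also have "(K #>\<^bsub>F\<^esub> s (\<pi> y)) \<otimes>\<^bsub>?Y\<^esub> inv\<^bsub>?Y\<^esub> (K #>\<^bsub>F\<^esub> y) = K #>\<^bsub>F\<^esub> (s (\<pi> y) \<otimes>\<^bsub>F\<^esub> inv\<^bsub>F\<^esub> y)"
      using sc y by (simp only: q.hom_mult q.hom_inv F.inv_closed)
    finally show "?h y \<otimes>\<^bsub>?Y\<^esub> inv\<^bsub>?Y\<^esub> (K #>\<^bsub>F\<^esub> y) \<in> group_center ?Y"
      using subgroup.m_closed[OF Y.subgroup_group_center rl coset_R_central[OF sR]] by simp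
  qed
  moreover have "?h x = r (lam x) \<otimes>\<^bsub>?Y\<^esub> (K #>\<^bsub>F\<^esub> s (\<pi> x))"
    using xF by (simp add: Lam_eq del: mult_FactGroup)
  moreover have "r (lam x) = \<one>\<^bsub>?Y\<^esub>" unfolding 1 by (rule hom_one[OF r Q.is_group Y.is_group])
  moreover have "K #>\<^bsub>F\<^esub> s (\<pi> x) = \<one>\<^bsub>?Y\<^esub>"
    unfolding pix s_w using q.hom_one by simp
  ultimately have "K #>\<^bsub>F\<^esub> x = \<one>\<^bsub>?Y\<^esub>"
    by (metis Y.r_one Y.one_closed)
  then show ?thesis using K_coset_eq[OF xF] by simp
qed

text \<open>A 2-chain is traded for an element of \<open>R\<close> whose \<open>lam\<close>-value
  differs from the class of the chain by a term depending only on the boundary. For a relative cycle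
  the boundary lies in \<open>A\<close>, and this term is \<open>lam\<close> of a power of
  \<open>wbar\<close>, which can be divided off. The class in \<open>F/[F,F]\<close> is followed in
  parallel, to ensure that the quotient lies in \<open>[F,F]\<close>.\<close>

lemma lam_surj:
  assumes z: "singular_relcycle 2 M A z"
  shows "\<exists>x \<in> H. lam x = cls z"
proof -
  let ?Y = "F Mod D"
  interpret D: normal D F by (rule F.derived_self_is_normal)
  interpret Y: comm_group ?Y by (rule F.derived_quot_is_comm_group)
  interpret ab: group_hom F ?Y "\<lambda>x. D #>\<^bsub>F\<^esub> x"
    by (simp add: group_hom_def group_hom_axioms_def D.r_coset_hom_Mod Y.is_group)
  let ?G = "F Mod R"
  have lsc: "lam (s (gv \<sigma>)) \<in> carrier Q" "s (gv \<sigma>) \<in> carrier F" if "S 1 \<sigma>" for \<sigma>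
    using lam_closed s gv_closed[OF that] by auto
  have qc: "cls (q_chain \<sigma>) \<in> carrier Q" if "S 1 \<sigma>" for \<sigma>
    using cls_closed q_chain that by auto
  \<comment> \<open>The squares are subtracted so as to cancel those produced by
    \<open>prism\<close>.\<close>
  have "\<exists>l \<in> hom (chain_group 1 M) Q. \<forall>\<sigma>. S 1 \<sigma> \<longrightarrow>
      l (frag_of \<sigma>) = lam (s (gv \<sigma>)) \<otimes>\<^bsub>Q\<^esub> inv\<^bsub>Q\<^esub> cls (q_chain \<sigma>)"
    by (rule hom_from_chain_group[OF comm_group_Q]) (intro Q.m_closed Q.inv_closed lsc qc)
  then obtain l where l: "l \<in> hom (chain_group 1 M) Q"
    and lf: "\<And>\<sigma>. S 1 \<sigma> \<Longrightarrow> l (frag_of \<sigma>) = lam (s (gv \<sigma>)) \<otimes>\<^bsub>Q\<^esub> inv\<^bsub>Q\<^esub> cls (q_chain \<sigma>)"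
    by metis
  \<comment> \<open>\<open>m\<close> is the bookkeeping in the abelianisation of
    \<open>F\<close>.\<close>
  have "\<exists>m \<in> hom (chain_group 1 M) ?Y. \<forall>\<sigma>. S 1 \<sigma> \<longrightarrow> m (frag_of \<sigma>) = D #>\<^bsub>F\<^esub> s (gv \<sigma>)"
    by (rule hom_from_chain_group[OF Y.comm_group_axioms]) (intro ab.hom_closed lsc)
  then obtain m where m: "m \<in> hom (chain_group 1 M) ?Y"
    and mf: "\<And>\<sigma>. S 1 \<sigma> \<Longrightarrow> m (frag_of \<sigma>) = D #>\<^bsub>F\<^esub> s (gv \<sigma>)"
    by metis
  interpret l: group_hom "chain_group 1 M" Q l
    by (simp add: group_hom_def group_hom_axioms_def l Q.is_group del: One_nat_def)
  interpret m: group_hom "chain_group 1 M" ?Y m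
    by (simp add: group_hom_def group_hom_axioms_def m Y.is_group del: One_nat_def)
  have l_add: "l (a + b) = l a \<otimes>\<^bsub>Q\<^esub> l b" if "singular_chain 1 M a" "singular_chain 1 M b" for a b
    using l.hom_mult[of a b] that by (simp del: One_nat_def)
  have m_add: "m (a + b) = m a \<otimes>\<^bsub>?Y\<^esub> m b" if "singular_chain 1 M a" "singular_chain 1 M b" for a b
    using m.hom_mult[of a b] that by (simp del: One_nat_def)
  have lc: "l a \<in> carrier Q" and mc: "m a \<in> carrier ?Y" if "singular_chain 1 M a" for a
    using l.hom_closed[of a] m.hom_closed[of a] that by (simp_all del: One_nat_def)
  have l_diff: "l (a - b) = l a \<otimes>\<^bsub>Q\<^esub> inv\<^bsub>Q\<^esub> l b" and m_diff: "m (a - b) = m a \<otimes>\<^bsub>?Y\<^esub> inv\<^bsub>?Y\<^esub> m b"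
    if "singular_chain 1 M a" "singular_chain 1 M b" for a b
  proof -
    note dc = singular_chain_diff[OF that]
    show "l (a - b) = l a \<otimes>\<^bsub>Q\<^esub> inv\<^bsub>Q\<^esub> l b"
      using Q.inv_solve_right[OF lc[OF dc] lc[OF that(1)] lc[OF that(2)]] l_add[OF dc that(2)] by simp
    show "m (a - b) = m a \<otimes>\<^bsub>?Y\<^esub> inv\<^bsub>?Y\<^esub> m b"
      using Y.inv_solve_right[OF mc[OF dc] mc[OF that(1)] mc[OF that(2)]] m_add[OF dc that(2)] by simp
  qed
  have l0: "l 0 = \<one>\<^bsub>Q\<^esub>" and m0: "m 0 = \<one>\<^bsub>?Y\<^esub>"
    using l.hom_one m.hom_one by (simp_all del: One_nat_def)
  have bd: "singular_chain 1 M (chain_boundary 2 a)" if "singular_chain 2 M a" for a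
    using singular_chain_boundary[OF that] by (simp add: numeral_2_eq_2)
  have RJ: "x \<in> J" "x \<in> carrier F" if "x \<in> R" for x
    using R_sub_J R.subset that by auto
  have P: "\<exists>x \<in> R. lam x = cls c \<otimes>\<^bsub>Q\<^esub> l (chain_boundary 2 c) \<and> D #>\<^bsub>F\<^esub> x = m (chain_boundary 2 c)"
    if "singular_chain 2 M c" for c
  proof -
    have "singular_chain 2 M c \<and> (\<exists>x \<in> R. lam x = cls c \<otimes>\<^bsub>Q\<^esub> l (chain_boundary 2 c) \<and> D #>\<^bsub>F\<^esub> x = m (chain_boundary 2 c))"
      using that unfolding singular_chain_def
    proof (induction rule: frag_induction)
      case zero
      have "lam \<one>\<^bsub>F\<^esub> = cls 0 \<otimes>\<^bsub>Q\<^esub> l (chain_boundary 2 0)" by (simp add: lam_one cls_0 l0)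
      moreover have "D #>\<^bsub>F\<^esub> \<one>\<^bsub>F\<^esub> = m (chain_boundary 2 0)" using ab.hom_one m0 by simp
      ultimately show ?case using R.one_closed by (intro conjI) (simp, blast)
    next
      case (one \<tau>)
      then have \<tau>: "S 2 \<tau>" by simp
      let ?\<alpha> = "tri_01 \<tau>" and ?\<beta> = "tri_12 \<tau>" and ?\<delta> = "tri_02 \<tau>"
      let ?g = "gv ?\<alpha>" and ?h = "gv ?\<beta>"
      note S1 = singular_simplex_tri(1)[OF \<tau>] singular_simplex_tri(3)[OF \<tau>] singular_simplex_tri(2)[OF \<tau>]
      note C1 = S1[folded singular_chain_of]
      have gh: "?g \<otimes>\<^bsub>?G\<^esub> ?h = gv ?\<delta>" by (rule gv_tri[OF \<tau>])
      note g = gv_closed[OF S1(1)] gv_closed[OF S1(2)] gv_closed[OF S1(3)]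
      \<comment> \<open>For a single triangle the witness is the defect of the section on its
        labels.\<close>
      let ?x = "s ?g \<otimes>\<^bsub>F\<^esub> s ?h \<otimes>\<^bsub>F\<^esub> inv\<^bsub>F\<^esub> s (gv ?\<delta>)"
      have xR: "?x \<in> R" using s_defect[OF g(1,2)] unfolding gh .
      note sc = s(1)[OF g(1)] s(1)[OF g(2)] s(1)[OF g(3)]
      note ls = lam_closed[OF sc(1)] lam_closed[OF sc(2)] lam_closed[OF sc(3)]
      note q = qc[OF S1(1)] qc[OF S1(2)] qc[OF S1(3)]
      note qs = q_chain[OF S1(1)] q_chain[OF S1(2)] q_chain[OF S1(3)]
      have xs: "?x \<otimes>\<^bsub>F\<^esub> s (gv ?\<delta>) = s ?g \<otimes>\<^bsub>F\<^esub> s ?h"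
        using sc by (simp add: F.m_assoc)
      have "lam (?x \<otimes>\<^bsub>F\<^esub> s (gv ?\<delta>)) = lam ?x \<otimes>\<^bsub>Q\<^esub> lam (s (gv ?\<delta>)) \<otimes>\<^bsub>Q\<^esub> T (\<pi> ?x) (\<pi> (s (gv ?\<delta>)))"
        by (rule lam_mult[OF RJ(2)[OF xR] sc(3)])
      also have "\<pi> ?x = \<one>\<^bsub>?G\<^esub>" using pi_eq_one[OF RJ(2)[OF xR]] xR by blast
      also have "T \<one>\<^bsub>?G\<^esub> (\<pi> (s (gv ?\<delta>))) = \<one>\<^bsub>Q\<^esub>"
        by (rule T.t_one_left[OF pi.hom_closed[OF sc(3)]])
      finally have e1: "lam ?x \<otimes>\<^bsub>Q\<^esub> lam (s (gv ?\<delta>)) = lam (s ?g) \<otimes>\<^bsub>Q\<^esub> lam (s ?h) \<otimes>\<^bsub>Q\<^esub> T ?g ?h"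
        unfolding xs lam_mult[OF sc(1,2)] s(2)[OF g(1)] s(2)[OF g(2)]
        using lam_closed[OF RJ(2)[OF xR]] ls by simp
      have Tc: "T ?g ?h \<in> carrier Q" using T.t_closed g by blast
      have cl: "cls (frag_of \<tau>) = T ?g ?h \<otimes>\<^bsub>Q\<^esub> cls (q_chain ?\<alpha>) \<otimes>\<^bsub>Q\<^esub> cls (q_chain ?\<beta>) \<otimes>\<^bsub>Q\<^esub> inv\<^bsub>Q\<^esub> cls (q_chain ?\<delta>)"
        using prism[OF \<tau>] qs t_chain[OF g(1,2)]
        by (simp add: cls_add cls_diff T_def singular_chain_add flip: cls_eq)
      have lb: "l (chain_boundary 2 (frag_of \<tau>)) = l (frag_of ?\<beta>) \<otimes>\<^bsub>Q\<^esub> inv\<^bsub>Q\<^esub> l (frag_of ?\<delta>) \<otimes>\<^bsub>Q\<^esub> l (frag_of ?\<alpha>)"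
        using C1 by (simp add: chain_boundary_2 l_add l_diff singular_chain_diff del: One_nat_def)
      have mb: "m (chain_boundary 2 (frag_of \<tau>)) = m (frag_of ?\<beta>) \<otimes>\<^bsub>?Y\<^esub> inv\<^bsub>?Y\<^esub> m (frag_of ?\<delta>) \<otimes>\<^bsub>?Y\<^esub> m (frag_of ?\<alpha>)"
        using C1 by (simp add: chain_boundary_2 m_add m_diff singular_chain_diff del: One_nat_def mult_FactGroup)
      \<comment> \<open>Each square from \<open>prism\<close> meets its inverse from
        \<open>l\<close>; what is left is the cocycle and three values of \<open>lam\<close>, which
        \<open>e1\<close> combines to \<open>lam ?x\<close>.\<close>
      have "cls (frag_of \<tau>) \<otimes>\<^bsub>Q\<^esub> l (chain_boundary 2 (frag_of \<tau>)) =
         (lam (s ?g) \<otimes>\<^bsub>Q\<^esub> lam (s ?h) \<otimes>\<^bsub>Q\<^esub> T ?g ?h) \<otimes>\<^bsub>Q\<^esub> inv\<^bsub>Q\<^esub> lam (s (gv ?\<delta>))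
         \<otimes>\<^bsub>Q\<^esub> (cls (q_chain ?\<alpha>) \<otimes>\<^bsub>Q\<^esub> inv\<^bsub>Q\<^esub> cls (q_chain ?\<alpha>)) \<otimes>\<^bsub>Q\<^esub> (cls (q_chain ?\<beta>) \<otimes>\<^bsub>Q\<^esub> inv\<^bsub>Q\<^esub> cls (q_chain ?\<beta>))
         \<otimes>\<^bsub>Q\<^esub> (inv\<^bsub>Q\<^esub> cls (q_chain ?\<delta>) \<otimes>\<^bsub>Q\<^esub> cls (q_chain ?\<delta>))"
        unfolding cl lb lf[OF S1(1)] lf[OF S1(2)] lf[OF S1(3)] using q ls Tc
        by (simp only: Q.inv_mult Q.inv_inv Q.m_ac Q.m_closed Q.inv_closed)
      also have "\<dots> = lam ?x"
        using q ls Tc lam_closed[OF RJ(2)[OF xR]] by (simp add: Q.m_assoc flip: e1)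
      finally have "lam ?x = cls (frag_of \<tau>) \<otimes>\<^bsub>Q\<^esub> l (chain_boundary 2 (frag_of \<tau>))" by simp
      moreover have "D #>\<^bsub>F\<^esub> ?x = m (chain_boundary 2 (frag_of \<tau>))"
      proof -
        have "D #>\<^bsub>F\<^esub> ?x = (D #>\<^bsub>F\<^esub> s ?g) \<otimes>\<^bsub>?Y\<^esub> (D #>\<^bsub>F\<^esub> s ?h) \<otimes>\<^bsub>?Y\<^esub> inv\<^bsub>?Y\<^esub> (D #>\<^bsub>F\<^esub> s (gv ?\<delta>))"
          using sc by (simp only: ab.hom_mult ab.hom_inv F.m_closed F.inv_closed)
        then show ?thesis
          unfolding mb mf[OF S1(1)] mf[OF S1(2)] mf[OF S1(3)] using sc
          by (simp only: Y.m_ac Y.m_closed Y.inv_closed ab.hom_closed)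
      qed
      ultimately show ?case using \<tau> xR by auto
    next
      case (diff a b)
      then have C: "singular_chain 2 M a" "singular_chain 2 M b" by (auto simp: singular_chain_def)
      note B = bd[OF C(1)] bd[OF C(2)]
      obtain x where x: "x \<in> R" "lam x = cls a \<otimes>\<^bsub>Q\<^esub> l (chain_boundary 2 a)" "D #>\<^bsub>F\<^esub> x = m (chain_boundary 2 a)"
        using diff by blast
      obtain y where y: "y \<in> R" "lam y = cls b \<otimes>\<^bsub>Q\<^esub> l (chain_boundary 2 b)" "D #>\<^bsub>F\<^esub> y = m (chain_boundary 2 b)"
        using diff by blast
      have "lam (x \<otimes>\<^bsub>F\<^esub> inv\<^bsub>F\<^esub> y) = lam x \<otimes>\<^bsub>Q\<^esub> inv\<^bsub>Q\<^esub> lam y"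
        using lam_mult_J[of x "inv\<^bsub>F\<^esub> y"] lam_inv_J[of y] RJ x y by simp
      also have "\<dots> = cls (a - b) \<otimes>\<^bsub>Q\<^esub> l (chain_boundary 2 (a - b))"
        unfolding x(2) y(2) chain_boundary_diff l_diff[OF B] cls_diff[OF C]
        using cls_closed[OF C(1)] cls_closed[OF C(2)] lc[OF B(1)] lc[OF B(2)]
        by (simp only: Q.inv_mult Q.m_ac Q.m_closed Q.inv_closed)
      finally have 1: "lam (x \<otimes>\<^bsub>F\<^esub> inv\<^bsub>F\<^esub> y) = cls (a - b) \<otimes>\<^bsub>Q\<^esub> l (chain_boundary 2 (a - b))" .
      have "D #>\<^bsub>F\<^esub> (x \<otimes>\<^bsub>F\<^esub> inv\<^bsub>F\<^esub> y) = (D #>\<^bsub>F\<^esub> x) \<otimes>\<^bsub>?Y\<^esub> inv\<^bsub>?Y\<^esub> (D #>\<^bsub>F\<^esub> y)"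
        using RJ x(1) y(1) by (simp only: ab.hom_mult ab.hom_inv F.inv_closed)
      also have "\<dots> = m (chain_boundary 2 (a - b))"
        unfolding x(3) y(3) chain_boundary_diff m_diff[OF B] ..
      finally have 2: "D #>\<^bsub>F\<^esub> (x \<otimes>\<^bsub>F\<^esub> inv\<^bsub>F\<^esub> y) = m (chain_boundary 2 (a - b))" .
      have "x \<otimes>\<^bsub>F\<^esub> inv\<^bsub>F\<^esub> y \<in> R" using x y by simp
      moreover have "Poly_Mapping.keys (a - b) \<subseteq> singular_simplex_set 2 M"
        using singular_chain_diff[OF C] by (simp add: singular_chain_def)
      ultimately show ?case using 1 2 by blast
    qed
    then show ?thesis ..
  qed
  \<comment> \<open>On an edge of \<open>A\<close> the square is a chain of \<open>A\<close>, hence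
    trivial in \<open>Q\<close>, and the section takes the label to a power of
    \<open>wbar\<close>.\<close>
  have PA: "\<exists>k::int. l d = lam (wbar [^]\<^bsub>F\<^esub> k) \<and> m d = D #>\<^bsub>F\<^esub> (wbar [^]\<^bsub>F\<^esub> k)"
    if "singular_chain 1 (subtopology M A) d" for d
  proof -
    have "singular_chain 1 (subtopology M A) d \<and> (\<exists>k::int. l d = lam (wbar [^]\<^bsub>F\<^esub> k) \<and> m d = D #>\<^bsub>F\<^esub> (wbar [^]\<^bsub>F\<^esub> k))"
      using that unfolding singular_chain_def
    proof (induction rule: frag_induction)
      case zero
      have "l 0 = lam (wbar [^]\<^bsub>F\<^esub> (0::int))" by (simp add: lam_one l0)
      moreover have "m 0 = D #>\<^bsub>F\<^esub> (wbar [^]\<^bsub>F\<^esub> (0::int))" using ab.hom_one m0 by simp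
      ultimately show ?case by (intro conjI) (simp, blast)
    next
      case (one \<sigma>)
      then have SA: "SA 1 \<sigma>" by simp
      then obtain k :: int where k: "gv \<sigma> = w [^]\<^bsub>?G\<^esub> k" using gv_sub by blast
      have "l (frag_of \<sigma>) = lam (wbar [^]\<^bsub>F\<^esub> k)"
        using lf[OF sub_simplex[OF SA]] cls_sub[OF q_chain_sub[OF SA]] lsc(1)[OF sub_simplex[OF SA]]
        by (simp add: k s_w)
      moreover have "m (frag_of \<sigma>) = D #>\<^bsub>F\<^esub> (wbar [^]\<^bsub>F\<^esub> k)"
        using mf[OF sub_simplex[OF SA]] by (simp add: k s_w)
      ultimately show ?case using SA by auto
    next
      case (diff a b)
      then have C: "singular_chain 1 (subtopology M A) a" "singular_chain 1 (subtopology M A) b"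
        by (auto simp: singular_chain_def)
      note C' = sub_chain[OF C(1)] sub_chain[OF C(2)]
      obtain j k :: int where j: "l a = lam (wbar [^]\<^bsub>F\<^esub> j)" "m a = D #>\<^bsub>F\<^esub> (wbar [^]\<^bsub>F\<^esub> j)"
        and k: "l b = lam (wbar [^]\<^bsub>F\<^esub> k)" "m b = D #>\<^bsub>F\<^esub> (wbar [^]\<^bsub>F\<^esub> k)"
        using diff by blast
      have jk: "wbar [^]\<^bsub>F\<^esub> (j - k) = wbar [^]\<^bsub>F\<^esub> j \<otimes>\<^bsub>F\<^esub> inv\<^bsub>F\<^esub> (wbar [^]\<^bsub>F\<^esub> k)"
        using wbar by (simp add: F.int_pow_diff)
      have "l (a - b) = lam (wbar [^]\<^bsub>F\<^esub> (j - k))"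
        unfolding jk l_diff[OF C'] j k
        using lam_mult_J[OF wbar_pow_J subgroup.m_inv_closed[OF subgroup_J wbar_pow_J]] lam_inv_J[OF wbar_pow_J] by simp
      moreover have "m (a - b) = D #>\<^bsub>F\<^esub> (wbar [^]\<^bsub>F\<^esub> (j - k))"
        unfolding jk m_diff[OF C'] j k using wbar
        by (simp only: ab.hom_mult ab.hom_inv F.inv_closed F.int_pow_closed)
      moreover have "Poly_Mapping.keys (a - b) \<subseteq> singular_simplex_set 1 (subtopology M A)"
        using singular_chain_diff[OF C] by (simp add: singular_chain_def)
      ultimately show ?case by blast
    qed
    then show ?thesis ..
  qed
  have zc: "singular_chain 2 M z" and zA: "singular_chain 1 (subtopology M A) (chain_boundary 2 z)"
    using z by (auto simp: singular_relcycle)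
  obtain x where x: "x \<in> R" "lam x = cls z \<otimes>\<^bsub>Q\<^esub> l (chain_boundary 2 z)" "D #>\<^bsub>F\<^esub> x = m (chain_boundary 2 z)"
    using P[OF zc] by blast
  obtain k :: int where k: "l (chain_boundary 2 z) = lam (wbar [^]\<^bsub>F\<^esub> k)" "m (chain_boundary 2 z) = D #>\<^bsub>F\<^esub> (wbar [^]\<^bsub>F\<^esub> k)"
    using PA[OF zA] by blast
  \<comment> \<open>\<open>x\<close> and the power of \<open>wbar\<close> have the same class in
    \<open>F/[F,F]\<close> by \<open>m\<close>, so their quotient is a commutator element; by
    \<open>l\<close> its \<open>lam\<close>-value is the class of \<open>z\<close>.\<close>
  let ?u = "wbar [^]\<^bsub>F\<^esub> k" and ?y = "x \<otimes>\<^bsub>F\<^esub> inv\<^bsub>F\<^esub> (wbar [^]\<^bsub>F\<^esub> k)"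
  have uJ: "inv\<^bsub>F\<^esub> ?u \<in> J" using subgroup.m_inv_closed[OF subgroup_J wbar_pow_J] .
  have uc: "?u \<in> carrier F" using wbar by simp
  have yJ: "?y \<in> J" using subgroup.m_closed[OF subgroup_J RJ(1)[OF x(1)] uJ] .
  have "D #>\<^bsub>F\<^esub> ?y = (D #>\<^bsub>F\<^esub> x) \<otimes>\<^bsub>?Y\<^esub> inv\<^bsub>?Y\<^esub> (D #>\<^bsub>F\<^esub> ?u)"
    using RJ(2)[OF x(1)] uc by (simp only: ab.hom_mult ab.hom_inv F.inv_closed)
  also have "\<dots> = \<one>\<^bsub>?Y\<^esub>"
    unfolding x(3) k(2) using Y.r_inv[OF ab.hom_closed[OF uc]] .
  finally have "?y \<in> D"
    using F.coset_join1[OF _ _ D.subgroup_axioms, of ?y] J_carrier[OF yJ] D.subset by simp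
  moreover have "lam ?y = cls z"
    using lam_mult_J[OF RJ(1)[OF x(1)] uJ] lam_inv_J[OF wbar_pow_J, of k] x(2) k(1)
      cls_closed[OF zc] lam_closed[OF uc] by (simp add: Q.m_assoc)
  ultimately show ?thesis using yJ by (auto simp: H_def)
qed

text \<open>The first isomorphism theorem for \<open>lam\<close> on \<open>H\<close>, with
  \<open>lam_relcycle\<close> giving the range, \<open>lam_surj\<close> the image, and
  \<open>lam_kernel\<close> with \<open>lam_K\<close> the kernel.\<close>

theorem relative_homology_iso:
  "relative_homology_group 2 M A \<cong> subgroup_generated F (J \<inter> D) Mod K"
proof -
  let ?S = "subgroup_generated F H" and ?RH = "relative_homology_group 2 M A"
  have car: "carrier ?S = H"
    by (rule subgroup.carrier_subgroup_generated_subgroup[OF subgroup_H])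
  have RH: "?RH = relcycle_group 2 M A Mod singular_relboundary_set 2 M A"
    using nontrivial_relative_homology_group[of 2 M A] by simp
  have carRH: "carrier ?RH = cls ` singular_relcycle_set 2 M A"
    using carrier_relative_homology_group[of 2 M A] by (simp add: cls_def)
  \<comment> \<open>Relative homology and \<open>Q\<close> are quotients by the same set, and the
    product of cosets depends only on addition of chains; so the two multiplications coincide as
    functions.\<close>
  have "monoid.mult (relcycle_group 2 M A) = monoid.mult (chain_group 2 M)" by simp
  then have mul: "monoid.mult ?RH = monoid.mult Q"
    unfolding RH Q_def mult_FactGroup set_mult_def by simp
  have one: "\<one>\<^bsub>?RH\<^esub> = \<one>\<^bsub>Q\<^esub>"
    unfolding RH Q_def by simp
  have HJ: "x \<in> J" if "x \<in> H" for x using that by (simp add: H_def)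
  have hom: "lam \<in> hom ?S ?RH"
  proof (rule homI)
    show "lam x \<in> carrier ?RH" if "x \<in> carrier ?S" for x
      using lam_relcycle[of x] that car carRH by auto
    show "lam (x \<otimes>\<^bsub>?S\<^esub> y) = lam x \<otimes>\<^bsub>?RH\<^esub> lam y" if "x \<in> carrier ?S" "y \<in> carrier ?S" for x y
      using that car lam_mult_J[of x y] HJ by (simp add: mul)
  qed
  interpret h: group_hom ?S ?RH lam
    by (simp add: group_hom_def group_hom_axioms_def hom group_relative_homology_group)
  have surj: "lam ` carrier ?S = carrier ?RH"
  proof
    show "lam ` carrier ?S \<subseteq> carrier ?RH" using h.hom_closed by blast
    show "carrier ?RH \<subseteq> lam ` carrier ?S"
      unfolding carRH car using lam_surj by (auto simp: image_iff) (metis)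
  qed
  have "kernel ?S ?RH lam = K"
  proof
    show "kernel ?S ?RH lam \<subseteq> K"
      using lam_kernel by (auto simp: kernel_def car one)
    have "K \<subseteq> H"
      using K_sub_R R_sub_J K_sub_derived by (auto simp: H_def)
    then show "K \<subseteq> kernel ?S ?RH lam"
      using lam_K by (auto simp: kernel_def car one)
  qed
  then have "?S Mod K \<cong> ?RH"
    using h.FactGroup_iso[OF surj] by simp
  moreover have "group (?S Mod K)"
    using normal.factorgroup_is_group[OF h.normal_kernel] \<open>kernel ?S ?RH lam = K\<close> by simp
  ultimately show ?thesis
    using group.iso_sym unfolding H_def by blast
qed

end

section \<open>Filling simplices\<close>

definition simplex_boundary :: "nat \<Rightarrow> (nat \<Rightarrow> real) set" where
  "simplex_boundary n = {x \<in> standard_simplex n. \<exists>i\<le>n. x i = 0}"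

lemma standard_simplexI:
  assumes "\<And>i. i \<le> n \<Longrightarrow> 0 \<le> x i" "\<And>i. i > n \<Longrightarrow> x i = 0" "(\<Sum>i\<le>n. x i) = 1"
  shows "x \<in> standard_simplex n"
proof -
  have "x i \<le> 1" if "i \<le> n" for i
    using member_le_sum[of i "{..n}" x] assms that by auto
  then have "0 \<le> x i \<and> x i \<le> 1" for i
    using assms by (cases "i \<le> n") (auto simp: not_le)
  then show ?thesis
    using assms by (auto simp: standard_simplex_def)
qed

lemma standard_simplexD:
  assumes "x \<in> standard_simplex n"
  shows "0 \<le> x i" "x i \<le> 1" "i > n \<Longrightarrow> x i = 0" "(\<Sum>i\<le>n. x i) = 1"
  using assms by (auto simp: standard_simplex_def)

lemma top_of_set_fun: "subtopology (powertop_real UNIV) B = top_of_set (B :: (nat \<Rightarrow> real) set)"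
  by (simp add: euclidean_product_topology)

lemma compact_standard_simplex: "compact (standard_simplex n)"
  using compactin_standard_simplex[of n] by (simp add: euclidean_product_topology)

lemma continuous_on_coordinate: "continuous_on B (\<lambda>x::nat \<Rightarrow> real. x i)"
  by (rule continuous_on_subset[OF continuous_on_product_coordinates]) auto

lemma continuous_on_funI:
  fixes f :: "'a::topological_space \<Rightarrow> nat \<Rightarrow> real"
  assumes "\<And>i. continuous_on B (\<lambda>x. f x i)"
  shows "continuous_on B f"
  by (rule continuous_on_coordinatewise_then_product[OF assms])

lemma closed_coordinate_zero: "closed {x::nat \<Rightarrow> real. x i = 0}"
proof -
  have "{x::nat \<Rightarrow> real. x i = 0} = (\<lambda>x. x i) -` {0}" by auto
  then show ?thesis
    using closed_vimage[of "{0}" "\<lambda>x::nat \<Rightarrow> real. x i"] continuous_on_coordinate[of UNIV i] by simp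
qed

lemma compact_simplex_boundary: "compact (simplex_boundary n)"
proof -
  have "simplex_boundary n = standard_simplex n \<inter> (\<Union>i\<le>n. {x. x i = 0})"
    by (auto simp: simplex_boundary_def)
  then show ?thesis
    using compact_standard_simplex closed_coordinate_zero by (auto intro!: compact_Int_closed closed_UN)
qed

definition drop_coord :: "nat \<Rightarrow> (nat \<Rightarrow> real) \<Rightarrow> nat \<Rightarrow> real" where
  "drop_coord i x = (\<lambda>j. if j < i then x j else x (Suc j))"

lemma drop_coord_face: "drop_coord i (simplical_face i x) = x"
  by (auto simp: drop_coord_def simplical_face_def)

lemma face_drop_coord: "x i = 0 \<Longrightarrow> simplical_face i (drop_coord i x) = x"
  by (auto simp: drop_coord_def simplical_face_def fun_eq_iff)

lemma drop_coord_in_simplex: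
  assumes x: "x \<in> standard_simplex (Suc n)" and i: "i \<le> Suc n" "x i = 0"
  shows "drop_coord i x \<in> standard_simplex n"
proof (rule standard_simplexI)
  have "(\<Sum>j\<le>n. drop_coord i x j) = (\<Sum>j\<in>{..Suc n} - {i}. x j)"
    by (rule sum.reindex_bij_witness[of _ "\<lambda>k. if k < i then k else k - 1" "\<lambda>j. if j < i then j else Suc j"])
      (use i in \<open>auto simp: drop_coord_def\<close>)
  also have "\<dots> = (\<Sum>j\<le>Suc n. x j)"
    using i by (simp add: sum.remove[of "{..Suc n}" i x] del: sum.atMost_Suc)
  finally show "(\<Sum>j\<le>n. drop_coord i x j) = 1"
    using standard_simplexD(4)[OF x] by simp
qed (use standard_simplexD[OF x] i in \<open>auto simp: drop_coord_def\<close>)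

lemma continuous_on_drop_coord: "continuous_on B (drop_coord i)"
proof (rule continuous_on_funI)
  show "continuous_on B (\<lambda>x. drop_coord i x j)" for j
    by (cases "j < i") (simp_all add: drop_coord_def continuous_on_coordinate)
qed

text \<open>Pasting over the closed cover by the facets \<open>x i = 0\<close>. On the overlap of
  two facets the pieces agree because the prescribed simplices have a common codimension-two face,
  which is what \<open>compat\<close> states.\<close>

lemma simplex_boundary_glue:
  assumes \<tau>: "\<And>i. i \<le> Suc (Suc n) \<Longrightarrow> singular_simplex (Suc n) Z (\<tau> i)"
    and compat: "\<And>i j. \<lbrakk>i \<le> j; j \<le> Suc n\<rbrakk> \<Longrightarrow> singular_face (Suc n) i (\<tau> (Suc j)) = singular_face (Suc n) j (\<tau> i)"
  shows "\<exists>f. continuous_map (top_of_set (simplex_boundary (Suc (Suc n)))) Z f \<and>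
    (\<forall>i\<le>Suc (Suc n). \<forall>x \<in> standard_simplex (Suc n). f (simplical_face i x) = \<tau> i x)"
proof -
  let ?B = "simplex_boundary (Suc (Suc n))"
  let ?T = "\<lambda>i. {x \<in> ?B. x i = 0}"
  have agree: "\<tau> i (drop_coord i x) = \<tau> j (drop_coord j x)"
    if ij: "i < j" "j \<le> Suc (Suc n)" and x: "x \<in> standard_simplex (Suc (Suc n))" "x i = 0" "x j = 0" for i j x
  proof -
    obtain k where j: "j = Suc k" and ik: "i \<le> k" using ij(1) by (cases j) auto
    let ?y = "drop_coord j x"
    have y: "?y \<in> standard_simplex (Suc n)" "?y i = 0"
      using drop_coord_in_simplex[of x "Suc n" j] that by (auto simp: drop_coord_def)
    let ?z = "drop_coord i ?y"
    have z: "?z \<in> standard_simplex n"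
      using drop_coord_in_simplex[of ?y n i] y ij by simp
    have 1: "simplical_face i ?z = ?y" using face_drop_coord[of ?y i, OF y(2)] .
    \<comment> \<open>Coordinates \<open>i\<close> and \<open>j\<close> vanish and
      \<open>i < j\<close>; once \<open>i\<close> is dropped, position \<open>j\<close> becomes
      \<open>k = j - 1\<close>.\<close>
    have 2: "simplical_face k ?z = drop_coord i x"
    proof
      fix l show "simplical_face k ?z l = drop_coord i x l"
        using ik x by (cases "l < k"; cases "l = k"; cases l) (auto simp: simplical_face_def drop_coord_def j)
    qed
    have "\<tau> j ?y = singular_face (Suc n) i (\<tau> j) ?z"
      using z by (simp add: singular_face_def 1)
    also have "\<dots> = singular_face (Suc n) k (\<tau> i) ?z"
      using compat[OF ik] ij by (simp add: j)
    also have "\<dots> = \<tau> i (drop_coord i x)"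
      using z by (simp add: singular_face_def 2)
    finally show ?thesis by simp
  qed
  obtain f where f: "continuous_map (top_of_set ?B) Z f"
    and fx: "\<And>x i. \<lbrakk>i \<in> {..Suc (Suc n)}; x \<in> topspace (top_of_set ?B) \<inter> ?T i\<rbrakk> \<Longrightarrow> f x = \<tau> i (drop_coord i x)"
  proof (rule pasting_lemma_exists_closed[of "{..Suc (Suc n)}" "top_of_set ?B" ?T Z "\<lambda>i x. \<tau> i (drop_coord i x)"])
    show "topspace (top_of_set ?B) \<subseteq> \<Union> (?T ` {..Suc (Suc n)})"
      by (auto simp: simplex_boundary_def)
    fix i assume i: "i \<in> {..Suc (Suc n)}"
    have "?T i = ?B \<inter> {x. x i = 0}" by auto
    then show "closedin (top_of_set ?B) (?T i)"
      using closed_coordinate_zero[of i] by (simp add: closedin_closed_Int)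
    have "continuous_map (top_of_set (?T i)) (top_of_set (standard_simplex (Suc n))) (drop_coord i)"
      using i drop_coord_in_simplex[of _ "Suc n" i] continuous_on_drop_coord
      by (auto simp: simplex_boundary_def)
    moreover have "continuous_map (top_of_set (standard_simplex (Suc n))) Z (\<tau> i)"
      using \<tau>[of i] i unfolding singular_simplex_def top_of_set_fun by simp
    ultimately have "continuous_map (top_of_set (?T i)) Z (\<tau> i \<circ> drop_coord i)"
      by (rule continuous_map_compose)
    moreover have "?B \<inter> ?T i = ?T i" by auto
    ultimately show "continuous_map (subtopology (top_of_set ?B) (?T i)) Z (\<lambda>x. \<tau> i (drop_coord i x))"
      by (simp add: subtopology_subtopology o_def)
  next
    fix i j x assume ij: "i \<in> {..Suc (Suc n)}" "j \<in> {..Suc (Suc n)}" and "x \<in> topspace (top_of_set ?B) \<inter> ?T i \<inter> ?T j"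
    then have x: "x \<in> standard_simplex (Suc (Suc n))" "x i = 0" "x j = 0"
      by (auto simp: simplex_boundary_def)
    consider "i < j" | "i = j" | "j < i" by linarith
    then show "\<tau> i (drop_coord i x) = \<tau> j (drop_coord j x)"
    proof cases
      case 1
      then show ?thesis using agree[of i j x] x ij by simp
    next
      case 3
      then show ?thesis using agree[of j i x] x ij by simp
    qed simp
  qed auto
  have "f (simplical_face i x) = \<tau> i x" if "i \<le> Suc (Suc n)" "x \<in> standard_simplex (Suc n)" for i x
  proof -
    have "simplical_face i x \<in> standard_simplex (Suc (Suc n))"
      using simplical_face_in_standard_simplex[of "Suc (Suc n)" i x] that by simp
    moreover have "simplical_face i x i = 0" by (simp add: simplical_face_def)
    ultimately have "f (simplical_face i x) = \<tau> i (drop_coord i (simplical_face i x))"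
      using that by (intro fx) (auto simp: simplex_boundary_def)
    then show ?thesis by (simp add: drop_coord_face)
  qed
  with f show ?thesis by blast
qed

text \<open>The straight-line contraction of the boundary to the barycentre; it exhibits the simplex
  as a quotient of the cylinder on its boundary.\<close>

definition to_barycentre :: "nat \<Rightarrow> real \<times> (nat \<Rightarrow> real) \<Rightarrow> nat \<Rightarrow> real" where
  "to_barycentre n = (\<lambda>(s, y) i. if i \<le> n then (1 - s) * y i + s / (real n + 1) else 0)"

lemma to_barycentre_in:
  assumes "s \<in> {0..1}" "y \<in> standard_simplex n"
  shows "to_barycentre n (s, y) \<in> standard_simplex n"
proof (rule standard_simplexI)
  show "(\<Sum>i\<le>n. to_barycentre n (s, y) i) = 1"
    using standard_simplexD(4)[OF assms(2)]
    by (simp add: to_barycentre_def sum.distrib add.commute flip: sum_distrib_left)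
qed (use assms standard_simplexD(1)[OF assms(2)] in \<open>auto simp: to_barycentre_def\<close>)

lemma to_barycentre_0: "y \<in> standard_simplex n \<Longrightarrow> to_barycentre n (0, y) = y"
  by (auto simp: to_barycentre_def fun_eq_iff standard_simplexD(3))

lemma continuous_on_to_barycentre: "continuous_on B (to_barycentre n)"
proof (rule continuous_on_funI)
  fix i
  have "continuous_on B (\<lambda>x. snd x i)"
    using continuous_on_compose2[OF continuous_on_coordinate[of UNIV i] continuous_on_snd[OF continuous_on_id]] by simp
  then show "continuous_on B (\<lambda>x. to_barycentre n x i)"
    by (cases "i \<le> n") (auto simp: to_barycentre_def case_prod_unfold intro!: continuous_intros)
qed

text \<open>Subtracting the least coordinate \<mu> puts the point on the boundary after rescaling,
  and the amount removed gives the height \<open>s = (n + 1) \<mu>\<close>. At \<open>s = 1\<close>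
  the point is the barycentre and any boundary point will do.\<close>

lemma to_barycentre_surj:
  assumes n: "1 \<le> n" and x: "x \<in> standard_simplex n"
  shows "\<exists>s \<in> {0..1}. \<exists>y \<in> simplex_boundary n. to_barycentre n (s, y) = x"
proof -
  define \<mu> where "\<mu> = Min (x ` {..n})"
  have le: "\<mu> \<le> x i" if "i \<le> n" for i
    using that by (simp add: \<mu>_def)
  obtain k where k: "k \<le> n" "x k = \<mu>"
  proof -
    have "\<mu> \<in> x ` {..n}" unfolding \<mu>_def by (rule Min_in) auto
    then show ?thesis using that by auto
  qed
  define s where "s = (real n + 1) * \<mu>"
  have sum: "(\<Sum>i\<le>n. x i - \<mu>) = 1 - s"
    using standard_simplexD(4)[OF x] by (simp add: sum_subtractf s_def algebra_simps)
  have s0: "0 \<le> s" using standard_simplexD(1)[OF x, of k] k by (simp add: s_def)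
  have s1: "s \<le> 1"
    using sum_nonneg[of "{..n}" "\<lambda>i. x i - \<mu>"] le sum by auto
  have smu: "s / (real n + 1) = \<mu>" by (simp add: s_def)
  show ?thesis
  proof (cases "s = 1")
    case True
    then have "\<forall>i\<in>{..n}. x i - \<mu> = 0"
      using sum_nonneg_eq_0_iff[of "{..n}" "\<lambda>i. x i - \<mu>"] le sum by auto
    then have "to_barycentre n (1, \<lambda>j. if j = 0 then 1 else 0) = x"
      using smu True standard_simplexD(3)[OF x] by (auto simp: to_barycentre_def fun_eq_iff)
    \<comment> \<open>Vertex 0 is a boundary point because coordinate 1 exists and vanishes, by
      \<open>1 \<le> n\<close>.\<close>
    moreover have "(\<lambda>j. if j = 0 then 1 else 0) \<in> simplex_boundary n"
      using n by (auto simp: simplex_boundary_def intro!: exI[of _ 1])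
    ultimately show ?thesis by (intro bexI[of _ 1] bexI) auto
  next
    case False
    define y where "y i = (if i \<le> n then (x i - \<mu>) / (1 - s) else 0)" for i
    have "y \<in> standard_simplex n"
    proof (rule standard_simplexI)
      show "(\<Sum>i\<le>n. y i) = 1"
        using sum False by (simp add: y_def flip: sum_divide_distrib)
    qed (use le s1 in \<open>auto simp: y_def\<close>)
    moreover have "y k = 0" using k by (simp add: y_def)
    ultimately have "y \<in> simplex_boundary n" using k by (auto simp: simplex_boundary_def)
    moreover have "to_barycentre n (s, y) = x"
      using smu False standard_simplexD(3)[OF x] by (auto simp: to_barycentre_def y_def fun_eq_iff)
    ultimately show ?thesis using s0 s1 by (intro bexI[of _ s] bexI) auto
  qed
qed

text \<open>Where a coordinate of \<open>y\<close> vanishes, the image has coordinate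
  \<open>s / (n + 1)\<close>, its least one. So the image determines the height, and below the top
  also the boundary point.\<close>

lemma to_barycentre_inj:
  assumes "s \<in> {0..1}" "s' \<in> {0..1}" "y \<in> simplex_boundary n" "y' \<in> simplex_boundary n"
    and eq: "to_barycentre n (s, y) = to_barycentre n (s', y')"
  shows "s = s' \<and> (s = 1 \<or> y = y')"
proof -
  have le: "s2 \<le> s1"
    if a: "s1 \<in> {0..1}" "s2 \<in> {0..1}" "y1 \<in> simplex_boundary n" "y2 \<in> simplex_boundary n"
      "to_barycentre n (s1, y1) = to_barycentre n (s2, y2)" for s1 s2 y1 y2
  proof -
    obtain i where i: "i \<le> n" "y1 i = 0" using a by (auto simp: simplex_boundary_def)
    have "s1 / (real n + 1) = (1 - s2) * y2 i + s2 / (real n + 1)"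
      using fun_cong[OF that(5), of i] i by (simp add: to_barycentre_def)
    moreover have "0 \<le> (1 - s2) * y2 i"
      using that standard_simplexD(1)[of y2 n i] by (auto simp: simplex_boundary_def)
    ultimately have "s2 / (real n + 1) \<le> s1 / (real n + 1)" by linarith
    then show ?thesis by (simp add: divide_le_cancel)
  qed
  have s: "s = s'" using le[of s s' y y'] le[of s' s y' y] assms by simp
  have "y = y'" if "s \<noteq> 1"
  proof
    fix i
    have "y i = y' i" if "i \<le> n"
      using fun_cong[OF eq, of i] that \<open>s \<noteq> 1\<close> by (simp add: to_barycentre_def s)
    moreover have "y i = 0" "y' i = 0" if "i > n"
      using assms(3,4) that by (auto simp: simplex_boundary_def standard_simplexD(3))
    ultimately show "y i = y' i" by (cases "i \<le> n") auto
  qed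
  with s show ?thesis by blast
qed

lemma simplex_boundary_subset: "simplex_boundary n \<subseteq> standard_simplex n"
  by (auto simp: simplex_boundary_def)

text \<open>The null-homotopy is constant on the top of the cylinder, so it factors through
  \<open>to_barycentre\<close>, a quotient map as a closed map from a compact space to a Hausdorff
  one.\<close>

lemma extend_nullhomotopic:
  assumes n: "1 \<le> n"
    and f: "homotopic_with (\<lambda>_. True) (top_of_set (simplex_boundary n)) Z f (\<lambda>_. c)"
  shows "\<exists>g. continuous_map (top_of_set (standard_simplex n)) Z g \<and> (\<forall>x \<in> simplex_boundary n. g x = f x)"
proof -
  let ?B = "simplex_boundary n"
  obtain h where h: "continuous_map (prod_topology (top_of_set {0..1::real}) (top_of_set ?B)) Z h"
    and h0: "\<And>x. h (0, x) = f x" and h1: "\<And>x. h (1, x) = c"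
    using f unfolding homotopic_with_def by blast
  have eq: "prod_topology (top_of_set {0..1::real}) (top_of_set ?B) = top_of_set ({0..1} \<times> ?B)"
    by (simp add: subtopology_Times)
  have q: "quotient_map (top_of_set ({0..1} \<times> ?B)) (top_of_set (standard_simplex n)) (to_barycentre n)"
  proof (rule continuous_closed_imp_quotient_map)
    show c: "continuous_map (top_of_set ({0..1} \<times> ?B)) (top_of_set (standard_simplex n)) (to_barycentre n)"
      using continuous_on_to_barycentre to_barycentre_in simplex_boundary_subset by fastforce
    have "compact ({0..1::real} \<times> ?B)"
      using compact_simplex_boundary by (simp add: compact_Times)
    then show "closed_map (top_of_set ({0..1} \<times> ?B)) (top_of_set (standard_simplex n)) (to_barycentre n)"
      by (intro continuous_imp_closed_map[OF c])
        (simp_all add: compact_space_subtopology Hausdorff_space_subtopology)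
    show "to_barycentre n ` topspace (top_of_set ({0..1} \<times> ?B)) = topspace (top_of_set (standard_simplex n))"
      using to_barycentre_surj[OF n] to_barycentre_in simplex_boundary_subset by (fastforce simp: image_iff)
  qed
  obtain g where g: "continuous_map (top_of_set (standard_simplex n)) Z g"
    and gq: "\<And>x. x \<in> topspace (top_of_set ({0..1} \<times> ?B)) \<Longrightarrow> g (to_barycentre n x) = h x"
  proof (rule quotient_map_lift_exists[OF q h[unfolded eq]])
    fix x y assume "x \<in> topspace (top_of_set ({0..1} \<times> ?B))" "y \<in> topspace (top_of_set ({0..1} \<times> ?B))"
      "to_barycentre n x = to_barycentre n y"
    then show "h x = h y"
      using to_barycentre_inj[of "fst x" "fst y" "snd x" n "snd y"] h1
      by (cases x; cases y) auto
  qed auto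
  have "g x = f x" if x: "x \<in> ?B" for x
    using gq[of "(0, x)"] x simplex_boundary_subset[of n] to_barycentre_0[of x n] by (auto simp: h0)
  with g show ?thesis by blast
qed

lemma nullhomotopic_extension:
  assumes "continuous_map (top_of_set (standard_simplex n)) Z g"
  shows "\<exists>c. homotopic_with (\<lambda>_. True) (top_of_set (simplex_boundary n)) Z g (\<lambda>_. c)"
proof -
  let ?B = "simplex_boundary n"
  have eq: "prod_topology (top_of_set {0..1::real}) (top_of_set ?B) = top_of_set ({0..1} \<times> ?B)"
    by (simp add: subtopology_Times)
  have "continuous_map (top_of_set ({0..1} \<times> ?B)) (top_of_set (standard_simplex n)) (to_barycentre n)"
    using continuous_on_to_barycentre to_barycentre_in simplex_boundary_subset by fastforce
  then have c: "continuous_map (prod_topology (top_of_set {0..1}) (top_of_set ?B)) Z (g \<circ> to_barycentre n)"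
    unfolding eq using assms by (rule continuous_map_compose)
  \<comment> \<open>At height 1 the second argument drops out; \<open>\<lambda>_. 0\<close> is a
    dummy outside the simplex, and the constant is the value of \<open>g\<close> at the
    barycentre.\<close>
  have "homotopic_with (\<lambda>_. True) (top_of_set ?B) Z g (\<lambda>_. g (to_barycentre n (1, \<lambda>_. 0)))"
  proof (subst homotopic_with, simp, intro exI[of _ "g \<circ> to_barycentre n"] conjI c ballI TrueI)
    show "(g \<circ> to_barycentre n) (0, x) = g x" if "x \<in> topspace (top_of_set ?B)" for x
      using that simplex_boundary_subset[of n] to_barycentre_0[of x n] by auto
    show "(g \<circ> to_barycentre n) (1, x) = g (to_barycentre n (1, \<lambda>_. 0))" for x
      by (simp add: to_barycentre_def cong: if_cong)
  qed
  then show ?thesis by blast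
qed

text \<open>Null-homotopy is requested only for boundary maps with the prescribed faces: for
  triangles it will come from the labels of these faces, for tetrahedra from asphericity.\<close>

lemma simplex_fill:
  assumes \<tau>: "\<And>i. i \<le> Suc (Suc n) \<Longrightarrow> singular_simplex (Suc n) Z (\<tau> i)"
    and compat: "\<And>i j. \<lbrakk>i \<le> j; j \<le> Suc n\<rbrakk> \<Longrightarrow> singular_face (Suc n) i (\<tau> (Suc j)) = singular_face (Suc n) j (\<tau> i)"
    and null: "\<And>f. \<lbrakk>continuous_map (top_of_set (simplex_boundary (Suc (Suc n)))) Z f;
        \<And>i x. \<lbrakk>i \<le> Suc (Suc n); x \<in> standard_simplex (Suc n)\<rbrakk> \<Longrightarrow> f (simplical_face i x) = \<tau> i x\<rbrakk>
      \<Longrightarrow> \<exists>c. homotopic_with (\<lambda>_. True) (top_of_set (simplex_boundary (Suc (Suc n)))) Z f (\<lambda>_. c)"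
  shows "\<exists>\<sigma>. singular_simplex (Suc (Suc n)) Z \<sigma> \<and> (\<forall>i\<le>Suc (Suc n). singular_face (Suc (Suc n)) i \<sigma> = \<tau> i)"
proof -
  let ?N = "Suc (Suc n)"
  obtain f where f: "continuous_map (top_of_set (simplex_boundary ?N)) Z f"
    and ft: "\<And>i x. \<lbrakk>i \<le> ?N; x \<in> standard_simplex (Suc n)\<rbrakk> \<Longrightarrow> f (simplical_face i x) = \<tau> i x"
    using simplex_boundary_glue[of n Z \<tau>] \<tau> compat by blast
  obtain c where "homotopic_with (\<lambda>_. True) (top_of_set (simplex_boundary ?N)) Z f (\<lambda>_. c)"
    using null[OF f ft] by blast
  then obtain g where g: "continuous_map (top_of_set (standard_simplex ?N)) Z g"
    and gf: "\<And>x. x \<in> simplex_boundary ?N \<Longrightarrow> g x = f x"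
    using extend_nullhomotopic[of ?N Z f c] by auto
  let ?s = "restrict g (standard_simplex ?N)"
  have "singular_simplex ?N Z ?s"
    unfolding singular_simplex_def top_of_set_fun
    using continuous_map_eq[OF g, of ?s] by simp
  moreover have "singular_face ?N i ?s = \<tau> i" if i: "i \<le> ?N" for i
  proof
    fix x
    show "singular_face ?N i ?s x = \<tau> i x"
    proof (cases "x \<in> standard_simplex (Suc n)")
      case True
      then have fx: "simplical_face i x \<in> standard_simplex ?N"
        using simplical_face_in_standard_simplex[of ?N i x] i by simp
      moreover have "simplical_face i x i = 0" by (simp add: simplical_face_def)
      ultimately have "g (simplical_face i x) = f (simplical_face i x)"
        using i by (intro gf) (auto simp: simplex_boundary_def)
      then show ?thesis
        using True fx ft[OF i True] by (simp add: singular_face_def)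
    next
      case False
      then show ?thesis
        using \<tau>[OF i] by (simp add: singular_face_def singular_simplex_def extensional_def)
    qed
  qed
  ultimately show ?thesis by blast
qed

section \<open>Radial homeomorphism from the boundary of a simplex to the sphere\<close>

definition radial_norm :: "nat \<Rightarrow> (nat \<Rightarrow> real) \<Rightarrow> real" where
  "radial_norm n x = sqrt (\<Sum>i\<le>n. (x i - 1 / (real n + 2))\<^sup>2)"

text \<open>The barycentre of the \<open>Suc n\<close>-simplex has coordinates
  \<open>1 / (n + 2)\<close>. The last coordinate is determined by the others, so discarding it
  identifies the hyperplane of the simplex with Euclidean space of dimension \<open>n + 1\<close>,
  where directions from the barycentre are normalised.\<close>

definition radial :: "nat \<Rightarrow> (nat \<Rightarrow> real) \<Rightarrow> nat \<Rightarrow> real" where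
  "radial n x = (\<lambda>i. if i \<le> n then (x i - 1 / (real n + 2)) / radial_norm n x else 0)"

lemma boundary_last_coord:
  assumes "x \<in> standard_simplex (Suc n)"
  shows "x (Suc n) - 1 / (real n + 2) = - (\<Sum>i\<le>n. x i - 1 / (real n + 2))"
proof -
  have "(\<Sum>i\<le>n. x i) + x (Suc n) = 1"
    using standard_simplexD(4)[OF assms] by simp
  moreover have "(\<Sum>i\<le>n. x i - 1 / (real n + 2)) = (\<Sum>i\<le>n. x i) - (real n + 1) * (1 / (real n + 2))"
    by (simp add: sum_subtractf)
  moreover have "(real n + 1) * (1 / (real n + 2)) = 1 - 1 / (real n + 2)"
    by (simp add: field_simps)
  ultimately show ?thesis by linarith
qed

text \<open>Norm zero would force all coordinates, the last one by
  \<open>boundary_last_coord\<close>, to equal those of the barycentre, none of which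
  vanishes.\<close>

lemma radial_norm_pos:
  assumes "x \<in> simplex_boundary (Suc n)"
  shows "0 < radial_norm n x"
proof -
  let ?b = "1 / (real n + 2)"
  have x: "x \<in> standard_simplex (Suc n)" using assms simplex_boundary_subset by blast
  have "(\<Sum>i\<le>n. (x i - ?b)\<^sup>2) \<noteq> 0"
  proof
    assume "(\<Sum>i\<le>n. (x i - ?b)\<^sup>2) = 0"
    then have "\<forall>i\<in>{..n}. (x i - ?b)\<^sup>2 = 0"
      by (subst (asm) sum_nonneg_eq_0_iff) auto
    then have eq: "\<And>i. i \<le> n \<Longrightarrow> x i = ?b" by simp
    have "x (Suc n) - ?b = 0"
      unfolding boundary_last_coord[OF x] using eq by simp
    then have "\<And>i. i \<le> Suc n \<Longrightarrow> x i = ?b" using eq by (auto simp: le_Suc_eq)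
    moreover obtain k where "k \<le> Suc n" "x k = 0" using assms by (auto simp: simplex_boundary_def)
    ultimately have "?b = 0" by metis
    then show False by simp
  qed
  moreover have "0 \<le> (\<Sum>i\<le>n. (x i - ?b)\<^sup>2)" by (intro sum_nonneg) auto
  ultimately show ?thesis by (simp add: radial_norm_def)
qed

lemma radial_in_nsphere:
  assumes "x \<in> simplex_boundary (Suc n)"
  shows "radial n x \<in> {x. (\<Sum>i\<le>n. x i ^ 2) = 1 \<and> (\<forall>i>n. x i = 0)}"
proof -
  have p: "0 < radial_norm n x" by (rule radial_norm_pos[OF assms])
  have "(\<Sum>i\<le>n. (x i - 1 / (real n + 2))\<^sup>2) = (radial_norm n x)\<^sup>2"
    by (simp add: radial_norm_def sum_nonneg)
  then show ?thesis
    using p by (simp add: radial_def power_divide flip: sum_divide_distrib)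
qed

text \<open>Two boundary points on one ray have deviations from the barycentre proportional by a
  factor \<open>r > 0\<close>. A vanishing coordinate of the one gives \<open>r \<ge> 1\<close>, a
  vanishing coordinate of the other \<open>r \<le> 1\<close>.\<close>

lemma radial_inj: "inj_on (radial n) (simplex_boundary (Suc n))"
proof (rule inj_onI)
  let ?b = "1 / (real n + 2)"
  fix x x' assume x: "x \<in> simplex_boundary (Suc n)" and x': "x' \<in> simplex_boundary (Suc n)"
    and eq: "radial n x = radial n x'"
  define r where "r = radial_norm n x / radial_norm n x'"
  have p: "0 < radial_norm n x" "0 < radial_norm n x'" using radial_norm_pos x x' by auto
  have r0: "r > 0" using p by (simp add: r_def)
  have sx: "x \<in> standard_simplex (Suc n)" "x' \<in> standard_simplex (Suc n)"
    using x x' simplex_boundary_subset by blast+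
  have e1: "x i - ?b = r * (x' i - ?b)" if "i \<le> n" for i
  proof -
    have gen: "a = l / l' * a'" if "a / l = a' / l'" "l > 0" "l' > 0" for a a' l l' :: real
      using that by (simp add: field_simps)
    show ?thesis
      unfolding r_def using fun_cong[OF eq, of i] that by (intro gen p) (simp add: radial_def)
  qed
  have e2: "x i - ?b = r * (x' i - ?b)" if "i \<le> Suc n" for i
  proof (cases "i \<le> n")
    case False
    then have i: "i = Suc n" using that by simp
    show ?thesis
      unfolding i boundary_last_coord[OF sx(1)] boundary_last_coord[OF sx(2)]
      using e1 by (simp add: sum_distrib_left)
  qed (rule e1)
  have b0: "?b > 0" by simp
  obtain k where k: "k \<le> Suc n" "x k = 0" using x by (auto simp: simplex_boundary_def)
  have "r * x' k \<ge> 0" using r0 standard_simplexD(1)[OF sx(2)] by simp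
  then have "?b \<le> r * ?b" using e2[OF k(1)] k(2) by (simp add: algebra_simps)
  then have r1: "1 \<le> r" using b0 mult_le_cancel_right1[of ?b r] by linarith
  obtain k' where k': "k' \<le> Suc n" "x' k' = 0" using x' by (auto simp: simplex_boundary_def)
  have "r * ?b \<le> ?b" using e2[OF k'(1)] k'(2) standard_simplexD(1)[OF sx(1), of k'] by simp
  then have "r \<le> 1" using b0 mult_le_cancel_right2[of r ?b] by linarith
  with r1 have "r = 1" by simp
  then show "x = x'"
    using e2 standard_simplexD(3)[OF sx(1)] standard_simplexD(3)[OF sx(2)]
    by (intro ext) (metis add_diff_cancel_right' diff_add_cancel mult_1 not_le)
qed

text \<open>The direction \<open>y\<close> is completed to \<open>d\<close> with coordinate sum zero
  and followed from the barycentre until some coordinate reaches zero. With \<open>m\<close> the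
  largest value of \<open>- d i\<close> this occurs at scale \<open>b / m\<close>; \<open>m\<close>
  is positive since \<open>d\<close> is nonzero with sum zero.\<close>

lemma radial_surj:
  assumes y: "(\<Sum>i\<le>n. y i ^ 2) = 1" "\<And>i. i > n \<Longrightarrow> y i = 0"
  shows "\<exists>x \<in> simplex_boundary (Suc n). radial n x = y"
proof -
  define b where "b = 1 / (real n + 2)"
  define d where "d i = (if i \<le> n then y i else if i = Suc n then - (\<Sum>i\<le>n. y i) else 0)" for i
  define m where "m = Max ((\<lambda>i. - d i) ` {..Suc n})"
  have b0: "b > 0" by (simp add: b_def)
  have dm: "- d i \<le> m" if "i \<le> Suc n" for i
    unfolding m_def by (rule Max_ge) (use that in auto)
  have "m \<in> (\<lambda>i. - d i) ` {..Suc n}" unfolding m_def by (rule Max_in) auto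
  then obtain k where k: "k \<le> Suc n" "m = - d k" by auto
  have sd: "(\<Sum>i\<le>Suc n. d i) = 0"
    by (simp add: d_def)
  have m0: "m > 0"
  proof (rule ccontr)
    assume "\<not> m > 0"
    then have "\<And>i. i \<le> Suc n \<Longrightarrow> 0 \<le> d i" using dm by force
    then have "\<forall>i\<in>{..Suc n}. d i = 0"
      using sd sum_nonneg_eq_0_iff[of "{..Suc n}" d] by auto
    then have "\<And>i. i \<le> n \<Longrightarrow> y i = 0" by (metis atMost_iff d_def le_Suc_eq)
    then have "(\<Sum>i\<le>n. y i ^ 2) = 0" by simp
    then show False using y(1) by simp
  qed
  define x where "x i = (if i \<le> Suc n then b + (b / m) * d i else 0)" for i
  have xs: "x \<in> standard_simplex (Suc n)"
  proof (rule standard_simplexI)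
    fix i assume i: "i \<le> Suc n"
    have "b + (b / m) * d i = (b / m) * (m + d i)" using m0 by (simp add: field_simps)
    then show "0 \<le> x i" using i dm[OF i] b0 m0 by (simp add: x_def)
  next
    have "(\<Sum>i\<le>Suc n. x i) = (\<Sum>i\<le>Suc n. b + (b / m) * d i)"
      by (rule sum.cong) (auto simp: x_def)
    also have "\<dots> = (real n + 2) * b + (b / m) * (\<Sum>i\<le>Suc n. d i)"
      by (simp only: sum.distrib sum_distrib_left sum_constant card_atMost) simp
    also have "\<dots> = 1" unfolding sd by (simp add: b_def)
    finally show "(\<Sum>i\<le>Suc n. x i) = 1" .
  qed (simp add: x_def)
  moreover have "x k = 0" using k m0 by (simp add: x_def field_simps)
  ultimately have xb: "x \<in> simplex_boundary (Suc n)" using k by (auto simp: simplex_boundary_def)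
  have xd: "x i - b = (b / m) * y i" if "i \<le> n" for i using that by (simp add: x_def d_def)
  have "(\<Sum>i\<le>n. (x i - b)\<^sup>2) = (b / m)\<^sup>2 * (\<Sum>i\<le>n. y i ^ 2)"
    unfolding sum_distrib_left by (rule sum.cong) (simp_all add: xd power_mult_distrib power_divide)
  then have "radial_norm n x = b / m"
    using b0 m0 by (simp add: radial_norm_def y(1) flip: b_def)
  then have "radial n x = y"
    using xd y(2) b0 m0 by (auto simp: radial_def fun_eq_iff simp flip: b_def)
  then show ?thesis using xb by blast
qed

lemma continuous_on_radial: "continuous_on (simplex_boundary (Suc n)) (radial n)"
proof (rule continuous_on_funI)
  fix i
  have "continuous_on (simplex_boundary (Suc n)) (radial_norm n)"
    unfolding radial_norm_def by (intro continuous_intros continuous_on_coordinate)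
  then have "continuous_on (simplex_boundary (Suc n)) (\<lambda>x. (x i - 1 / (real n + 2)) / radial_norm n x)"
    using radial_norm_pos by (intro continuous_intros continuous_on_coordinate) force+
  then show "continuous_on (simplex_boundary (Suc n)) (\<lambda>x. radial n x i)"
    by (cases "i \<le> n") (simp_all add: radial_def)
qed

lemma aspherical_boundary_null:
  assumes "aspherical Z" "2 \<le> n" and f: "continuous_map (top_of_set (simplex_boundary (Suc n))) Z f"
  shows "\<exists>c. homotopic_with (\<lambda>_. True) (top_of_set (simplex_boundary (Suc n))) Z f (\<lambda>_. c)"
proof -
  let ?B = "simplex_boundary (Suc n)" and ?N = "{x::nat \<Rightarrow> real. (\<Sum>i\<le>n. x i ^ 2) = 1 \<and> (\<forall>i>n. x i = 0)}"
  have N: "nsphere n = top_of_set ?N" by (simp add: nsphere euclidean_product_topology)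
  have cu: "continuous_map (top_of_set ?B) (nsphere n) (radial n)"
    unfolding N using continuous_on_radial radial_in_nsphere by fastforce
  have im: "radial n ` ?B = ?N"
  proof
    show "radial n ` ?B \<subseteq> ?N" using radial_in_nsphere by blast
    show "?N \<subseteq> radial n ` ?B"
    proof
      fix y assume "y \<in> ?N"
      then show "y \<in> radial n ` ?B" using radial_surj[of y n] by auto
    qed
  qed
  have "homeomorphic_map (top_of_set ?B) (nsphere n) (radial n)"
    unfolding N
  proof (rule continuous_imp_homeomorphic_map)
    show "compact_space (top_of_set ?B)"
      using compact_simplex_boundary by (simp add: compact_space_subtopology)
    show "Hausdorff_space (top_of_set ?N)" by (simp add: Hausdorff_space_subtopology)
    show "continuous_map (top_of_set ?B) (top_of_set ?N) (radial n)" using cu unfolding N .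
    show "radial n ` topspace (top_of_set ?B) = topspace (top_of_set ?N)" using im by simp
    show "inj_on (radial n) (topspace (top_of_set ?B))" using radial_inj by simp
  qed
  then obtain v where v: "homeomorphic_maps (top_of_set ?B) (nsphere n) (radial n) v"
    by (auto simp: homeomorphic_map_maps)
  then have cv: "continuous_map (nsphere n) (top_of_set ?B) v"
    and vu: "\<And>x. x \<in> ?B \<Longrightarrow> v (radial n x) = x"
    by (auto simp: homeomorphic_maps_def)
  have "continuous_map (nsphere n) Z (f \<circ> v)" using cv f by (rule continuous_map_compose)
  then obtain c where "homotopic_with (\<lambda>_. True) (nsphere n) Z (f \<circ> v) (\<lambda>_. c)"
    using assms by (auto simp: aspherical_def)
  from homotopic_with_compose_continuous_map_right[OF this cu, of "\<lambda>_. True"]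
  have "homotopic_with (\<lambda>_. True) (top_of_set ?B) Z (f \<circ> v \<circ> radial n) (\<lambda>_. c)"
    by (simp add: o_def)
  moreover have "homotopic_with (\<lambda>_. True) (top_of_set ?B) Z f (f \<circ> v \<circ> radial n)"
    by (rule homotopic_with_equal) (use f vu in auto)
  ultimately show ?thesis using homotopic_with_trans by blast
qed

section \<open>Path homotopy\<close>

abbreviation unit_top :: "real topology" where "unit_top \<equiv> top_of_set {0..1}"

text \<open>The ends are pinned to those of \<open>a\<close>; that \<open>b\<close> shares them
  follows, since the predicate also holds for the last map of the homotopy.\<close>

definition path_homotopic :: "'a topology \<Rightarrow> (real \<Rightarrow> 'a) \<Rightarrow> (real \<Rightarrow> 'a) \<Rightarrow> bool" where
  "path_homotopic T a b \<longleftrightarrow> homotopic_with (\<lambda>k. k 0 = a 0 \<and> k 1 = a 1) unit_top T a b"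

lemma path_homotopic_iff:
  "path_homotopic T a b \<longleftrightarrow> (\<exists>h. continuous_map (prod_topology unit_top unit_top) T h \<and>
     (\<forall>t\<in>{0..1}. h (0, t) = a t) \<and> (\<forall>t\<in>{0..1}. h (1, t) = b t) \<and>
     (\<forall>s\<in>{0..1}. h (s, 0) = a 0 \<and> h (s, 1) = a 1))"
  unfolding path_homotopic_def by (subst homotopic_with) auto

lemma path_homotopic_ends:
  assumes "path_homotopic T a b" shows "b 0 = a 0" "b 1 = a 1"
  using assms homotopic_with_imp_property unfolding path_homotopic_def by blast+

lemma path_homotopic_pathin:
  assumes "path_homotopic T a b" shows "pathin T a" "pathin T b"
  using assms homotopic_with_imp_continuous_maps unfolding path_homotopic_def pathin_def by blast+

lemma path_homotopic_eq:
  "\<lbrakk>pathin T a; \<And>t. t \<in> {0..1} \<Longrightarrow> a t = b t\<rbrakk> \<Longrightarrow> path_homotopic T a b"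
  unfolding path_homotopic_def by (rule homotopic_with_equal) (auto simp: pathin_def)

lemma path_homotopic_refl: "pathin T a \<Longrightarrow> path_homotopic T a a"
  by (rule path_homotopic_eq) auto

lemma path_homotopic_sym: "path_homotopic T a b \<Longrightarrow> path_homotopic T b a"
  using path_homotopic_ends[of T a b] unfolding path_homotopic_def by (simp add: homotopic_with_sym)

lemma path_homotopic_trans [trans]:
  "\<lbrakk>path_homotopic T a b; path_homotopic T b c\<rbrakk> \<Longrightarrow> path_homotopic T a c"
  using path_homotopic_ends[of T a b] unfolding path_homotopic_def by (auto intro: homotopic_with_trans)

text \<open>A straight-line homotopy in the parameter domain \<open>C\<close>. Associativity,
  cancellation, the conjugation square of a free homotopy and the comparison of arcs with equal end
  angles all reduce to it.\<close>

lemma path_homotopic_reparam: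
  fixes C :: "'b::real_normed_vector set"
  assumes f: "continuous_map (top_of_set C) T f" and C: "convex C"
    and p: "continuous_on {0..1} p" "p \<in> {0..1} \<rightarrow> C" and q: "continuous_on {0..1} q" "q \<in> {0..1} \<rightarrow> C"
    and ends: "p 0 = q 0" "p 1 = q 1"
    and a: "\<And>t. t \<in> {0..1} \<Longrightarrow> a t = f (p t)" and b: "\<And>t. t \<in> {0..1} \<Longrightarrow> b t = f (q t)"
  shows "path_homotopic T a b"
proof -
  let ?h = "\<lambda>x::real \<times> real. (1 - fst x) *\<^sub>R p (snd x) + fst x *\<^sub>R q (snd x)"
  have "continuous_on ({0..1::real} \<times> {0..1}) (\<lambda>x. p (snd x))" "continuous_on ({0..1::real} \<times> {0..1}) (\<lambda>x. q (snd x))"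
    by (rule continuous_on_compose2[OF p(1) continuous_on_snd[OF continuous_on_id]], force,
        rule continuous_on_compose2[OF q(1) continuous_on_snd[OF continuous_on_id]], force)
  then have "continuous_on ({0..1} \<times> {0..1}) ?h"
    by (intro continuous_on_add continuous_on_scaleR continuous_on_diff continuous_on_fst continuous_on_const continuous_on_id)
  moreover have "?h \<in> {0..1} \<times> {0..1} \<rightarrow> C"
  proof clarify
    fix s t :: real assume "s \<in> {0..1}" "t \<in> {0..1}"
    then show "?h (s, t) \<in> C"
      using convexD[OF C, of "p t" "q t" "1 - s" s] p(2) q(2) by (auto simp: Pi_iff)
  qed
  ultimately have "continuous_map (prod_topology unit_top unit_top) (top_of_set C) ?h"
    by (simp add: prod_topology_subtopology_eu)
  then have "continuous_map (prod_topology unit_top unit_top) T (f \<circ> ?h)"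
    using f by (rule continuous_map_compose)
  moreover have "(1 - s) *\<^sub>R p 0 + s *\<^sub>R q 0 = p 0" "(1 - s) *\<^sub>R p 1 + s *\<^sub>R q 1 = p 1" for s
    using ends by (simp_all add: algebra_simps)
  ultimately show ?thesis
    unfolding path_homotopic_iff by (intro exI[of _ "f \<circ> ?h"]) (simp add: a b)
qed

section \<open>Groupoid laws for concatenated paths\<close>

lemma continuous_map_glue_interval:
  fixes u m v :: real
  assumes "continuous_map (top_of_set {u..m}) T f" "continuous_map (top_of_set {m..v}) T g" "f m = g m"
    "u \<le> m" "m \<le> v"
  shows "continuous_map (top_of_set {u..v}) T (\<lambda>t. if t \<le> m then f t else g t)"
proof (rule continuous_map_cases_le)
  have "{u..v} \<inter> {x \<in> topspace (top_of_set {u..v}). x \<le> m} = {u..m}" using assms by auto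
  then show "continuous_map (subtopology (top_of_set {u..v}) {x \<in> topspace (top_of_set {u..v}). x \<le> m}) T f"
    using assms by (simp add: subtopology_subtopology)
  have "{u..v} \<inter> {x \<in> topspace (top_of_set {u..v}). m \<le> x} = {m..v}" using assms by auto
  then show "continuous_map (subtopology (top_of_set {u..v}) {x \<in> topspace (top_of_set {u..v}). m \<le> x}) T g"
    using assms by (simp add: subtopology_subtopology)
qed (use assms in auto)

text \<open>Concatenation without rescaling, on \<open>{0..2}\<close>, and for \<open>cat3\<close>
  on \<open>{0..3}\<close>: bracketed concatenations are reparametrisations of one and the same
  map.\<close>

definition cat2 :: "(real \<Rightarrow> 'a) \<Rightarrow> (real \<Rightarrow> 'a) \<Rightarrow> real \<Rightarrow> 'a" where
  "cat2 a b = (\<lambda>t. if t \<le> 1 then a t else b (t - 1))"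

definition cat3 :: "(real \<Rightarrow> 'a) \<Rightarrow> (real \<Rightarrow> 'a) \<Rightarrow> (real \<Rightarrow> 'a) \<Rightarrow> real \<Rightarrow> 'a" where
  "cat3 a b c = (\<lambda>t. if t \<le> 2 then cat2 a b t else c (t - 2))"

lemma continuous_map_shift:
  assumes "pathin T a"
  shows "continuous_map (top_of_set {m..m + 1}) T (\<lambda>t. a (t - m))"
proof -
  have "continuous_map (top_of_set {m..m + 1}) unit_top (\<lambda>t. t - m)"
    by (auto intro!: continuous_intros)
  from continuous_map_compose[OF this assms[unfolded pathin_def]] show ?thesis
    by (simp add: o_def)
qed

lemma continuous_map_cat2:
  assumes "pathin T a" "pathin T b" "a 1 = b 0"
  shows "continuous_map (top_of_set {0..2}) T (cat2 a b)"
  unfolding cat2_def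
  using continuous_map_glue_interval[of 0 1 T a 2 "\<lambda>t. b (t - 1)"] continuous_map_shift[OF assms(2), of 1] assms
  by (simp add: pathin_def)

lemma continuous_map_cat3:
  assumes "pathin T a" "pathin T b" "pathin T c" "a 1 = b 0" "b 1 = c 0"
  shows "continuous_map (top_of_set {0..3}) T (cat3 a b c)"
  unfolding cat3_def
  using continuous_map_glue_interval[of 0 2 T "cat2 a b" 3 "\<lambda>t. c (t - 2)"] continuous_map_shift[OF assms(3), of 2]
    continuous_map_cat2[of T a b] assms
  by (simp add: cat2_def)

lemma path_join_ends [simp]: "path_join a b 0 = a 0" "path_join a b 1 = b 1"
  by (simp_all add: path_join_def)

lemma pathin_path_join:
  assumes "pathin T a" "pathin T b" "a 1 = b 0"
  shows "pathin T (path_join a b)"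
proof -
  have "continuous_map unit_top (top_of_set {0..2}) (\<lambda>t::real. 2 * t)"
    by (auto intro!: continuous_intros)
  then have "continuous_map unit_top T (cat2 a b \<circ> (\<lambda>t. 2 * t))"
    using continuous_map_cat2[OF assms] by (rule continuous_map_compose)
  moreover have "cat2 a b \<circ> (\<lambda>t. 2 * t) = path_join a b"
    by (auto simp: cat2_def path_join_def fun_eq_iff)
  ultimately show ?thesis by (simp add: pathin_def)
qed

definition path_rev :: "(real \<Rightarrow> 'a) \<Rightarrow> real \<Rightarrow> 'a" where
  "path_rev a = (\<lambda>t. a (1 - t))"

lemma path_rev_ends [simp]: "path_rev a 0 = a 1" "path_rev a 1 = a 0" "path_rev (path_rev a) = a"
  by (simp_all add: path_rev_def)

lemma pathin_path_rev: "pathin T a \<Longrightarrow> pathin T (path_rev a)"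
proof -
  assume a: "pathin T a"
  have "continuous_map unit_top unit_top (\<lambda>t::real. 1 - t)"
    by (auto intro!: continuous_intros)
  from continuous_map_compose[OF this a[unfolded pathin_def]] show ?thesis
    by (simp add: o_def pathin_def path_rev_def)
qed

lemma real_half: "(t::real) * 2 = 1 \<Longrightarrow> t = 1 / 2"
  by simp

lemma path_join_cong:
  assumes a: "path_homotopic T a a'" and b: "path_homotopic T b b'" and ab: "a 1 = b 0"
  shows "path_homotopic T (path_join a b) (path_join a' b')"
proof -
  obtain h where h: "continuous_map (prod_topology unit_top unit_top) T h"
    "\<And>t. t \<in> {0..1} \<Longrightarrow> h (0, t) = a t" "\<And>t. t \<in> {0..1} \<Longrightarrow> h (1, t) = a' t"
    "\<And>s. s \<in> {0..1} \<Longrightarrow> h (s, 0) = a 0" "\<And>s. s \<in> {0..1} \<Longrightarrow> h (s, 1) = a 1"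
    using a unfolding path_homotopic_iff by blast
  obtain k where k: "continuous_map (prod_topology unit_top unit_top) T k"
    "\<And>t. t \<in> {0..1} \<Longrightarrow> k (0, t) = b t" "\<And>t. t \<in> {0..1} \<Longrightarrow> k (1, t) = b' t"
    "\<And>s. s \<in> {0..1} \<Longrightarrow> k (s, 0) = b 0" "\<And>s. s \<in> {0..1} \<Longrightarrow> k (s, 1) = b 1"
    using b unfolding path_homotopic_iff by blast
  let ?I = "{0..1::real} \<times> {0..1::real}"
  have II: "prod_topology unit_top unit_top = top_of_set ?I"
    by (simp add: prod_topology_subtopology_eu)
  let ?l = "\<lambda>x. if snd x \<le> 1 / 2 then h (fst x, 2 * snd x) else k (fst x, 2 * snd x - 1)"
  have "continuous_map (top_of_set ?I) T ?l"
  proof (rule continuous_map_cases_le)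
    have s1: "?I \<inter> {x \<in> topspace (top_of_set ?I). snd x \<le> 1 / 2} = {0..1} \<times> {0..1 / 2}" by auto
    have "continuous_map (top_of_set ({0..1} \<times> {0..1 / 2})) (top_of_set ?I) (\<lambda>x::real \<times> real. (fst x, 2 * snd x))"
      by (auto intro!: continuous_intros)
    then have "continuous_map (top_of_set ({0..1} \<times> {0..1 / 2})) T (h \<circ> (\<lambda>x. (fst x, 2 * snd x)))"
      using h(1) unfolding II by (rule continuous_map_compose)
    then show "continuous_map (subtopology (top_of_set ?I) {x \<in> topspace (top_of_set ?I). snd x \<le> 1 / 2}) T
        (\<lambda>x. h (fst x, 2 * snd x))"
      unfolding subtopology_subtopology s1 by (simp add: o_def)
    have s2: "?I \<inter> {x \<in> topspace (top_of_set ?I). 1 / 2 \<le> snd x} = {0..1} \<times> {1 / 2..1}" by auto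
    have "continuous_map (top_of_set ({0..1} \<times> {1 / 2..1})) (top_of_set ?I) (\<lambda>x::real \<times> real. (fst x, 2 * snd x - 1))"
      by (auto intro!: continuous_intros)
    then have "continuous_map (top_of_set ({0..1} \<times> {1 / 2..1})) T (k \<circ> (\<lambda>x. (fst x, 2 * snd x - 1)))"
      using k(1) unfolding II by (rule continuous_map_compose)
    then show "continuous_map (subtopology (top_of_set ?I) {x \<in> topspace (top_of_set ?I). 1 / 2 \<le> snd x}) T
        (\<lambda>x. k (fst x, 2 * snd x - 1))"
      unfolding subtopology_subtopology s2 by (simp add: o_def)
    show "h (fst x, 2 * snd x) = k (fst x, 2 * snd x - 1)" if "x \<in> topspace (top_of_set ?I)" "snd x = 1 / 2" for x
      using that h(5)[of "fst x"] k(4)[of "fst x"] ab by (auto dest!: real_half)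
  qed (auto intro!: continuous_intros)
  then show ?thesis
    unfolding path_homotopic_iff II
    by (intro exI[of _ ?l] conjI ballI) (auto simp: path_join_def h k)
qed

text \<open>The left bracketing runs through \<open>a\<close> and \<open>b\<close> at speed 4 and
  \<open>c\<close> at speed 2, the right one through \<open>a\<close> at speed 2 and the others at
  speed 4. These piecewise linear clocks are a minimum and a maximum of affine functions, with
  corner at \<open>1/2\<close>.\<close>

lemma path_join_assoc:
  assumes "pathin T a" "pathin T b" "pathin T c" "a 1 = b 0" "b 1 = c 0"
  shows "path_homotopic T (path_join (path_join a b) c) (path_join a (path_join b c))"
proof (rule path_homotopic_reparam[OF continuous_map_cat3[OF assms],
    where p = "\<lambda>t. min (4 * t) (2 * t + 1)" and q = "\<lambda>t. max (2 * t) (4 * t - 1)"])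
  show "path_join (path_join a b) c t = cat3 a b c (min (4 * t) (2 * t + 1))" if "t \<in> {0..1}" for t
    using that by (auto simp: path_join_def cat3_def cat2_def min_def algebra_simps dest!: real_half)
  show "path_join a (path_join b c) t = cat3 a b c (max (2 * t) (4 * t - 1))" if "t \<in> {0..1}" for t
    using that assms by (auto simp: path_join_def cat3_def cat2_def max_def algebra_simps dest!: real_half)
qed (auto intro!: continuous_intros)

text \<open>The clock runs from 1 back to 0 and then forward to 2, and can be straightened to a run
  from 1 to 2.\<close>

lemma path_join_cancel_left:
  assumes "pathin T p" "pathin T b" "p 1 = b 0"
  shows "path_homotopic T (path_join (path_rev p) (path_join p b)) b"
proof (rule path_homotopic_reparam[OF continuous_map_cat2[OF assms],
    where p = "\<lambda>t. max (1 - 2 * t) (4 * t - 2)" and q = "\<lambda>t. 1 + t"])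
  show "path_join (path_rev p) (path_join p b) t = cat2 p b (max (1 - 2 * t) (4 * t - 2))" if "t \<in> {0..1}" for t
    using that by (auto simp: path_join_def cat2_def path_rev_def max_def algebra_simps dest!: real_half)
  show "b t = cat2 p b (1 + t)" if "t \<in> {0..1}" for t
    using that assms(3) by (auto simp: cat2_def)
qed (auto intro!: continuous_intros)

lemma path_join_cancel_right:
  assumes "pathin T a" "pathin T p" "a 1 = p 0"
  shows "path_homotopic T (path_join (path_join a p) (path_rev p)) a"
proof (rule path_homotopic_reparam[OF continuous_map_cat2[OF assms],
    where p = "\<lambda>t. min (4 * t) (3 - 2 * t)" and q = "\<lambda>t. t"])
  show "path_join (path_join a p) (path_rev p) t = cat2 a p (min (4 * t) (3 - 2 * t))" if "t \<in> {0..1}" for t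
    using that assms(3) by (auto simp: path_join_def cat2_def path_rev_def min_def algebra_simps dest!: real_half)
  show "a t = cat2 a p t" if "t \<in> {0..1}" for t
    using that by (auto simp: cat2_def)
qed (auto intro!: continuous_intros)

text \<open>The constant pieces are waiting times, so the clock is clamped to
  \<open>{0..1}\<close>.\<close>

lemma path_join_const:
  assumes "pathin T a"
  shows "path_homotopic T (path_join (path_join (\<lambda>_. a 0) a) (\<lambda>_. a 1)) a"
proof (rule path_homotopic_reparam[where C = "{0..1::real}" and f = a,
    where p = "\<lambda>t. max 0 (min 1 (4 * t - 1))" and q = "\<lambda>t. t"])
  show "path_join (path_join (\<lambda>_. a 0) a) (\<lambda>_. a 1) t = a (max 0 (min 1 (4 * t - 1)))" if "t \<in> {0..1}" for t
    using that by (auto simp: path_join_def min_def max_def algebra_simps dest!: real_half)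
qed (use assms in \<open>auto intro!: continuous_intros simp: pathin_def\<close>)

section \<open>Edges and triangles as paths\<close>

definition edge_pt :: "real \<Rightarrow> nat \<Rightarrow> real" where
  "edge_pt t = (\<lambda>i. if i = 0 then 1 - t else if i = 1 then t else 0)"

definition edge_path :: "((nat \<Rightarrow> real) \<Rightarrow> 'a) \<Rightarrow> real \<Rightarrow> 'a" where
  "edge_path \<sigma> = (\<lambda>t. \<sigma> (edge_pt t))"

definition path_edge :: "(real \<Rightarrow> 'a) \<Rightarrow> (nat \<Rightarrow> real) \<Rightarrow> 'a" where
  "path_edge p = restrict (\<lambda>x. p (x 1)) (standard_simplex 1)"

definition pt_simplex :: "'a \<Rightarrow> (nat \<Rightarrow> real) \<Rightarrow> 'a" where
  "pt_simplex x = restrict (\<lambda>_. x) (standard_simplex 0)"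

lemma edge_pt_in: "t \<in> {0..1} \<Longrightarrow> edge_pt t \<in> standard_simplex 1"
  by (rule standard_simplexI) (auto simp: edge_pt_def)

lemma simplex_1_edge_pt: "x \<in> standard_simplex 1 \<Longrightarrow> x 1 \<in> {0..1} \<and> edge_pt (x 1) = x"
  using standard_simplexD[of x 1] by (auto simp: edge_pt_def fun_eq_iff)

lemma continuous_on_edge_pt: "continuous_on B edge_pt"
proof (rule continuous_on_funI)
  show "continuous_on B (\<lambda>t. edge_pt t i)" for i
    by (cases "i = 0"; cases "i = 1") (auto simp: edge_pt_def intro!: continuous_intros)
qed

lemma pathin_edge_path:
  assumes "singular_simplex 1 Z \<sigma>" shows "pathin Z (edge_path \<sigma>)"
proof -
  have "continuous_map unit_top (top_of_set (standard_simplex 1)) edge_pt"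
    using continuous_on_edge_pt edge_pt_in by auto
  moreover have "continuous_map (top_of_set (standard_simplex 1)) Z \<sigma>"
    using assms unfolding singular_simplex_def top_of_set_fun by simp
  ultimately show ?thesis
    using continuous_map_compose unfolding pathin_def edge_path_def o_def[symmetric] by blast
qed

lemma singular_simplex_path_edge:
  assumes "pathin Z p" shows "singular_simplex 1 Z (path_edge p)"
proof -
  have "continuous_map (top_of_set (standard_simplex 1)) unit_top (\<lambda>x. x 1)"
    using continuous_on_coordinate[of "standard_simplex 1" 1] simplex_1_edge_pt by auto
  then have "continuous_map (top_of_set (standard_simplex 1)) Z (p \<circ> (\<lambda>x. x 1))"
    using assms unfolding pathin_def by (rule continuous_map_compose)
  then have "continuous_map (top_of_set (standard_simplex 1)) Z (path_edge p)"
    by (rule continuous_map_eq) (auto simp: path_edge_def)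
  then show ?thesis
    unfolding singular_simplex_def top_of_set_fun by (simp add: path_edge_def)
qed

lemma edge_path_path_edge: "t \<in> {0..1} \<Longrightarrow> edge_path (path_edge p) t = p t"
  using edge_pt_in[of t] by (simp add: edge_path_def path_edge_def) (simp add: edge_pt_def)

lemma path_edge_edge_path:
  assumes "singular_simplex 1 Z \<sigma>" shows "path_edge (edge_path \<sigma>) = \<sigma>"
proof
  fix x show "path_edge (edge_path \<sigma>) x = \<sigma> x"
    using simplex_1_edge_pt[of x] assms
    by (cases "x \<in> standard_simplex 1") (auto simp: path_edge_def edge_path_def singular_simplex_def extensional_def)
qed

lemma edge_eqI:
  assumes "singular_simplex 1 Z \<sigma>" "singular_simplex 1 Z' \<sigma>'" "\<And>t. t \<in> {0..1} \<Longrightarrow> edge_path \<sigma> t = edge_path \<sigma>' t"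
  shows "\<sigma> = \<sigma>'"
proof -
  have "path_edge (edge_path \<sigma>) = path_edge (edge_path \<sigma>')"
    unfolding path_edge_def using assms(3) simplex_1_edge_pt by (intro restrict_ext) blast
  then show ?thesis using path_edge_edge_path assms by metis
qed

lemma edge_src_eq: "edge_src \<sigma> = pt_simplex (edge_path \<sigma> 0)"
proof
  fix x
  show "edge_src \<sigma> x = pt_simplex (edge_path \<sigma> 0) x"
  proof (cases "x \<in> standard_simplex 0")
    case True
    then have "simplical_face 1 x = edge_pt 0"
      by (auto simp: standard_simplex_0 simplical_face_def edge_pt_def fun_eq_iff)
    then show ?thesis
      using True by (simp add: edge_src_def singular_face_def pt_simplex_def edge_path_def del: One_nat_def)
  qed (simp add: edge_src_def singular_face_def pt_simplex_def)
qed

lemma edge_tgt_eq: "edge_tgt \<sigma> = pt_simplex (edge_path \<sigma> 1)"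
proof
  fix x
  show "edge_tgt \<sigma> x = pt_simplex (edge_path \<sigma> 1) x"
  proof (cases "x \<in> standard_simplex 0")
    case True
    then have "simplical_face 0 x = edge_pt 1"
      by (auto simp: standard_simplex_0 simplical_face_def edge_pt_def fun_eq_iff)
    then show ?thesis
      using True by (simp add: edge_tgt_def singular_face_def pt_simplex_def edge_path_def del: One_nat_def)
  qed (simp add: edge_tgt_def singular_face_def pt_simplex_def)
qed

lemma pt_simplex_eq_iff [simp]: "pt_simplex x = pt_simplex y \<longleftrightarrow> x = y"
proof
  assume "pt_simplex x = pt_simplex y"
  from fun_cong[OF this, of "\<lambda>j. if j = 0 then 1 else 0"] show "x = y"
    by (simp add: pt_simplex_def)
qed simp

lemma singular_simplex_0:
  "singular_simplex 0 Z f \<longleftrightarrow> (\<exists>x \<in> topspace Z. f = pt_simplex x)"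
proof
  assume f: "singular_simplex 0 Z f"
  let ?e = "\<lambda>j. if j = 0 then 1 else 0 :: real"
  have "f ?e \<in> topspace Z"
    using f by (auto simp: singular_simplex_def continuous_map_def standard_simplex_0)
  moreover have "f = pt_simplex (f ?e)"
  proof
    fix x show "f x = pt_simplex (f ?e) x"
      using f by (cases "x = ?e") (auto simp: singular_simplex_def pt_simplex_def standard_simplex_0 extensional_def restrict_def)
  qed
  ultimately show "\<exists>x \<in> topspace Z. f = pt_simplex x" by blast
next
  assume "\<exists>x \<in> topspace Z. f = pt_simplex x"
  then obtain x where x: "x \<in> topspace Z" "f = pt_simplex x" by blast
  have "continuous_map (top_of_set (standard_simplex 0)) Z f"
    by (rule continuous_map_eq[of _ _ "\<lambda>_. x"]) (use x in \<open>auto simp: pt_simplex_def\<close>)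
  then show "singular_simplex 0 Z f"
    unfolding singular_simplex_def top_of_set_fun using x by (simp add: pt_simplex_def)
qed

text \<open>The square is folded onto the triangle so that its bottom traverses the edges 01 and 12, its
  top the edge 02, and its sides collapse to vertices.\<close>

definition fold_square :: "real \<times> real \<Rightarrow> nat \<Rightarrow> real" where
  "fold_square = (\<lambda>(s, t) i. let m = (1 - s) * min (2 * t) (2 - 2 * t) in
     if i = 0 then 1 - t - m / 2 else if i = 1 then m else if i = 2 then t - m / 2 else 0)"

lemma fold_square_in:
  assumes "s \<in> {0..1}" "t \<in> {0..1}" shows "fold_square (s, t) \<in> standard_simplex 2"
proof -
  define c where "c = min (2 * t) (2 - 2 * t)"
  have c: "0 \<le> c" "c \<le> 2 * t" "c \<le> 2 - 2 * t" using assms by (auto simp: c_def)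
  have m: "0 \<le> (1 - s) * c" "(1 - s) * c \<le> c"
    using assms c by (auto intro: mult_left_le_one_le)
  have "{..2::nat} = {0, 1, 2}" by auto
  then show ?thesis
    using m c by (intro standard_simplexI) (auto simp: fold_square_def Let_def simp flip: c_def)
qed

lemma continuous_on_fold_square: "continuous_on B fold_square"
proof (rule continuous_on_funI)
  show "continuous_on B (\<lambda>x. fold_square x i)" for i
    by (cases "i = 0"; cases "i = 1"; cases "i = 2")
      (auto simp: fold_square_def Let_def case_prod_unfold intro!: continuous_intros)
qed

lemma fold_square_image: "fold_square ` ({0..1} \<times> {0..1}) = standard_simplex 2"
proof
  show "fold_square ` ({0..1} \<times> {0..1}) \<subseteq> standard_simplex 2" using fold_square_in by auto
  show "standard_simplex 2 \<subseteq> fold_square ` ({0..1} \<times> {0..1})"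
  proof
    fix x assume x: "x \<in> standard_simplex 2"
    have "{..2::nat} = {0, 1, 2}" by auto
    then have sum: "x 0 + x 1 + x 2 = 1" using standard_simplexD(4)[OF x] by simp
    have nn: "0 \<le> x 0" "0 \<le> x 1" "0 \<le> x 2" using standard_simplexD(1)[OF x] by auto
    define t where "t = x 2 + x 1 / 2"
    define c where "c = min (2 * t) (2 - 2 * t)"
    have c: "x 1 \<le> c" using nn sum by (auto simp: c_def t_def)
    \<comment> \<open>\<open>c\<close> is the height of the tent over \<open>t\<close>. It vanishes
      only for \<open>t = 0\<close> and \<open>t = 1\<close>, where a whole side collapses to a
      vertex and the default 0 serves.\<close>
    define s where "s = (if c = 0 then 0 else 1 - x 1 / c)"
    have m: "(1 - s) * c = x 1" using c nn by (auto simp: s_def)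
    have "s \<in> {0..1}" using c nn by (auto simp: s_def divide_simps)
    moreover have "t \<in> {0..1}" using nn sum by (auto simp: t_def)
    moreover have "fold_square (s, t) = x"
      using m sum standard_simplexD(3)[OF x] unfolding fold_square_def Let_def prod.case c_def[symmetric]
      by (auto simp: fun_eq_iff t_def)
    ultimately show "x \<in> fold_square ` ({0..1} \<times> {0..1})" by force
  qed
qed

lemma fold_square_inj:
  assumes "s \<in> {0..1}" "s' \<in> {0..1}" "t \<in> {0..1}" "t' \<in> {0..1}" and eq: "fold_square (s, t) = fold_square (s', t')"
  shows "t = t' \<and> (s = s' \<or> t = 0 \<or> t = 1)"
proof -
  have 1: "(1 - s) * min (2 * t) (2 - 2 * t) = (1 - s') * min (2 * t') (2 - 2 * t')"
    using fun_cong[OF eq, of 1] by (simp add: fold_square_def Let_def)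
  have t: "t = t'"
    using fun_cong[OF eq, of 2] 1 by (simp add: fold_square_def Let_def)
  moreover have "s = s'" if "t \<noteq> 0" "t \<noteq> 1"
  proof -
    have "min (2 * t) (2 - 2 * t) \<noteq> 0" using that by (auto simp: min_def)
    then show ?thesis using 1 t by simp
  qed
  ultimately show ?thesis by blast
qed

lemma fold_square_edges:
  assumes "t \<in> {0..1}"
  shows "t \<le> 1 / 2 \<Longrightarrow> fold_square (0, t) = simplical_face 2 (edge_pt (2 * t))"
    "1 / 2 \<le> t \<Longrightarrow> fold_square (0, t) = simplical_face 0 (edge_pt (2 * t - 1))"
    "fold_square (1, t) = simplical_face 1 (edge_pt t)"
  using assms
  by (auto simp: fold_square_def simplical_face_def edge_pt_def Let_def fun_eq_iff min_def diff_divide_distrib)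

lemma fold_square_sides: "fold_square (s, 0) = edge_pt 0" "fold_square (s, 1) = simplical_face 1 (edge_pt 1)"
  by (auto simp: fold_square_def simplical_face_def edge_pt_def Let_def fun_eq_iff)

lemma edge_path_tri:
  assumes "t \<in> {0..1}"
  shows "edge_path (tri_01 \<tau>) t = \<tau> (simplical_face 2 (edge_pt t))"
    "edge_path (tri_12 \<tau>) t = \<tau> (simplical_face 0 (edge_pt t))"
    "edge_path (tri_02 \<tau>) t = \<tau> (simplical_face 1 (edge_pt t))"
  using edge_pt_in[OF assms]
  by (simp_all add: edge_path_def tri_01_def tri_12_def tri_02_def singular_face_def)

lemma unit_square_top: "prod_topology unit_top unit_top = top_of_set ({0..1} \<times> {0..1})"
  by (simp add: prod_topology_subtopology_eu)

lemma continuous_map_fold_square: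
  "continuous_map (top_of_set ({0..1} \<times> {0..1})) (top_of_set (standard_simplex 2)) fold_square"
  using continuous_on_fold_square fold_square_in by auto

text \<open>The homotopy is \<tau> read on the square; the collapsed sides keep the ends
  fixed.\<close>

lemma tri_path_homotopic:
  assumes "singular_simplex 2 Z \<tau>"
  shows "path_homotopic Z (path_join (edge_path (tri_01 \<tau>)) (edge_path (tri_12 \<tau>))) (edge_path (tri_02 \<tau>))"
proof -
  have "continuous_map (top_of_set (standard_simplex 2)) Z \<tau>"
    using assms unfolding singular_simplex_def top_of_set_fun by simp
  with continuous_map_fold_square have "continuous_map (top_of_set ({0..1} \<times> {0..1})) Z (\<tau> \<circ> fold_square)"
    by (rule continuous_map_compose)
  moreover have "simplical_face 2 (edge_pt 0) = edge_pt 0" "simplical_face 0 (edge_pt 1) = simplical_face 1 (edge_pt 1)"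
    by (auto simp: simplical_face_def edge_pt_def fun_eq_iff)
  ultimately show ?thesis
    unfolding path_homotopic_iff unit_square_top
    by (intro exI[of _ "\<tau> \<circ> fold_square"] conjI ballI)
      (auto simp: path_join_def edge_path_tri fold_square_edges fold_square_sides)
qed

text \<open>A homotopy with fixed ends is constant on the two sides, hence descends along the
  quotient map \<open>fold_square\<close> to the triangle.\<close>

lemma path_homotopic_tri:
  assumes S: "singular_simplex 1 Z \<alpha>" "singular_simplex 1 Z \<beta>" "singular_simplex 1 Z \<delta>"
    and h: "path_homotopic Z (path_join (edge_path \<alpha>) (edge_path \<beta>)) (edge_path \<delta>)"
    and ab: "edge_path \<alpha> 1 = edge_path \<beta> 0"
  shows "\<exists>\<tau>. singular_simplex 2 Z \<tau> \<and> tri_01 \<tau> = \<alpha> \<and> tri_12 \<tau> = \<beta> \<and> tri_02 \<tau> = \<delta>"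
proof -
  let ?I = "{0..1::real} \<times> {0..1::real}" and ?j = "path_join (edge_path \<alpha>) (edge_path \<beta>)"
  obtain h where h: "continuous_map (top_of_set ?I) Z h"
    and h0: "\<And>t. t \<in> {0..1} \<Longrightarrow> h (0, t) = ?j t" and h1: "\<And>t. t \<in> {0..1} \<Longrightarrow> h (1, t) = edge_path \<delta> t"
    and hs: "\<And>s. s \<in> {0..1} \<Longrightarrow> h (s, 0) = ?j 0 \<and> h (s, 1) = ?j 1"
    using h unfolding path_homotopic_iff unit_square_top by blast
  have q: "quotient_map (top_of_set ?I) (top_of_set (standard_simplex 2)) fold_square"
  proof (rule continuous_closed_imp_quotient_map[OF continuous_map_fold_square])
    show "closed_map (top_of_set ?I) (top_of_set (standard_simplex 2)) fold_square"
      by (rule continuous_imp_closed_map[OF continuous_map_fold_square])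
        (simp_all add: compact_space_subtopology Hausdorff_space_subtopology compact_Times)
  qed (simp add: fold_square_image)
  obtain g where g: "continuous_map (top_of_set (standard_simplex 2)) Z g"
    and gq: "\<And>x. x \<in> topspace (top_of_set ?I) \<Longrightarrow> g (fold_square x) = h x"
  proof (rule quotient_map_lift_exists[OF q h])
    fix x y assume "x \<in> topspace (top_of_set ?I)" "y \<in> topspace (top_of_set ?I)" "fold_square x = fold_square y"
    then show "h x = h y"
      using fold_square_inj[of "fst x" "fst y" "snd x" "snd y"] hs[of "fst x"] hs[of "fst y"]
      by (cases x; cases y) auto
  qed auto
  let ?t = "restrict g (standard_simplex 2)"
  have gq': "?t (fold_square (s, t)) = h (s, t)" if "s \<in> {0..1}" "t \<in> {0..1}" for s t
    using gq[of "(s, t)"] fold_square_in[OF that] that by simp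
  have t: "singular_simplex 2 Z ?t"
    unfolding singular_simplex_def top_of_set_fun using continuous_map_eq[OF g, of ?t] by simp
  note tS = singular_simplex_tri[OF t]
  have "tri_01 ?t = \<alpha>"
  proof (rule edge_eqI[OF tS(1) S(1)])
    fix u :: real assume u: "u \<in> {0..1}"
    have "edge_path (tri_01 ?t) u = ?t (fold_square (0, u / 2))"
      using fold_square_edges(1)[of "u / 2"] u by (simp add: edge_path_tri)
    also have "\<dots> = edge_path \<alpha> u"
      using gq'[of 0 "u / 2"] h0[of "u / 2"] u by (simp add: path_join_def)
    finally show "edge_path (tri_01 ?t) u = edge_path \<alpha> u" .
  qed
  moreover have "tri_12 ?t = \<beta>"
  proof (rule edge_eqI[OF tS(3) S(2)])
    fix u :: real assume u: "u \<in> {0..1}"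
    have "edge_path (tri_12 ?t) u = ?t (fold_square (0, (u + 1) / 2))"
      using fold_square_edges(2)[of "(u + 1) / 2"] u by (simp add: edge_path_tri field_simps)
    also have "\<dots> = ?j ((u + 1) / 2)"
      using gq'[of 0 "(u + 1) / 2"] h0[of "(u + 1) / 2"] u by simp
    \<comment> \<open>At \<open>u = 0\<close> the parameter is \<open>1/2\<close>, where
      \<open>path_join\<close> still uses its first branch, so \<open>ab\<close> is called
      for.\<close>
    also have "\<dots> = edge_path \<beta> u"
      using u ab by (cases "u = 0") (auto simp: path_join_def field_simps)
    finally show "edge_path (tri_12 ?t) u = edge_path \<beta> u" .
  qed
  moreover have "tri_02 ?t = \<delta>"
  proof (rule edge_eqI[OF tS(2) S(3)])
    fix u :: real assume u: "u \<in> {0..1}"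
    have "edge_path (tri_02 ?t) u = ?t (fold_square (1, u))"
      using fold_square_edges(3)[of u] u by (simp add: edge_path_tri)
    also have "\<dots> = edge_path \<delta> u"
      using gq'[of 1 u] h1[of u] u by simp
    finally show "edge_path (tri_02 ?t) u = edge_path \<delta> u" .
  qed
  ultimately show ?thesis using t by blast
qed

section \<open>Labelling paths by elements of the fundamental group\<close>

locale eilenberg_maclane = group G
  for G :: "('g, 'd) monoid_scheme" (structure) +
  fixes T :: "'x topology" and x0 :: 'x and phi :: "(real \<Rightarrow> 'x) set \<Rightarrow> 'g"
  assumes K_G_1: "K_G_1 T x0 G phi"
begin

lemma x0: "x0 \<in> topspace T" and path_conn: "path_connected_space T" and asph: "aspherical T"
  and phi_iso: "phi \<in> iso (fundamental_group T x0) G"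
  using K_G_1 by (auto simp: K_G_1_def)

lemma is_loop_iff: "is_loop T x0 a \<longleftrightarrow> pathin T a \<and> a 0 = x0 \<and> a 1 = x0"
  by (simp add: is_loop_def pathin_def)

lemma loop_class_eq: "is_loop T x0 a \<Longrightarrow> loop_class T x0 a = {b. path_homotopic T a b}"
  by (simp add: loop_class_def path_homotopic_def is_loop_iff)

lemma loop_class_eq_iff:
  assumes "is_loop T x0 a" "is_loop T x0 b"
  shows "loop_class T x0 a = loop_class T x0 b \<longleftrightarrow> path_homotopic T a b"
proof
  assume "loop_class T x0 a = loop_class T x0 b"
  moreover have "path_homotopic T b b" using assms by (simp add: is_loop_iff path_homotopic_refl)
  ultimately show "path_homotopic T a b" using assms by (simp add: loop_class_eq set_eq_iff)
next
  assume "path_homotopic T a b"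
  then show "loop_class T x0 a = loop_class T x0 b"
    unfolding loop_class_eq[OF assms(1)] loop_class_eq[OF assms(2)]
    using path_homotopic_trans path_homotopic_sym by blast
qed

lemma is_loop_join: "\<lbrakk>is_loop T x0 a; is_loop T x0 b\<rbrakk> \<Longrightarrow> is_loop T x0 (path_join a b)"
  by (simp add: is_loop_iff pathin_path_join)

text \<open>The product is defined through representatives picked by \<open>SOME\<close>;
  \<open>path_join_cong\<close> makes it independent of them.\<close>

lemma fundamental_group_mult:
  assumes "is_loop T x0 a" "is_loop T x0 b"
  shows "loop_class T x0 a \<otimes>\<^bsub>fundamental_group T x0\<^esub> loop_class T x0 b = loop_class T x0 (path_join a b)"
proof -
  define a' where "a' = (SOME g. g \<in> loop_class T x0 a)"
  define b' where "b' = (SOME g. g \<in> loop_class T x0 b)"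
  have "a \<in> loop_class T x0 a" "b \<in> loop_class T x0 b"
    using assms by (simp_all add: loop_class_eq path_homotopic_refl is_loop_iff)
  then have "a' \<in> loop_class T x0 a" "b' \<in> loop_class T x0 b"
    unfolding a'_def b'_def by (metis someI)+
  then have h: "path_homotopic T a a'" "path_homotopic T b b'"
    using assms by (simp_all add: loop_class_eq)
  then have l: "is_loop T x0 a'" "is_loop T x0 b'"
    using assms path_homotopic_pathin path_homotopic_ends by (metis is_loop_iff)+
  have "path_homotopic T (path_join a b) (path_join a' b')"
    using h assms by (intro path_join_cong) (auto simp: is_loop_iff)
  then have "loop_class T x0 (path_join a' b') = loop_class T x0 (path_join a b)"
    using loop_class_eq_iff[OF is_loop_join[OF assms] is_loop_join[OF l]] by simp
  then show ?thesis by (simp add: fundamental_group_def a'_def b'_def)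
qed

lemma phi_mult:
  assumes "is_loop T x0 a" "is_loop T x0 b"
  shows "phi (loop_class T x0 (path_join a b)) = phi (loop_class T x0 a) \<otimes> phi (loop_class T x0 b)"
proof -
  have c: "loop_class T x0 a \<in> carrier (fundamental_group T x0)" "loop_class T x0 b \<in> carrier (fundamental_group T x0)"
    using assms by (auto simp: fundamental_group_def)
  have "phi \<in> hom (fundamental_group T x0) G" using phi_iso by (simp add: iso_def)
  from hom_mult[OF this c] show ?thesis
    unfolding fundamental_group_mult[OF assms] .
qed

lemma phi_closed: "is_loop T x0 a \<Longrightarrow> phi (loop_class T x0 a) \<in> carrier G"
  using phi_iso by (auto simp: iso_def hom_def fundamental_group_def)

lemma phi_inj: "\<lbrakk>is_loop T x0 a; is_loop T x0 b; phi (loop_class T x0 a) = phi (loop_class T x0 b)\<rbrakk> \<Longrightarrow> path_homotopic T a b"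
  using phi_iso loop_class_eq_iff[of a b]
  by (auto simp: iso_def bij_betw_def inj_on_def fundamental_group_def)

lemma phi_surj: "g \<in> carrier G \<Longrightarrow> \<exists>a. is_loop T x0 a \<and> phi (loop_class T x0 a) = g"
proof -
  assume "g \<in> carrier G"
  then have "g \<in> phi ` carrier (fundamental_group T x0)"
    using phi_iso by (simp add: iso_def bij_betw_def)
  then show ?thesis by (auto simp: fundamental_group_def)
qed

text \<open>Taken constant at \<open>x0\<close>, so that the label of a based loop is its own class;
  see \<open>gT_loop\<close>.\<close>

definition "base x = (if x = x0 then (\<lambda>_. x0) else (SOME p. pathin T p \<and> p 0 = x0 \<and> p 1 = x))"

lemma base: assumes "x \<in> topspace T" shows "pathin T (base x)" "base x 0 = x0" "base x 1 = x"
proof -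
  have "pathin T (base x) \<and> base x 0 = x0 \<and> base x 1 = x"
  proof (cases "x = x0")
    case True
    then show ?thesis using x0 by (simp add: base_def pathin_def)
  next
    case False
    have "\<exists>p. pathin T p \<and> p 0 = x0 \<and> p 1 = x"
      using path_conn x0 assms unfolding path_connected_space_def by blast
    from someI_ex[OF this] False show ?thesis by (simp add: base_def)
  qed
  then show "pathin T (base x)" "base x 0 = x0" "base x 1 = x" by auto
qed

definition "lp a = path_join (path_join (base (a 0)) a) (path_rev (base (a 1)))"

definition "gT a = phi (loop_class T x0 (lp a))"

lemma path_topspace: "pathin T a \<Longrightarrow> a 0 \<in> topspace T" "pathin T a \<Longrightarrow> a 1 \<in> topspace T"
  by (auto simp: pathin_def continuous_map_def)

lemma lp_loop: "pathin T a \<Longrightarrow> is_loop T x0 (lp a)"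
  unfolding lp_def is_loop_iff
  by (simp add: base path_topspace pathin_path_join pathin_path_rev)

lemma lp_cong: "path_homotopic T a b \<Longrightarrow> path_homotopic T (lp a) (lp b)"
  using path_homotopic_ends[of T a b] path_homotopic_pathin(1)[of T a b]
  unfolding lp_def by (auto intro!: path_join_cong path_homotopic_refl pathin_path_rev simp: base path_topspace)

text \<open>The return along \<open>base (a 1)\<close> that ends the first loop cancels against the
  way out that starts the second.\<close>

lemma lp_join:
  assumes a: "pathin T a" and b: "pathin T b" and ab: "a 1 = b 0"
  shows "path_homotopic T (path_join (lp a) (lp b)) (lp (path_join a b))"
proof -
  let ?p = "base (a 0)" and ?q = "base (a 1)" and ?r = "path_rev (base (b 1))"
  note B = base[OF path_topspace(1)[OF a]] base[OF path_topspace(2)[OF a]] base[OF path_topspace(2)[OF b]]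
  note P = pathin_path_join pathin_path_rev a b B
  have "path_homotopic T (path_join (lp a) (lp b))
      (path_join (path_join ?p a) (path_join (path_rev ?q) (path_join (path_join ?q b) ?r)))"
    unfolding lp_def ab[symmetric] by (rule path_join_assoc) (simp_all add: P ab[symmetric])
  also have "path_homotopic T \<dots> (path_join (path_join ?p a) (path_join (path_rev ?q) (path_join ?q (path_join b ?r))))"
    by (rule path_join_cong[OF path_homotopic_refl path_join_cong[OF path_homotopic_refl path_join_assoc]]) (simp_all add: P ab[symmetric])
  also have "path_homotopic T \<dots> (path_join (path_join ?p a) (path_join b ?r))"
    by (rule path_join_cong[OF path_homotopic_refl path_join_cancel_left]) (simp_all add: P ab[symmetric])
  also have "path_homotopic T \<dots> (path_join (path_join (path_join ?p a) b) ?r)"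
    by (rule path_homotopic_sym, rule path_join_assoc) (simp_all add: P ab[symmetric])
  also have "path_homotopic T \<dots> (path_join (path_join ?p (path_join a b)) ?r)"
    by (rule path_join_cong[OF path_join_assoc path_homotopic_refl]) (simp_all add: P ab[symmetric])
  finally show ?thesis by (simp add: lp_def)
qed

text \<open>Conjugating back with the base paths recovers a path from its loop, so homotopic loops
  come from homotopic paths.\<close>

lemma lp_cancel:
  assumes a: "pathin T a" and b: "pathin T b" and ends: "a 0 = b 0" "a 1 = b 1"
    and h: "path_homotopic T (lp a) (lp b)"
  shows "path_homotopic T a b"
proof -
  let ?p = "base (a 0)" and ?q = "base (a 1)"
  have *: "path_homotopic T (path_join (path_rev ?p) (path_join (lp c) ?q)) c"
    if c: "pathin T c" "c 0 = a 0" "c 1 = a 1" for c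
  proof -
    note B = base[OF path_topspace(1)[OF a]] base[OF path_topspace(2)[OF a]]
    note P = pathin_path_join pathin_path_rev a c B
    have "path_homotopic T (path_join (lp c) ?q) (path_join ?p c)"
      using path_join_cancel_right[of T "path_join ?p c" "path_rev ?q"] by (simp add: lp_def P)
    from path_join_cong[OF path_homotopic_refl[of T "path_rev ?p"] this]
    have "path_homotopic T (path_join (path_rev ?p) (path_join (lp c) ?q)) (path_join (path_rev ?p) (path_join ?p c))"
      by (simp add: P lp_def)
    also have "path_homotopic T \<dots> c"
      by (rule path_join_cancel_left) (simp_all add: P)
    finally show ?thesis .
  qed
  note B = base[OF path_topspace(1)[OF a]] base[OF path_topspace(2)[OF a]]
  have "path_homotopic T a (path_join (path_rev ?p) (path_join (lp a) ?q))"
    using *[OF a] path_homotopic_sym by blast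
  also have "path_homotopic T \<dots> (path_join (path_rev ?p) (path_join (lp b) ?q))"
    by (rule path_join_cong[OF path_homotopic_refl path_join_cong[OF h path_homotopic_refl]]) (simp_all add: B pathin_path_rev lp_def)
  also have "path_homotopic T \<dots> b"
    using *[OF b] ends by simp
  finally show ?thesis .
qed

lemma gT_closed: "pathin T a \<Longrightarrow> gT a \<in> carrier G"
  by (simp add: gT_def phi_closed lp_loop)

lemma gT_cong: "path_homotopic T a b \<Longrightarrow> gT a = gT b"
  unfolding gT_def using lp_cong loop_class_eq_iff lp_loop path_homotopic_pathin by metis

lemma gT_join: "\<lbrakk>pathin T a; pathin T b; a 1 = b 0\<rbrakk> \<Longrightarrow> gT (path_join a b) = gT a \<otimes> gT b"
  unfolding gT_def
  using phi_mult[OF lp_loop lp_loop, of a b] lp_join[of a b] lp_loop[OF pathin_path_join[of T a b]]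
    loop_class_eq_iff[OF is_loop_join[OF lp_loop lp_loop], of a b "lp (path_join a b)"] by simp

lemma gT_inj:
  assumes "pathin T a" "pathin T b" "a 0 = b 0" "a 1 = b 1" "gT a = gT b"
  shows "path_homotopic T a b"
  by (rule lp_cancel[OF assms(1-4) phi_inj[OF lp_loop[OF assms(1)] lp_loop[OF assms(2)]]])
    (use assms(5) in \<open>simp add: gT_def\<close>)

lemma gT_loop: "is_loop T x0 a \<Longrightarrow> gT a = phi (loop_class T x0 a)"
proof -
  assume a: "is_loop T x0 a"
  then have "path_homotopic T (lp a) a"
    using path_join_const[of T a] by (simp add: lp_def is_loop_iff base_def path_rev_def)
  then show ?thesis
    unfolding gT_def using a loop_class_eq_iff[OF lp_loop[of a] a] by (simp add: is_loop_iff)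
qed

text \<open>A loop of class \<open>g\<close> is conjugated by the base paths of \<open>x\<close> and
  \<open>y\<close>, which cancel when the result is closed up again.\<close>

lemma gT_surj:
  assumes "x \<in> topspace T" "y \<in> topspace T" "g \<in> carrier G"
  shows "\<exists>a. pathin T a \<and> a 0 = x \<and> a 1 = y \<and> gT a = g"
proof -
  obtain l where l: "is_loop T x0 l" "phi (loop_class T x0 l) = g" using phi_surj assms by blast
  have lp: "pathin T l" "l 0 = x0" "l 1 = x0" using l by (auto simp: is_loop_iff)
  note B = base[OF assms(1)] base[OF assms(2)]
  let ?a = "path_join (path_rev (base x)) (path_join l (base y))"
  note P = pathin_path_join pathin_path_rev lp B
  have a: "pathin T ?a" by (simp add: P)
  have "path_homotopic T (path_join (base x) ?a) (path_join l (base y))"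
    using path_join_cancel_left[of T "path_rev (base x)" "path_join l (base y)"] by (simp add: P)
  from path_join_cong[OF this path_homotopic_refl[of T "path_rev (base y)"]]
  have "path_homotopic T (lp ?a) (path_join (path_join l (base y)) (path_rev (base y)))"
    by (simp add: lp_def P)
  also have "path_homotopic T \<dots> l"
    by (rule path_join_cancel_right) (simp_all add: P)
  finally have "gT ?a = g"
    using loop_class_eq_iff[OF lp_loop[OF a] l(1)] l(2) by (simp add: gT_def)
  then show ?thesis using a by (intro exI[of _ ?a]) (simp add: B)
qed

lemma gT_eq: "\<lbrakk>pathin T a; \<And>t. t \<in> {0..1} \<Longrightarrow> a t = b t\<rbrakk> \<Longrightarrow> gT a = gT b"
  by (rule gT_cong, rule path_homotopic_eq)

lemma gT_tri:
  assumes "singular_simplex 2 T \<tau>"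
  shows "gT (edge_path (tri_01 \<tau>)) \<otimes> gT (edge_path (tri_12 \<tau>)) = gT (edge_path (tri_02 \<tau>))"
proof -
  note S = singular_simplex_tri[OF assms]
  have "edge_path (tri_01 \<tau>) 1 = edge_path (tri_12 \<tau>) 0"
    using edge_simps(2)[of \<tau>] by (simp add: edge_src_eq edge_tgt_eq)
  then show ?thesis
    using gT_cong[OF tri_path_homotopic[OF assms]] gT_join[OF pathin_edge_path[OF S(1)] pathin_edge_path[OF S(3)]] by simp
qed

lemma gT_fill:
  assumes S: "singular_simplex 1 T \<alpha>" "singular_simplex 1 T \<beta>" "singular_simplex 1 T \<delta>"
    and E: "edge_src \<alpha> = edge_src \<delta>" "edge_tgt \<alpha> = edge_src \<beta>" "edge_tgt \<beta> = edge_tgt \<delta>"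
    and g: "gT (edge_path \<alpha>) \<otimes> gT (edge_path \<beta>) = gT (edge_path \<delta>)"
  shows "\<exists>\<tau>. singular_simplex 2 T \<tau> \<and> tri_01 \<tau> = \<alpha> \<and> tri_12 \<tau> = \<beta> \<and> tri_02 \<tau> = \<delta>"
proof (rule path_homotopic_tri[OF S])
  note P = pathin_edge_path[OF S(1)] pathin_edge_path[OF S(2)] pathin_edge_path[OF S(3)]
  show ab: "edge_path \<alpha> 1 = edge_path \<beta> 0" using E by (simp add: edge_src_eq edge_tgt_eq)
  show "path_homotopic T (path_join (edge_path \<alpha>) (edge_path \<beta>)) (edge_path \<delta>)"
    by (rule gT_inj) (use P ab E g in \<open>simp_all add: pathin_path_join gT_join edge_src_eq edge_tgt_eq\<close>)
qed

end

section \<open>The mapping cylinder\<close>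

lemma openin_disjoint_union_topology:
  "openin (disjoint_union_topology T Y) U \<longleftrightarrow>
     U \<subseteq> Inl ` topspace T \<union> Inr ` topspace Y \<and> openin T (Inl -` U) \<and> openin Y (Inr -` U)"
proof -
  have "istopology (\<lambda>U. U \<subseteq> Inl ` topspace T \<union> Inr ` topspace Y \<and> openin T (Inl -` U) \<and> openin Y (Inr -` U))"
    unfolding istopology_def by (auto simp: vimage_Union)
  then show ?thesis
    unfolding disjoint_union_topology_def by (simp add: topology_inverse')
qed

lemma topspace_disjoint_union_topology:
  "topspace (disjoint_union_topology T Y) = Inl ` topspace T \<union> Inr ` topspace Y"
proof -
  have "Inl -` (Inl ` topspace T \<union> Inr ` topspace Y) = topspace T"
    "Inr -` (Inl ` topspace T \<union> Inr ` topspace Y) = topspace Y" by auto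
  then have "openin (disjoint_union_topology T Y) (Inl ` topspace T \<union> Inr ` topspace Y)"
    by (simp add: openin_disjoint_union_topology)
  moreover have "U \<subseteq> Inl ` topspace T \<union> Inr ` topspace Y" if "openin (disjoint_union_topology T Y) U" for U
    using that openin_disjoint_union_topology by blast
  ultimately show ?thesis
    unfolding topspace_def by blast
qed

lemma continuous_map_Inl: "continuous_map T (disjoint_union_topology T Y) Inl"
  and continuous_map_Inr: "continuous_map Y (disjoint_union_topology T Y) Inr"
proof -
  have "{x \<in> topspace T. Inl x \<in> U} = Inl -` U" "{y \<in> topspace Y. Inr y \<in> U} = Inr -` U"
    if "openin (disjoint_union_topology T Y) U" for U
    using openin_subset[OF that] by (auto simp: topspace_disjoint_union_topology)
  then show "continuous_map T (disjoint_union_topology T Y) Inl" "continuous_map Y (disjoint_union_topology T Y) Inr"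
    by (auto simp: continuous_map_def topspace_disjoint_union_topology openin_disjoint_union_topology)
qed

lemma continuous_map_from_disjoint_union:
  assumes "continuous_map T Z (f \<circ> Inl)" "continuous_map Y Z (f \<circ> Inr)"
  shows "continuous_map (disjoint_union_topology T Y) Z f"
  unfolding continuous_map_def
proof (intro conjI allI impI)
  show "f \<in> topspace (disjoint_union_topology T Y) \<rightarrow> topspace Z"
    using assms by (auto simp: topspace_disjoint_union_topology continuous_map_def Pi_iff)
  fix U assume U: "openin Z U"
  let ?V = "{x \<in> topspace (disjoint_union_topology T Y). f x \<in> U}"
  have e: "Inl -` ?V = {x \<in> topspace T. (f \<circ> Inl) x \<in> U}" "Inr -` ?V = {x \<in> topspace Y. (f \<circ> Inr) x \<in> U}"
    by (auto simp: topspace_disjoint_union_topology)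
  show "openin (disjoint_union_topology T Y) ?V"
    unfolding openin_disjoint_union_topology e
    by (intro conjI openin_continuous_map_preimage[OF assms(1) U] openin_continuous_map_preimage[OF assms(2) U])
      (auto simp: topspace_disjoint_union_topology)
qed

lemma openin_quotient_topology:
  "openin (quotient_topology D q) U \<longleftrightarrow> U \<subseteq> q ` topspace D \<and> openin D {x \<in> topspace D. q x \<in> U}"
proof -
  have "istopology (\<lambda>U. U \<subseteq> q ` topspace D \<and> openin D {x \<in> topspace D. q x \<in> U})"
    unfolding istopology_def
  proof (intro conjI allI impI)
    fix U V assume *: "U \<subseteq> q ` topspace D \<and> openin D {x \<in> topspace D. q x \<in> U}"
      "V \<subseteq> q ` topspace D \<and> openin D {x \<in> topspace D. q x \<in> V}"
    then show "U \<inter> V \<subseteq> q ` topspace D" by blast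
    have "{x \<in> topspace D. q x \<in> U \<inter> V} = {x \<in> topspace D. q x \<in> U} \<inter> {x \<in> topspace D. q x \<in> V}" by auto
    then show "openin D {x \<in> topspace D. q x \<in> U \<inter> V}" using * by (simp add: openin_Int)
  next
    fix \<K> assume *: "\<forall>K\<in>\<K>. K \<subseteq> q ` topspace D \<and> openin D {x \<in> topspace D. q x \<in> K}"
    then show "\<Union>\<K> \<subseteq> q ` topspace D" by blast
    have "{x \<in> topspace D. q x \<in> \<Union>\<K>} = (\<Union>K\<in>\<K>. {x \<in> topspace D. q x \<in> K})" by auto
    then show "openin D {x \<in> topspace D. q x \<in> \<Union>\<K>}" using * by auto
  qed
  then show ?thesis
    unfolding quotient_topology_def by (simp add: topology_inverse')
qed

lemma topspace_quotient_topology: "topspace (quotient_topology D q) = q ` topspace D"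
proof -
  have "{x \<in> topspace D. q x \<in> q ` topspace D} = topspace D" by auto
  then have "openin (quotient_topology D q) (q ` topspace D)"
    by (simp add: openin_quotient_topology)
  moreover have "U \<subseteq> q ` topspace D" if "openin (quotient_topology D q) U" for U
    using that by (simp add: openin_quotient_topology)
  ultimately show ?thesis unfolding topspace_def by blast
qed

lemma quotient_map_quotient_topology: "quotient_map D (quotient_topology D q) q"
  unfolding quotient_map_def topspace_quotient_topology
  by (auto simp: openin_quotient_topology)

locale cylinder =
  fixes T :: "'x topology" and \<gamma> :: "complex \<Rightarrow> 'x"
  assumes gamma: "continuous_map circle T \<gamma>"
begin

abbreviation "Y \<equiv> top_of_set (sphere (0::complex) 1 \<times> {0..1::real})"
abbreviation "D \<equiv> disjoint_union_topology T Y"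
abbreviation "M \<equiv> mapping_cylinder T \<gamma>"
abbreviation "A \<equiv> cylinder_end :: ('x + complex \<times> real) set"

lemma M_eq: "M = quotient_topology D (cyl_map \<gamma>)"
  by (simp add: mapping_cylinder_def)

lemma quotient_map_cyl: "quotient_map D M (cyl_map \<gamma>)"
  unfolding M_eq by (rule quotient_map_quotient_topology)

lemma continuous_map_cyl: "continuous_map D M (cyl_map \<gamma>)"
  by (rule quotient_imp_continuous_map[OF quotient_map_cyl])

lemma topspace_M: "topspace M = cyl_map \<gamma> ` topspace D"
  unfolding M_eq by (rule topspace_quotient_topology)

lemma M_cases:
  assumes "p \<in> topspace M"
  obtains x where "x \<in> topspace T" "p = Inl x" | z t where "z \<in> sphere 0 1" "t \<in> {0<..1}" "p = Inr (z, t)"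
proof -
  obtain d where d: "d \<in> topspace D" "p = cyl_map \<gamma> d" using assms unfolding topspace_M by blast
  then consider x where "x \<in> topspace T" "d = Inl x" | z t where "z \<in> sphere 0 1" "t \<in> {0..1}" "d = Inr (z, t)"
    by (auto simp: topspace_disjoint_union_topology)
  then show ?thesis
  proof cases
    case 1
    then show ?thesis using d that(1) by (simp add: cyl_map_def)
  next
    case 2
    have "\<gamma> z \<in> topspace T" using gamma 2 by (auto simp: continuous_map_def)
    then show ?thesis using d that(1)[of "\<gamma> z"] that(2)[of z t] 2 by (cases "t = 0") (auto simp: cyl_map_def)
  qed
qed

section \<open>The collapse of the cylinder onto \<open>X\<close> and its homotopy to the
  identity\<close>

definition "\<rho> p = (case p of Inl x \<Rightarrow> x | Inr (z, t) \<Rightarrow> \<gamma> z)"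

lemma rho_simps [simp]: "\<rho> (Inl x) = x" "\<rho> (Inr (z, t)) = \<gamma> z"
  by (simp_all add: \<rho>_def)

lemma rho_cyl: "\<rho> (cyl_map \<gamma> (Inl x)) = x" "\<rho> (cyl_map \<gamma> (Inr (z, t))) = \<gamma> z"
  by (simp_all add: cyl_map_def)

lemma continuous_map_rho: "continuous_map M T \<rho>"
proof (rule continuous_compose_quotient_map[OF quotient_map_cyl], rule continuous_map_from_disjoint_union)
  have "(\<rho> \<circ> cyl_map \<gamma>) \<circ> Inl = id" by (auto simp: rho_cyl)
  then show "continuous_map T T ((\<rho> \<circ> cyl_map \<gamma>) \<circ> Inl)" by simp
  have "(\<rho> \<circ> cyl_map \<gamma>) \<circ> Inr = \<gamma> \<circ> fst" by (auto simp: rho_cyl)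
  then show "continuous_map Y T ((\<rho> \<circ> cyl_map \<gamma>) \<circ> Inr)"
    using continuous_map_compose[of Y circle fst T \<gamma>] gamma by (auto intro!: continuous_intros)
qed

lemma continuous_map_Inl_M: "continuous_map T M Inl"
proof -
  have "cyl_map \<gamma> \<circ> Inl = Inl" by (auto simp: cyl_map_def)
  then show ?thesis using continuous_map_compose[OF continuous_map_Inl continuous_map_cyl] by simp
qed

text \<open>The height is scaled by \<open>1 - s\<close>; applying \<open>cyl_map\<close> again
  performs the gluing when the height reaches 0.\<close>

definition "H = (\<lambda>(s::real, p). case p of Inl x \<Rightarrow> Inl x | Inr (z, t) \<Rightarrow> cyl_map \<gamma> (Inr (z, (1 - s) * t)))"

lemma H_cyl: "H (s, cyl_map \<gamma> (Inl x)) = Inl x" "H (s, cyl_map \<gamma> (Inr (z, t))) = cyl_map \<gamma> (Inr (z, (1 - s) * t))"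
  by (auto simp: H_def cyl_map_def)

text \<open>The unit interval is locally compact Hausdorff, so its product with the quotient map
  \<open>cyl_map\<close> is again a quotient map. Continuity can therefore be tested before gluing,
  on the two open summands.\<close>

lemma continuous_map_H: "continuous_map (prod_topology (top_of_set {0..1}) M) M H"
proof -
  let ?I = "top_of_set {0..1::real}"
  have lc: "locally_compact_space ?I"
    by (simp add: compact_imp_locally_compact_space compact_space_subtopology)
  have q: "quotient_map (prod_topology ?I D) (prod_topology ?I M) (\<lambda>(s, d). (s, cyl_map \<gamma> d))"
    by (rule quotient_map_prod_right[OF lc _ quotient_map_cyl]) (simp add: Hausdorff_space_subtopology)
  let ?pr = "projr :: 'x + complex \<times> real \<Rightarrow> complex \<times> real"
  let ?U = "\<lambda>i::nat. if i = 0 then {0..1::real} \<times> (Inl ` topspace T) else {0..1} \<times> (Inr ` topspace Y)"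
  let ?h = "\<lambda>(s, y). cyl_map \<gamma> (Inr (fst y, (1 - s) * snd y))"
  let ?f = "\<lambda>(i::nat) x. if i = 0 then cyl_map \<gamma> (snd x) else ?h (fst x, ?pr (snd x))"
  have opn: "openin D (Inl ` topspace T)" "openin D (Inr ` topspace Y)"
  proof -
    have e: "Inl -` (Inl ` topspace T :: ('x + complex \<times> real) set) = topspace T"
      "Inr -` (Inl ` topspace T :: ('x + complex \<times> real) set) = {}"
      "Inr -` (Inr ` topspace Y :: ('x + complex \<times> real) set) = topspace Y"
      "Inl -` (Inr ` topspace Y :: ('x + complex \<times> real) set) = {}" by auto
    show "openin D (Inl ` topspace T)" "openin D (Inr ` topspace Y)"
      unfolding openin_disjoint_union_topology e by auto
  qed
  have pr: "continuous_map (subtopology D (Inr ` topspace Y)) Y ?pr"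
    unfolding continuous_map_def
  proof (intro conjI allI impI)
    fix V assume V: "openin Y V"
    have VY: "V \<subseteq> topspace Y" by (rule openin_subset[OF V])
    have "{x \<in> topspace (subtopology D (Inr ` topspace Y)). ?pr x \<in> V} = Inr ` V"
      using VY by (auto simp: topspace_disjoint_union_topology)
    moreover have "openin D (Inr ` V)"
    proof -
      have e: "Inr -` (Inr ` V :: ('x + complex \<times> real) set) = V"
        "Inl -` (Inr ` V :: ('x + complex \<times> real) set) = {}" by auto
      show ?thesis unfolding openin_disjoint_union_topology e using V VY by auto
    qed
    ultimately show "openin (subtopology D (Inr ` topspace Y)) {x \<in> topspace (subtopology D (Inr ` topspace Y)). ?pr x \<in> V}"
      using VY openin_open_subtopology[OF opn(2), of "Inr ` V"] by (simp add: image_mono)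
  qed (auto simp: topspace_disjoint_union_topology)
  have hc: "continuous_map (prod_topology ?I Y) M ?h"
  proof -
    have "continuous_on ({0..1::real} \<times> (sphere (0::complex) 1 \<times> {0..1::real})) (\<lambda>x. (fst (snd x), (1 - fst x) * snd (snd x)))"
      by (intro continuous_intros)
    then have "continuous_map (prod_topology ?I Y) Y (\<lambda>x. (fst (snd x), (1 - fst x) * snd (snd x)))"
      by (auto simp: mult_le_one)
    from continuous_map_compose[OF continuous_map_compose[OF this continuous_map_Inr] continuous_map_cyl]
    show ?thesis by (simp add: o_def case_prod_unfold)
  qed
  have "continuous_map (prod_topology ?I D) M (\<lambda>(s, d). H (s, cyl_map \<gamma> d))"
  proof (rule pasting_lemma[where I = "{0, 1::nat}" and T = ?U and f = ?f])
    show "openin (prod_topology ?I D) (?U i)" for i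
      using opn by (auto simp: openin_prod_Times_iff simp del: topspace_prod_topology)
    show "continuous_map (subtopology (prod_topology ?I D) (?U i)) M (?f i)" for i
    proof (cases "i = 0")
      case True
      have "continuous_map (prod_topology ?I D) M (cyl_map \<gamma> \<circ> snd)"
        by (rule continuous_map_compose[OF continuous_map_snd continuous_map_cyl])
      then show ?thesis
        using True continuous_map_from_subtopology by (simp add: o_def)
    next
      case False
      have "subtopology (prod_topology ?I D) ({0..1} \<times> (Inr ` topspace Y)) = prod_topology ?I (subtopology D (Inr ` topspace Y))"
        unfolding subtopology_Times by (simp add: subtopology_subtopology)
      moreover have "continuous_map (prod_topology ?I (subtopology D (Inr ` topspace Y))) (prod_topology ?I Y) (\<lambda>x. (fst x, ?pr (snd x)))"
        by (intro continuous_map_pairedI continuous_map_fst continuous_map_compose[OF continuous_map_snd pr, unfolded o_def])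
      ultimately show ?thesis
        using False continuous_map_compose[OF _ hc, of _ "\<lambda>x. (fst x, ?pr (snd x))"] by (simp add: o_def)
    qed
    fix x assume x: "x \<in> topspace (prod_topology ?I D)"
    then obtain s d where sd: "x = (s, d)" "s \<in> {0..1}" "d \<in> topspace D" by auto
    show "\<exists>j. j \<in> {0, 1} \<and> x \<in> ?U j \<and> (case x of (s, d) \<Rightarrow> H (s, cyl_map \<gamma> d)) = ?f j x"
    proof (cases d)
      case (Inl y)
      then show ?thesis using sd by (intro exI[of _ 0]) (auto simp: topspace_disjoint_union_topology H_cyl, simp add: cyl_map_def)
    next
      case (Inr y)
      then show ?thesis using sd by (cases y, intro exI[of _ 1]) (auto simp: topspace_disjoint_union_topology H_cyl)
    qed
  next
    fix i j x assume "i \<in> {0, 1::nat}" "j \<in> {0, 1::nat}" "x \<in> topspace (prod_topology ?I D) \<inter> ?U i \<inter> ?U j"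
    then have "i = j" by (auto split: if_splits)
    then show "?f i x = ?f j x" by simp
  qed
  moreover have "(\<lambda>(s, d). H (s, cyl_map \<gamma> d)) = H \<circ> (\<lambda>(s, d). (s, cyl_map \<gamma> d))" by auto
  ultimately show ?thesis
    using continuous_compose_quotient_map[OF q] by simp
qed

lemma H_0: "p \<in> topspace M \<Longrightarrow> H (0, p) = p"
  by (erule M_cases) (auto simp: H_def cyl_map_def)

lemma H_1: "H (1, p) = Inl (\<rho> p)"
  by (auto simp: H_def cyl_map_def \<rho>_def split: sum.splits)

lemma rho_H: "\<rho> (H (s, p)) = \<rho> p"
  by (auto simp: H_def \<rho>_def cyl_map_def split: sum.splits)

text \<open>\<open>f\<close> is homotopic through \<open>H\<close> to its collapse into
  \<open>X\<close>, which is null-homotopic there.\<close>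

lemma cyl_null:
  assumes f: "continuous_map Z M f" and h: "homotopic_with (\<lambda>_. True) Z T (\<rho> \<circ> f) (\<lambda>_. c)"
  shows "\<exists>c'. homotopic_with (\<lambda>_. True) Z M f (\<lambda>_. c')"
proof -
  have "homotopic_with (\<lambda>_. True) M M id (Inl \<circ> \<rho>)"
    by (subst homotopic_with, simp, intro exI[of _ H]) (simp add: continuous_map_H H_0 H_1)
  from homotopic_with_compose_continuous_map_right[OF this f, of "\<lambda>_. True"]
  have "homotopic_with (\<lambda>_. True) Z M f (Inl \<circ> (\<rho> \<circ> f))" by (simp add: o_assoc)
  moreover from homotopic_with_compose_continuous_map_left[OF h continuous_map_Inl_M, of "\<lambda>_. True"]
  have "homotopic_with (\<lambda>_. True) Z M (Inl \<circ> (\<rho> \<circ> f)) (\<lambda>_. Inl c)" by (simp add: o_def)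
  ultimately show ?thesis using homotopic_with_trans by blast
qed

section \<open>The end circle\<close>

lemma continuous_map_end: "continuous_map circle (subtopology M A) (\<lambda>z. Inr (z, 1))"
proof -
  have "continuous_map circle Y (\<lambda>z. (z, 1))"
    by (auto intro!: continuous_intros)
  from continuous_map_compose[OF continuous_map_compose[OF this continuous_map_Inr] continuous_map_cyl]
  have "continuous_map circle M (\<lambda>z. Inr (z, 1))"
    by (simp add: o_def cyl_map_def)
  then show ?thesis
    by (auto simp: continuous_map_in_subtopology cylinder_end_def)
qed

definition end_proj :: "'x + complex \<times> real \<Rightarrow> complex" where
  "end_proj p = fst (projr p)"

text \<open>For open \<open>V\<close> in the circle the set \<open>V \<times> {0<..1}\<close> avoids
  the gluing locus, so it is open in the cylinder and cuts out the preimage of \<open>V\<close> in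
  the end.\<close>

lemma continuous_map_end_proj: "continuous_map (subtopology M A) circle end_proj"
  unfolding continuous_map_def
proof (intro conjI allI impI)
  show "end_proj \<in> topspace (subtopology M A) \<rightarrow> topspace circle"
    by (auto simp: cylinder_end_def end_proj_def)
  fix V assume V: "openin circle V"
  have Vs: "V \<subseteq> sphere 0 1" using openin_subset[OF V] by simp
  let ?W = "Inr ` (V \<times> {0<..1::real}) :: ('x + complex \<times> real) set"
  have "openin M ?W"
  proof -
    have "?W \<subseteq> cyl_map \<gamma> ` topspace D"
    proof clarify
      fix z t assume "z \<in> V" "t \<in> {0<..1::real}"
      then show "Inr (z, t) \<in> cyl_map \<gamma> ` topspace D"
        using Vs by (intro image_eqI[of _ _ "Inr (z, t)"]) (auto simp: cyl_map_def topspace_disjoint_union_topology)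
    qed
    moreover have eq: "{x \<in> topspace D. cyl_map \<gamma> x \<in> ?W} = Inr ` (V \<times> {0<..1})"
      using Vs by (auto simp: cyl_map_def topspace_disjoint_union_topology split: if_splits)
    moreover have "openin D (Inr ` (V \<times> {0<..1}))"
    proof -
      have "openin (top_of_set {0..1}) ({0..1} \<inter> {0::real<..})" by (intro openin_open_Int) simp
      moreover have "{0..1} \<inter> {0<..} = {0<..1::real}" by auto
      ultimately have "openin (prod_topology circle (top_of_set {0..1::real})) (V \<times> {0<..1})"
        using V unfolding openin_prod_Times_iff by simp
      then have "openin Y (V \<times> {0<..1})" by simp
      moreover have e: "Inr -` (Inr ` (V \<times> {0<..1::real}) :: ('x + complex \<times> real) set) = V \<times> {0<..1}"
        "Inl -` (Inr ` (V \<times> {0<..1}) :: ('x + complex \<times> real) set) = {}" by auto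
      ultimately show ?thesis
        unfolding openin_disjoint_union_topology e using openin_subset[of Y "V \<times> {0<..1}"] by auto
    qed
    ultimately show ?thesis
      unfolding M_eq openin_quotient_topology by simp
  qed
  moreover have "{x \<in> topspace (subtopology M A). end_proj x \<in> V} = ?W \<inter> A"
    using openin_subset[OF calculation] by (auto simp: cylinder_end_def end_proj_def)
  ultimately show "openin (subtopology M A) {x \<in> topspace (subtopology M A). end_proj x \<in> V}"
    by (auto simp: openin_subtopology)
qed

lemma A_end: "p \<in> A \<Longrightarrow> p = Inr (end_proj p, 1) \<and> end_proj p \<in> sphere 0 1"
  by (auto simp: cylinder_end_def end_proj_def)

end

section \<open>Edge labels on the mapping cylinder\<close>

lemma edge_path_simplex_map: "t \<in> {0..1} \<Longrightarrow> edge_path (simplex_map 1 f \<sigma>) t = f (edge_path \<sigma> t)"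
  using edge_pt_in[of t] by (simp add: edge_path_def simplex_map_def)

lemma tri_simplex_map:
  "tri_01 (simplex_map 2 f \<tau>) = simplex_map 1 f (tri_01 \<tau>)"
  "tri_12 (simplex_map 2 f \<tau>) = simplex_map 1 f (tri_12 \<tau>)"
  "tri_02 (simplex_map 2 f \<tau>) = simplex_map 1 f (tri_02 \<tau>)"
proof -
  have "simplical_face k x \<in> standard_simplex 2" if "k \<le> 2" "x \<in> standard_simplex 1" for k x
    using simplical_face_in_standard_simplex[of 2 k x] that by simp
  then show "tri_01 (simplex_map 2 f \<tau>) = simplex_map 1 f (tri_01 \<tau>)"
    "tri_12 (simplex_map 2 f \<tau>) = simplex_map 1 f (tri_12 \<tau>)"
    "tri_02 (simplex_map 2 f \<tau>) = simplex_map 1 f (tri_02 \<tau>)"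
    by (auto simp: tri_01_def tri_12_def tri_02_def singular_face_def simplex_map_def restrict_def fun_eq_iff)
qed

lemma cis_shift: "cis (a + 2 * pi * of_int k) = cis a"
  by (simp flip: cis_mult)

lemma cis_eqD: "cis a = cis b \<Longrightarrow> \<exists>k::int. a = b + 2 * pi * of_int k"
  using sin_cos_eq_iff[of a b] by (auto simp: complex_eq_iff)

lemma Arg2pi_cis: "Arg2pi (cis a) = a - 2 * pi * of_int \<lfloor>a / (2 * pi)\<rfloor>"
proof (rule Arg2pi_unique[of 1])
  have "cis (a - 2 * pi * of_int \<lfloor>a / (2 * pi)\<rfloor>) = cis a"
    using cis_shift[of a "- \<lfloor>a / (2 * pi)\<rfloor>"] by simp
  then show "of_real 1 * exp (\<i> * of_real (a - 2 * pi * of_int \<lfloor>a / (2 * pi)\<rfloor>)) = cis a"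
    by (simp only: cis_conv_exp of_real_1 mult_1)
  show "0 \<le> a - 2 * pi * of_int \<lfloor>a / (2 * pi)\<rfloor>" "a - 2 * pi * of_int \<lfloor>a / (2 * pi)\<rfloor> < 2 * pi"
    using floor_divide_lower[of "2 * pi" a] floor_divide_upper[of "2 * pi" a]
    by (simp_all add: algebra_simps)
qed simp

lemma continuous_map_cis: "continuous_map euclideanreal circle cis"
proof -
  have "continuous_on UNIV (\<lambda>a. cis a)"
    unfolding cis_conv_exp by (intro continuous_intros)
  then show ?thesis by (auto simp: continuous_map_in_subtopology)
qed

locale cylinder_pair = eilenberg_maclane G T x0 phi + cylinder T \<gamma>
  for G :: "('g, 'd) monoid_scheme" (structure) and T :: "'x topology" and x0 :: 'x
    and phi :: "(real \<Rightarrow> 'x) set \<Rightarrow> 'g" and \<gamma> :: "complex \<Rightarrow> 'x" +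
  fixes w :: 'g
  assumes represents: "represents_class T x0 phi \<gamma> w"
    and w_infinite: "\<And>k::int. w [^] k = \<one> \<Longrightarrow> k = 0"
begin

section \<open>Labels of arcs of the circle and their monodromy\<close>

definition "\<Gamma> a = \<gamma> (cis a)"

lemma continuous_map_Gamma: "continuous_map euclideanreal T \<Gamma>"
  using continuous_map_compose[OF continuous_map_cis gamma] by (simp add: o_def \<Gamma>_def[abs_def])

lemma Gamma_shift: "\<Gamma> (a + 2 * pi * of_int k) = \<Gamma> a"
  by (simp add: \<Gamma>_def cis_shift)

definition "u a b = gT (\<lambda>t. \<Gamma> (a + t * (b - a)))"

lemma pathin_Gamma:
  assumes "continuous_on {0..1} \<theta>" "\<And>t. t \<in> {0..1} \<Longrightarrow> p t = \<Gamma> (\<theta> t)"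
  shows "pathin T p"
proof -
  have "continuous_map unit_top euclideanreal \<theta>" using assms by simp
  from continuous_map_compose[OF this continuous_map_Gamma] show ?thesis
    unfolding pathin_def by (rule continuous_map_eq) (use assms in auto)
qed

text \<open>The line is convex, so a path of angles can be straightened; the label depends on the
  two end angles only.\<close>

lemma gT_lift:
  assumes "continuous_on {0..1} \<theta>" "\<And>t. t \<in> {0..1} \<Longrightarrow> p t = \<Gamma> (\<theta> t)"
  shows "gT p = u (\<theta> 0) (\<theta> 1)"
  unfolding u_def
proof (rule gT_cong, rule path_homotopic_reparam[where C = UNIV and f = \<Gamma> and p = \<theta>
    and q = "\<lambda>t. \<theta> 0 + t * (\<theta> 1 - \<theta> 0)"])
  show "continuous_map (top_of_set UNIV) T \<Gamma>" using continuous_map_Gamma by simp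
qed (use assms in \<open>auto intro!: continuous_intros\<close>)

lemma u_closed: "u a b \<in> carrier G"
  unfolding u_def by (rule gT_closed, rule pathin_Gamma[of "\<lambda>t. a + t * (b - a)"]) (auto intro!: continuous_intros)

lemma u_mult: "u a b \<otimes> u b c = u a c"
proof -
  let ?l = "\<lambda>a b t. a + t * (b - a) :: real"
  let ?j = "path_join (?l a b) (?l b c)"
  have "pathin euclideanreal ?j"
    by (rule pathin_path_join) (auto simp: pathin_def intro!: continuous_intros)
  then have j: "continuous_on {0..1} ?j" by (simp add: pathin_def)
  have P: "pathin T (\<lambda>t. \<Gamma> (?l a b t))" "pathin T (\<lambda>t. \<Gamma> (?l b c t))"
    by (rule pathin_Gamma; auto intro!: continuous_intros)+
  have "gT (path_join (\<lambda>t. \<Gamma> (?l a b t)) (\<lambda>t. \<Gamma> (?l b c t))) = u (?j 0) (?j 1)"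
    by (rule gT_lift[OF j]) (simp add: path_join_def)
  then show ?thesis
    using gT_join[OF P] by (simp add: u_def)
qed

lemma u_shift: "u (a + 2 * pi * of_int k) (b + 2 * pi * of_int k) = u a b"
proof -
  have "\<Gamma> (a + 2 * pi * of_int k + t * (b + 2 * pi * of_int k - (a + 2 * pi * of_int k))) = \<Gamma> (a + t * (b - a))" for t
    using Gamma_shift[of "a + t * (b - a)" k] by (simp add: algebra_simps)
  then show ?thesis by (simp add: u_def)
qed

lemma w_carrier: "w \<in> carrier G"
  using represents phi_closed by (auto simp: represents_class_def)

text \<open>The free homotopy from \<open>\<gamma>\<close> to a based loop, seen as a map of the square, conjugates the
  label of \<open>\<gamma>\<close> into \<open>w\<close>.\<close>

lemma conjugator_ex: "\<exists>h \<in> carrier G. h \<otimes> u 0 (2 * pi) = w \<otimes> h"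
proof -
  obtain g where g: "is_loop T x0 g" "phi (loop_class T x0 g) = w"
    and hom: "homotopic_with (\<lambda>_. True) circle T \<gamma> (\<lambda>z. g (Arg2pi z / (2 * pi)))"
    using represents by (auto simp: represents_class_def)
  obtain k where k: "continuous_map (prod_topology unit_top circle) T k"
    and k0: "\<And>z. k (0, z) = \<gamma> z" and k1: "\<And>z. k (1, z) = g (Arg2pi z / (2 * pi))"
    using hom unfolding homotopic_with_def by blast
  let ?I = "{0..1::real} \<times> {0..1::real}"
  define K where "K = (\<lambda>x::real \<times> real. k (fst x, cis (2 * pi * snd x)))"
  have "continuous_on ?I (\<lambda>x. (fst x, cis (2 * pi * snd x)))"
    unfolding cis_conv_exp by (intro continuous_intros)
  then have "continuous_map (top_of_set ?I) (prod_topology unit_top circle) (\<lambda>x. (fst x, cis (2 * pi * snd x)))"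
    by auto
  from continuous_map_compose[OF this k] have K: "continuous_map (top_of_set ?I) T K"
    by (simp add: o_def K_def)
  have K0: "K (0, t) = \<Gamma> (0 + t * (2 * pi - 0))" for t by (simp add: K_def k0 \<Gamma>_def mult.commute)
  have K1: "K (1, t) = g t" if "t \<in> {0..1}" for t
  proof (cases "t = 1")
    case True
    \<comment> \<open>At \<open>t = 1\<close> the angle jumps back to 0, and the value is still
      right because \<open>g\<close> is closed.\<close>
    have "Arg2pi 1 = 0" using Arg2pi_cis[of 0] by simp
    then have "g (Arg2pi 1 / (2 * pi)) = g 1" using g by (simp add: is_loop_def)
    then show ?thesis using True by (simp add: K_def k1)
  next
    case False
    have "\<lfloor>t\<rfloor> = 0" using that False by (auto simp: floor_eq_iff)
    then have "Arg2pi (cis (2 * pi * t)) = 2 * pi * t" by (simp add: Arg2pi_cis)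
    then show ?thesis by (simp add: K_def k1)
  qed
  have KK: "K (s, 1) = K (s, 0)" for s by (simp add: K_def)
  let ?c = "\<lambda>s. K (s, 0)" and ?b = "\<lambda>t. \<Gamma> (0 + t * (2 * pi - 0))"
  have "continuous_map unit_top (top_of_set ?I) (\<lambda>s. (s, 0))" by (auto intro!: continuous_intros)
  from continuous_map_compose[OF this K] have c: "pathin T ?c" by (simp add: pathin_def o_def)
  have b: "pathin T ?b" by (rule pathin_Gamma[of "\<lambda>t. 0 + t * (2 * pi - 0)"]) (auto intro!: continuous_intros)
  have gp: "pathin T g" using g by (simp add: is_loop_iff)
  have bc: "?b 1 = ?c 0" using K0[of 1] KK[of 0] by simp
  have cg: "?c 1 = g 0" using K1[of 0] by simp
  \<comment> \<open>Both paths run along two sides of the square of homotopy time and angle: the one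
    goes round \<gamma> and then follows the track \<open>?c\<close> of the point 1, the other
    follows this track and then \<open>g\<close>.\<close>
  have "path_homotopic T (path_join ?b ?c) (path_join ?c g)"
  proof (rule path_homotopic_reparam[OF K, where p = "\<lambda>t. (max 0 (2 * t - 1), min 1 (2 * t))"
      and q = "\<lambda>t. (min 1 (2 * t), max 0 (2 * t - 1))"])
    show "path_join ?b ?c t = K (max 0 (2 * t - 1), min 1 (2 * t))" if t: "t \<in> {0..1}" for t
    proof (cases "t \<le> 1 / 2")
      case True
      then have "max 0 (2 * t - 1) = 0" "min 1 (2 * t) = 2 * t" by auto
      then show ?thesis using True K0[of "2 * t"] by (simp add: path_join_def)
    next
      case False
      then show ?thesis using KK[of "2 * t - 1"] by (simp add: path_join_def max_def min_def)
    qed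
    show "path_join ?c g t = K (min 1 (2 * t), max 0 (2 * t - 1))" if t: "t \<in> {0..1}" for t
    proof (cases "t \<le> 1 / 2")
      case True
      then have "max 0 (2 * t - 1) = 0" "min 1 (2 * t) = 2 * t" by auto
      then show ?thesis using True by (simp add: path_join_def)
    next
      case False
      then show ?thesis using t K1[of "2 * t - 1"] by (simp add: path_join_def max_def min_def)
    qed
  qed (auto intro!: continuous_intros convex_Times)
  from gT_cong[OF this] have eq: "u 0 (2 * pi) \<otimes> gT ?c = gT ?c \<otimes> w"
    using gT_join[OF b c bc] gT_join[OF c gp cg] gT_loop[OF g(1)] g(2) by (simp add: u_def)
  note cc = gT_closed[OF c]
  \<comment> \<open>The conjugator is the inverse label of the track of the point 1 under the free
    homotopy.\<close>
  have "inv gT ?c \<otimes> u 0 (2 * pi) = inv gT ?c \<otimes> (u 0 (2 * pi) \<otimes> gT ?c) \<otimes> inv gT ?c"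
    using cc u_closed by (simp add: m_assoc)
  also have "\<dots> = w \<otimes> inv gT ?c"
    unfolding eq using cc w_carrier by (simp flip: m_assoc)
  finally show ?thesis using cc by blast
qed

definition "w0 = (SOME h. h \<in> carrier G \<and> h \<otimes> u 0 (2 * pi) = w \<otimes> h)"

lemma w0: "w0 \<in> carrier G" "w0 \<otimes> u 0 (2 * pi) = w \<otimes> w0"
  using someI_ex[of "\<lambda>h. h \<in> carrier G \<and> h \<otimes> u 0 (2 * pi) = w \<otimes> h"] conjugator_ex
  unfolding w0_def by blast+

text \<open>Chosen so that arcs telescope, \<open>mt_mult\<close>, while a full turn multiplies by
  \<open>w\<close> on the left, \<open>mt_step\<close>; the factor \<open>w0\<close> conjugates the
  label of \<gamma> into \<open>w\<close>.\<close>

definition "mt a = w0 \<otimes> u 0 a"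

lemma mt_closed: "mt a \<in> carrier G"
  by (simp add: mt_def w0 u_closed)

lemma mt_mult: "mt a \<otimes> u a b = mt b"
  using u_mult[of 0 a b] by (simp add: mt_def m_assoc w0 u_closed)

lemma mt_step: "mt (a + 2 * pi) = w \<otimes> mt a"
proof -
  have "mt (a + 2 * pi) = w0 \<otimes> (u 0 (2 * pi) \<otimes> u (2 * pi) (a + 2 * pi))"
    by (simp add: mt_def u_mult)
  also have "u (2 * pi) (a + 2 * pi) = u 0 a" using u_shift[of 0 1 a] by simp
  also have "w0 \<otimes> (u 0 (2 * pi) \<otimes> u 0 a) = (w0 \<otimes> u 0 (2 * pi)) \<otimes> u 0 a"
    by (simp add: m_assoc w0(1) u_closed)
  also have "\<dots> = w \<otimes> mt a"
    unfolding w0(2) by (simp add: mt_def m_assoc w0(1) u_closed w_carrier)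
  finally show ?thesis .
qed

lemma mt_shift: "mt (a + 2 * pi * of_int k) = w [^] k \<otimes> mt a"
proof (induction k rule: int_induct[of _ 0])
  case base
  show ?case by (simp add: mt_closed)
next
  case (step1 k)
  have "mt (a + 2 * pi * of_int (k + 1)) = w \<otimes> mt (a + 2 * pi * of_int k)"
    using mt_step[of "a + 2 * pi * of_int k"] by (simp add: algebra_simps)
  also have "\<dots> = (w \<otimes> w [^] k) \<otimes> mt a"
    using step1 by (simp add: m_assoc w_carrier mt_closed)
  also have "w \<otimes> w [^] k = w [^] (k + 1)"
    using int_pow_mult[OF w_carrier, of 1 k] w_carrier by (simp add: add.commute)
  finally show ?case .
next
  case (step2 k)
  have "w \<otimes> mt (a + 2 * pi * of_int (k - 1)) = w [^] k \<otimes> mt a"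
    using mt_step[of "a + 2 * pi * of_int (k - 1)"] step2 by (simp add: algebra_simps)
  also have "w [^] k = w \<otimes> w [^] (k - 1)"
    using int_pow_mult[OF w_carrier, of 1 "k - 1"] w_carrier by simp
  finally have "w \<otimes> mt (a + 2 * pi * of_int (k - 1)) = w \<otimes> (w [^] (k - 1) \<otimes> mt a)"
    by (simp add: m_assoc w_carrier mt_closed)
  then show ?case by (simp add: w_carrier mt_closed)
qed

definition kk :: "real \<Rightarrow> int" where "kk a = \<lfloor>a / (2 * pi)\<rfloor>"

lemma kk_shift: "kk (a + 2 * pi * of_int k) = kk a + k"
  by (simp add: kk_def add_divide_distrib)

text \<open>The twist of the labels at a point: \<open>mt\<close> of the angle in the range of
  \<open>Arg2pi\<close> on the end circle, trivial elsewhere. It corresponds to another choice of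
  path to the base point.\<close>

definition mg :: "'x + complex \<times> real \<Rightarrow> 'g" where
  "mg p = (case p of Inl x \<Rightarrow> \<one> | Inr (z, t) \<Rightarrow> if t = 1 then mt (Arg2pi z) else \<one>)"

lemma mg_closed: "mg p \<in> carrier G"
  by (auto simp: mg_def mt_closed split: sum.splits)

text \<open>An arbitrary angle exceeds the one given by \<open>Arg2pi\<close> by \<open>kk a\<close>
  full turns, each contributing a factor \<open>w\<close>.\<close>

lemma mg_end: "mg (Inr (cis a, 1)) = inv (w [^] kk a) \<otimes> mt a"
proof -
  have "mt a = w [^] kk a \<otimes> mg (Inr (cis a, 1))"
    using mt_shift[of "a - 2 * pi * of_int (kk a)" "kk a"] by (simp add: mg_def Arg2pi_cis kk_def)
  then show ?thesis
    using inv_solve_left[OF mg_closed[of "Inr (cis a, 1)"] int_pow_closed[OF w_carrier] mt_closed] by blast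
qed

definition "gv \<sigma> = mg (edge_path \<sigma> 0) \<otimes> gT (edge_path (simplex_map 1 \<rho> \<sigma>)) \<otimes> inv mg (edge_path \<sigma> 1)"

lemma rho_simplex: "singular_simplex p M \<sigma> \<Longrightarrow> singular_simplex p T (simplex_map p \<rho> \<sigma>)"
  by (rule singular_simplex_simplex_map[OF _ continuous_map_rho])

lemma gT_rho_closed: "singular_simplex 1 M \<sigma> \<Longrightarrow> gT (edge_path (simplex_map 1 \<rho> \<sigma>)) \<in> carrier G"
  by (rule gT_closed, rule pathin_edge_path, rule rho_simplex)

lemma gv_closed: "singular_simplex 1 M \<sigma> \<Longrightarrow> gv \<sigma> \<in> carrier G"
  unfolding gv_def by (intro m_closed inv_closed mg_closed gT_rho_closed)

text \<open>The twists at the shared vertex cancel and those at the outer ends agree on both sides,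
  so the twist does not affect which triangles of labels are compatible.\<close>

lemma gv_mult_iff:
  assumes S: "singular_simplex 1 M \<alpha>" "singular_simplex 1 M \<beta>" "singular_simplex 1 M \<delta>"
    and E: "edge_src \<alpha> = edge_src \<delta>" "edge_tgt \<alpha> = edge_src \<beta>" "edge_tgt \<beta> = edge_tgt \<delta>"
  shows "gv \<alpha> \<otimes> gv \<beta> = gv \<delta> \<longleftrightarrow> gT (edge_path (simplex_map 1 \<rho> \<alpha>)) \<otimes> gT (edge_path (simplex_map 1 \<rho> \<beta>))
     = gT (edge_path (simplex_map 1 \<rho> \<delta>))"
proof -
  define a b d where "a = gT (edge_path (simplex_map 1 \<rho> \<alpha>))" and "b = gT (edge_path (simplex_map 1 \<rho> \<beta>))"
    and "d = gT (edge_path (simplex_map 1 \<rho> \<delta>))"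
  define p q r where "p = mg (edge_path \<alpha> 0)" and "q = mg (edge_path \<beta> 0)" and "r = mg (edge_path \<beta> 1)"
  have ends: "edge_path \<delta> 0 = edge_path \<alpha> 0" "edge_path \<alpha> 1 = edge_path \<beta> 0" "edge_path \<delta> 1 = edge_path \<beta> 1"
    using E by (simp_all add: edge_src_eq edge_tgt_eq)
  have cl: "a \<in> carrier G" "b \<in> carrier G" "d \<in> carrier G" "p \<in> carrier G" "q \<in> carrier G" "r \<in> carrier G"
    using gT_rho_closed[OF S(1)] gT_rho_closed[OF S(2)] gT_rho_closed[OF S(3)]
    by (simp_all add: a_def b_def d_def p_def q_def r_def mg_closed)
  have gs: "gv \<alpha> = p \<otimes> a \<otimes> inv q" "gv \<beta> = q \<otimes> b \<otimes> inv r" "gv \<delta> = p \<otimes> d \<otimes> inv r"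
    by (simp_all add: gv_def ends a_def b_def d_def p_def q_def r_def)
  have "inv q \<otimes> (q \<otimes> (b \<otimes> inv r)) = b \<otimes> inv r"
    using cl by (simp flip: m_assoc)
  then have "gv \<alpha> \<otimes> gv \<beta> = p \<otimes> (a \<otimes> b) \<otimes> inv r"
    unfolding gs using cl by (simp add: m_assoc)
  then show ?thesis
    unfolding gs(3) a_def[symmetric] b_def[symmetric] d_def[symmetric]
    using cl by simp
qed

lemma gv_tri:
  assumes "singular_simplex 2 M \<tau>"
  shows "gv (tri_01 \<tau>) \<otimes> gv (tri_12 \<tau>) = gv (tri_02 \<tau>)"
  using gT_tri[OF rho_simplex[OF assms]] singular_simplex_tri[OF assms]
  by (subst gv_mult_iff) (simp_all add: edge_simps tri_simplex_map del: One_nat_def)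

lemma gv_path:
  assumes "pathin M p"
  shows "gv (path_edge p) = mg (p 0) \<otimes> gT (\<rho> \<circ> p) \<otimes> inv mg (p 1)"
proof -
  have "gT (edge_path (simplex_map 1 \<rho> (path_edge p))) = gT (\<rho> \<circ> p)"
    by (rule gT_eq[OF pathin_edge_path[OF rho_simplex[OF singular_simplex_path_edge[OF assms]]]])
      (simp add: edge_path_simplex_map edge_path_path_edge del: One_nat_def)
  then show ?thesis by (simp add: gv_def edge_path_path_edge)
qed

section \<open>Realising edges, triangles and tetrahedra in the cylinder\<close>

lemma gT_const: assumes "x \<in> topspace T" shows "gT (\<lambda>_. x) = \<one>"
proof -
  have p: "pathin T (\<lambda>_. x)" using assms by (simp add: pathin_def)
  have "path_join (\<lambda>_. x) (\<lambda>_. x) = (\<lambda>_. x)" by (simp add: path_join_def)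
  then have "gT (\<lambda>_. x) \<otimes> gT (\<lambda>_. x) = gT (\<lambda>_. x)" using gT_join[OF p p] by simp
  then show ?thesis using gT_closed[OF p] by simp
qed

lemma edge_ex:
  assumes "singular_simplex 0 M x" "singular_simplex 0 M y" "g \<in> carrier G"
  shows "\<exists>\<sigma>. singular_simplex 1 M \<sigma> \<and> edge_src \<sigma> = x \<and> edge_tgt \<sigma> = y \<and> gv \<sigma> = g"
proof -
  obtain a b where ab: "a \<in> topspace M" "x = pt_simplex a" "b \<in> topspace M" "y = pt_simplex b"
    using assms by (auto simp: singular_simplex_0)
  have rt: "\<rho> a \<in> topspace T" "\<rho> b \<in> topspace T"
    using continuous_map_rho ab by (auto simp: continuous_map_def Pi_iff)
  \<comment> \<open>The label wanted in \<open>X\<close> is \<open>g\<close> with the twists at both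
    ends undone. The edge descends from \<open>a\<close> along \<open>H\<close>, follows
    \<open>c\<close> and climbs back to \<open>b\<close>; the vertical parts collapse to constants
    under \<rho>.\<close>
  obtain c where c: "pathin T c" "c 0 = \<rho> a" "c 1 = \<rho> b" "gT c = inv mg a \<otimes> g \<otimes> mg b"
    using gT_surj[OF rt m_closed[OF m_closed[OF inv_closed[OF mg_closed] assms(3)] mg_closed]] by blast
  have hp: "pathin M (\<lambda>s. H (s, p))" if "p \<in> topspace M" for p
  proof -
    have "continuous_map unit_top (prod_topology unit_top M) (\<lambda>s. (s, p))"
      using that by (simp add: continuous_map_pairedI)
    from continuous_map_compose[OF this continuous_map_H] show ?thesis by (simp add: pathin_def o_def)
  qed
  have ic: "pathin M (Inl \<circ> c)"
    using continuous_map_compose[OF c(1)[unfolded pathin_def] continuous_map_Inl_M] by (simp add: pathin_def)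
  let ?r = "path_rev (\<lambda>s. H (s, b))"
  let ?p = "path_join (\<lambda>s. H (s, a)) (path_join (Inl \<circ> c) ?r)"
  have p: "pathin M ?p" "?p 0 = a" "?p 1 = b"
    using ab hp c by (auto intro!: pathin_path_join pathin_path_rev ic simp: H_0 H_1)
  have "\<rho> \<circ> ?p = path_join (\<lambda>_. \<rho> a) (path_join c (\<lambda>_. \<rho> b))"
    by (auto simp: path_join_def path_rev_def rho_H fun_eq_iff)
  moreover have "gT (path_join (\<lambda>_. \<rho> a) (path_join c (\<lambda>_. \<rho> b))) = gT (\<lambda>_. \<rho> a) \<otimes> (gT c \<otimes> gT (\<lambda>_. \<rho> b))"
  proof -
    have P: "pathin T (\<lambda>_. \<rho> a)" "pathin T (\<lambda>_. \<rho> b)" using rt by (simp_all add: pathin_def)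
    show ?thesis
      using gT_join[OF P(1) pathin_path_join[OF c(1) P(2)]] gT_join[OF c(1) P(2)] c(2,3) by simp
  qed
  ultimately have "gT (\<rho> \<circ> ?p) = inv mg a \<otimes> g \<otimes> mg b"
    using rt c assms mg_closed by (simp add: gT_const)
  then have "gv (path_edge ?p) = mg a \<otimes> (inv mg a \<otimes> g \<otimes> mg b) \<otimes> inv mg b"
    using gv_path[OF p(1)] p(2,3) by simp
  also have "\<dots> = (mg a \<otimes> inv mg a) \<otimes> g \<otimes> (mg b \<otimes> inv mg b)"
    using assms(3) mg_closed by (simp only: m_assoc m_closed inv_closed)
  also have "\<dots> = g" using assms(3) mg_closed by simp
  finally have "gv (path_edge ?p) = g" .
  then show ?thesis
    using singular_simplex_path_edge[OF p(1)] p ab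
    by (intro exI[of _ "path_edge ?p"]) (simp add: edge_src_eq edge_tgt_eq edge_path_path_edge)
qed

text \<open>The labels provide a filling \<tau> of the collapsed triangle in \<open>X\<close>. This
  shows that the collapsed boundary is null-homotopic, hence so is the boundary in the cylinder, and
  it can be filled there with the given edges.\<close>

lemma tri_ex:
  assumes S: "singular_simplex 1 M \<alpha>" "singular_simplex 1 M \<beta>" "singular_simplex 1 M \<delta>"
    and E: "edge_src \<alpha> = edge_src \<delta>" "edge_tgt \<alpha> = edge_src \<beta>" "edge_tgt \<beta> = edge_tgt \<delta>"
    and g: "gv \<alpha> \<otimes> gv \<beta> = gv \<delta>"
  shows "\<exists>\<tau>. singular_simplex 2 M \<tau> \<and> tri_01 \<tau> = \<alpha> \<and> tri_12 \<tau> = \<beta> \<and> tri_02 \<tau> = \<delta>"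
proof -
  have ends: "edge_path \<delta> 0 = edge_path \<alpha> 0" "edge_path \<alpha> 1 = edge_path \<beta> 0" "edge_path \<delta> 1 = edge_path \<beta> 1"
    using E by (simp_all add: edge_src_eq edge_tgt_eq)
  obtain \<tau> where \<tau>: "singular_simplex 2 T \<tau>" "tri_01 \<tau> = simplex_map 1 \<rho> \<alpha>"
      "tri_12 \<tau> = simplex_map 1 \<rho> \<beta>" "tri_02 \<tau> = simplex_map 1 \<rho> \<delta>"
    using gT_fill[OF rho_simplex[OF S(1)] rho_simplex[OF S(2)] rho_simplex[OF S(3)]]
      g[unfolded gv_mult_iff[OF S E]] ends
    by (auto simp: edge_src_eq edge_tgt_eq edge_path_simplex_map simp del: One_nat_def)
  define f where "f = (\<lambda>i::nat. if i = 0 then \<beta> else if i = 1 then \<delta> else \<alpha>)"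
  have ft: "singular_face 2 i \<tau> = simplex_map 1 \<rho> (f i)" if "i \<le> 2" for i
  proof -
    have "i = 0 \<or> i = 1 \<or> i = 2" using that by auto
    then show ?thesis using \<tau> by (auto simp: f_def tri_01_def tri_02_def tri_12_def)
  qed
  have "\<exists>\<sigma>. singular_simplex (Suc (Suc 0)) M \<sigma> \<and> (\<forall>i\<le>Suc (Suc 0). singular_face (Suc (Suc 0)) i \<sigma> = f i)"
  proof (rule simplex_fill)
    show "singular_simplex (Suc 0) M (f i)" for i using S by (simp add: f_def)
    show "singular_face (Suc 0) i (f (Suc j)) = singular_face (Suc 0) j (f i)" if "i \<le> j" "j \<le> Suc 0" for i j
    proof -
      have "(i = 0 \<and> j = 0) \<or> (i = 0 \<and> j = 1) \<or> (i = 1 \<and> j = 1)" using that by auto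
      then show ?thesis using E by (auto simp: f_def edge_src_def edge_tgt_def)
    qed
    fix h assume h: "continuous_map (top_of_set (simplex_boundary (Suc (Suc 0)))) M h"
      and hf: "\<And>i x. \<lbrakk>i \<le> Suc (Suc 0); x \<in> standard_simplex (Suc 0)\<rbrakk> \<Longrightarrow> h (simplical_face i x) = f i x"
    have "continuous_map (top_of_set (standard_simplex (Suc (Suc 0)))) T \<tau>"
      using \<tau>(1) unfolding singular_simplex_def top_of_set_fun by (simp add: numeral_2_eq_2)
    then obtain c where c: "homotopic_with (\<lambda>_. True) (top_of_set (simplex_boundary (Suc (Suc 0)))) T \<tau> (\<lambda>_. c)"
      using nullhomotopic_extension by blast
    \<comment> \<open>Each boundary point lies on a face, and there both sides are the collapsed
      edge opposite vertex \<open>i\<close>.\<close>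
    have "(\<rho> \<circ> h) x = \<tau> x" if x: "x \<in> simplex_boundary (Suc (Suc 0))" for x
    proof -
      obtain i where i: "i \<le> Suc (Suc 0)" "x i = 0" and xs: "x \<in> standard_simplex (Suc (Suc 0))"
        using x by (auto simp: simplex_boundary_def)
      let ?y = "drop_coord i x"
      have y: "?y \<in> standard_simplex (Suc 0)" by (rule drop_coord_in_simplex[OF xs i])
      have "(\<rho> \<circ> h) x = \<rho> (f i ?y)"
        using hf[OF i(1) y] face_drop_coord[of x i, OF i(2)] by simp
      also have "\<dots> = singular_face 2 i \<tau> ?y"
        using ft[of i] i y by (simp add: simplex_map_def)
      also have "\<dots> = \<tau> x"
        using y face_drop_coord[of x i, OF i(2)] by (simp add: singular_face_def)
      finally show ?thesis .
    qed
    then have "homotopic_with (\<lambda>_. True) (top_of_set (simplex_boundary (Suc (Suc 0)))) T (\<rho> \<circ> h) \<tau>"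
      using continuous_map_compose[OF h continuous_map_rho] by (intro homotopic_with_equal) auto
    from cyl_null[OF h homotopic_with_trans[OF this c]]
    show "\<exists>c. homotopic_with (\<lambda>_. True) (top_of_set (simplex_boundary (Suc (Suc 0)))) M h (\<lambda>_. c)" .
  qed
  then obtain \<sigma> where "singular_simplex 2 M \<sigma>" "\<And>i. i \<le> 2 \<Longrightarrow> singular_face 2 i \<sigma> = f i"
    by (auto simp: numeral_2_eq_2)
  then show ?thesis
    by (intro exI[of _ \<sigma>]) (simp add: tri_01_def tri_02_def tri_12_def f_def)
qed

lemma tetra_ex:
  assumes S: "singular_simplex 2 M a" "singular_simplex 2 M b" "singular_simplex 2 M c" "singular_simplex 2 M d"
    and E: "tri_01 a = tri_01 b" "tri_02 a = tri_01 c" "tri_02 b = tri_02 c"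
      "tri_12 a = tri_01 d" "tri_12 b = tri_02 d" "tri_12 c = tri_12 d"
  shows "\<exists>\<theta>. singular_simplex 3 M \<theta> \<and> singular_face 3 3 \<theta> = a \<and> singular_face 3 2 \<theta> = b \<and>
             singular_face 3 1 \<theta> = c \<and> singular_face 3 0 \<theta> = d"
proof -
  define f where "f = (\<lambda>i::nat. if i = 0 then d else if i = 1 then c else if i = 2 then b else a)"
  have "\<exists>\<sigma>. singular_simplex (Suc (Suc 1)) M \<sigma> \<and> (\<forall>i\<le>Suc (Suc 1). singular_face (Suc (Suc 1)) i \<sigma> = f i)"
  proof (rule simplex_fill)
    show "singular_simplex (Suc 1) M (f i)" for i using S by (simp add: f_def numeral_2_eq_2)
    show "singular_face (Suc 1) i (f (Suc j)) = singular_face (Suc 1) j (f i)" if "i \<le> j" "j \<le> Suc 1" for i j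
    proof -
      have "(i = 0 \<and> j = 0) \<or> (i = 0 \<and> j = 1) \<or> (i = 0 \<and> j = 2) \<or> (i = 1 \<and> j = 1) \<or> (i = 1 \<and> j = 2) \<or> (i = 2 \<and> j = 2)"
        using that by auto
      then show ?thesis using E by (auto simp: f_def tri_01_def tri_02_def tri_12_def numeral_2_eq_2)
    qed
    fix h assume h: "continuous_map (top_of_set (simplex_boundary (Suc (Suc 1)))) M h"
    obtain c where "homotopic_with (\<lambda>_. True) (top_of_set (simplex_boundary (Suc (Suc 1)))) T (\<rho> \<circ> h) (\<lambda>_. c)"
      using aspherical_boundary_null[OF asph _ continuous_map_compose[OF h continuous_map_rho]] by auto
    from cyl_null[OF h this]
    show "\<exists>c. homotopic_with (\<lambda>_. True) (top_of_set (simplex_boundary (Suc (Suc 1)))) M h (\<lambda>_. c)" .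
  qed
  then obtain \<sigma> where "singular_simplex 3 M \<sigma>" "\<And>i. i \<le> 3 \<Longrightarrow> singular_face 3 i \<sigma> = f i"
    by (auto simp: numeral_3_eq_3)
  then show ?thesis
    by (intro exI[of _ \<sigma>]) (simp add: f_def)
qed

section \<open>Edges and triangles in the end circle, through lifts to the line of angles\<close>

lemma lift_ex:
  assumes "singular_simplex 1 (subtopology M A) \<sigma>"
  shows "\<exists>\<theta>. continuous_on {0..1} \<theta> \<and> (\<forall>t\<in>{0..1}. edge_path \<sigma> t = Inr (cis (\<theta> t), 1))"
proof -
  let ?z = "\<lambda>t. end_proj (edge_path \<sigma> t)"
  have p: "pathin (subtopology M A) (edge_path \<sigma>)" by (rule pathin_edge_path[OF assms])
  have "continuous_map unit_top circle (end_proj \<circ> edge_path \<sigma>)"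
    using p continuous_map_end_proj unfolding pathin_def by (rule continuous_map_compose)
  then have zc: "continuous_on {0..1} ?z" by (simp add: o_def)
  have e: "edge_path \<sigma> t = Inr (?z t, 1)" "norm (?z t) = 1" if "t \<in> {0..1}" for t
  proof -
    have "edge_path \<sigma> t \<in> A" using p that by (auto simp: pathin_def continuous_map_def Pi_iff)
    from A_end[OF this] show "edge_path \<sigma> t = Inr (?z t, 1)" "norm (?z t) = 1" by auto
  qed
  have "?z t \<noteq> 0" if "t \<in> {0..1}" for t using e(2)[OF that] by auto
  \<comment> \<open>A continuous logarithm exists on the contractible interval; since the values
    have modulus 1, its imaginary part is the angle.\<close>
  then obtain g where g: "continuous_on {0..1} g" "\<And>t. t \<in> {0..1} \<Longrightarrow> ?z t = exp (g t)"
    using continuous_logarithm_on_contractible[OF zc convex_imp_contractible] by auto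
  have "?z t = cis (Im (g t))" if "t \<in> {0..1}" for t
  proof -
    have "Re (g t) = 0" using e(2)[OF that] g(2)[OF that] by (simp add: norm_exp_eq_Re)
    then show ?thesis using g(2)[OF that] by (simp add: exp_eq_polar)
  qed
  moreover have "continuous_on {0..1} (\<lambda>t. Im (g t))" using g(1) by (intro continuous_intros)
  ultimately show ?thesis using e(1) by metis
qed

lemma lift_at:
  assumes "singular_simplex 1 (subtopology M A) \<sigma>" "edge_path \<sigma> 0 = Inr (cis a, 1)"
  shows "\<exists>\<theta>. continuous_on {0..1} \<theta> \<and> (\<forall>t\<in>{0..1}. edge_path \<sigma> t = Inr (cis (\<theta> t), 1)) \<and> \<theta> 0 = a"
proof -
  obtain \<theta> where \<theta>: "continuous_on {0..1} \<theta>" "\<And>t. t \<in> {0..1} \<Longrightarrow> edge_path \<sigma> t = Inr (cis (\<theta> t), 1)"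
    using lift_ex[OF assms(1)] by blast
  then have "cis a = cis (\<theta> 0)" using assms(2) by auto
  then obtain k :: int where k: "a = \<theta> 0 + 2 * pi * of_int k" using cis_eqD by blast
  show ?thesis
    by (rule exI[of _ "\<lambda>t. \<theta> t + 2 * pi * of_int k"]) (use \<theta> in \<open>auto simp: cis_shift k intro!: continuous_intros\<close>)
qed

text \<open>The factors \<open>mt\<close> at the two ends cancel against the label of the arc,
  leaving the difference of the numbers of completed turns.\<close>

lemma gv_lift:
  assumes \<theta>: "continuous_on {0..1} \<theta>" and e: "\<And>t. t \<in> {0..1} \<Longrightarrow> edge_path \<sigma> t = Inr (cis (\<theta> t), 1)"
  shows "gv \<sigma> = w [^] (kk (\<theta> 1) - kk (\<theta> 0))"
proof -
  have "gT (edge_path (simplex_map 1 \<rho> \<sigma>)) = u (\<theta> 0) (\<theta> 1)"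
    by (rule gT_lift[OF \<theta>]) (simp add: edge_path_simplex_map e \<Gamma>_def del: One_nat_def)
  then have "gv \<sigma> = (inv (w [^] kk (\<theta> 0)) \<otimes> mt (\<theta> 0)) \<otimes> u (\<theta> 0) (\<theta> 1) \<otimes> inv (inv (w [^] kk (\<theta> 1)) \<otimes> mt (\<theta> 1))"
    by (simp add: gv_def e mg_end)
  also have "(inv (w [^] kk (\<theta> 0)) \<otimes> mt (\<theta> 0)) \<otimes> u (\<theta> 0) (\<theta> 1) = inv (w [^] kk (\<theta> 0)) \<otimes> mt (\<theta> 1)"
    using w_carrier by (simp add: m_assoc mt_closed u_closed mt_mult)
  also have "inv (w [^] kk (\<theta> 0)) \<otimes> mt (\<theta> 1) \<otimes> inv (inv (w [^] kk (\<theta> 1)) \<otimes> mt (\<theta> 1)) =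
      inv (w [^] kk (\<theta> 0)) \<otimes> (mt (\<theta> 1) \<otimes> inv mt (\<theta> 1)) \<otimes> w [^] kk (\<theta> 1)"
    using w_carrier mt_closed by (simp only: inv_mult_group inv_inv m_assoc m_closed inv_closed int_pow_closed)
  also have "\<dots> = w [^] (- kk (\<theta> 0) + kk (\<theta> 1))"
    using w_carrier mt_closed int_pow_mult[OF w_carrier, of "- kk (\<theta> 0)" "kk (\<theta> 1)"] by (simp add: int_pow_neg)
  finally show ?thesis by (simp add: add.commute)
qed

lemma gv_sub: "singular_simplex 1 (subtopology M A) \<sigma> \<Longrightarrow> \<exists>k::int. gv \<sigma> = w [^] k"
  using lift_ex gv_lift by meson

lemma continuous_map_cis_end: "continuous_map euclideanreal (subtopology M A) (\<lambda>a. Inr (cis a, 1))"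
  using continuous_map_compose[OF continuous_map_cis continuous_map_end] by (simp add: o_def)

lemma point_in_end: "p \<in> A \<Longrightarrow> \<exists>a. p = Inr (cis a, 1)"
proof -
  assume "p \<in> A"
  then have "p = Inr (end_proj p, 1)" "norm (end_proj p) = 1" using A_end by auto
  moreover have "cis (Arg2pi (end_proj p)) = end_proj p"
    using Arg2pi_eq[of "end_proj p"] calculation(2) by (simp add: cis_conv_exp)
  ultimately show ?thesis by metis
qed

lemma edge_sub:
  assumes "singular_simplex 0 (subtopology M A) x" "singular_simplex 0 (subtopology M A) y"
  shows "\<exists>\<sigma>. singular_simplex 1 (subtopology M A) \<sigma> \<and> edge_src \<sigma> = x \<and> edge_tgt \<sigma> = y \<and> gv \<sigma> = w [^] (k::int)"
proof -
  obtain a b where ab: "x = pt_simplex (Inr (cis a, 1))" "y = pt_simplex (Inr (cis b, 1))"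
    using assms point_in_end by (fastforce simp: singular_simplex_0)
  \<comment> \<open>Enough turns are added that the target angle has completed exactly
    \<open>k\<close> more of them than \<open>a\<close>.\<close>
  define b' where "b' = b + 2 * pi * of_int (k + kk a - kk b)"
  define \<theta> where "\<theta> t = a + t * (b' - a)" for t
  have \<theta>: "continuous_on {0..1} \<theta>" unfolding \<theta>_def by (intro continuous_intros)
  let ?p = "\<lambda>t. Inr (cis (\<theta> t), 1) :: 'x + complex \<times> real"
  have "continuous_map unit_top euclideanreal \<theta>" using \<theta> by simp
  from continuous_map_compose[OF this continuous_map_cis_end]
  have p: "pathin (subtopology M A) ?p" by (simp add: pathin_def o_def)
  have "gv (path_edge ?p) = w [^] (kk (\<theta> 1) - kk (\<theta> 0))"
    by (rule gv_lift[OF \<theta>]) (rule edge_path_path_edge)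
  also have "kk (\<theta> 1) - kk (\<theta> 0) = k" using kk_shift[of b "k + kk a - kk b"] by (simp add: \<theta>_def b'_def)
  finally have "gv (path_edge ?p) = w [^] k" .
  moreover have "cis (\<theta> 0) = cis a" "cis (\<theta> 1) = cis b"
    using cis_shift[of b "k + kk a - kk b"] by (simp_all add: \<theta>_def b'_def)
  ultimately show ?thesis
    using singular_simplex_path_edge[OF p] ab
    by (intro exI[of _ "path_edge ?p"]) (simp add: edge_src_eq edge_tgt_eq edge_path_path_edge)
qed

text \<open>The sides are lifted to the line, each lift starting where it must. Since
  \<open>w\<close> has infinite order, equal labels force equal numbers of turns, so both lifts
  around the triangle end at the same real number, and convexity of the line gives the homotopy
  inside the circle.\<close>

lemma tri_sub:
  assumes S: "singular_simplex 1 (subtopology M A) \<alpha>" "singular_simplex 1 (subtopology M A) \<beta>"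
      "singular_simplex 1 (subtopology M A) \<delta>"
    and E: "edge_src \<alpha> = edge_src \<delta>" "edge_tgt \<alpha> = edge_src \<beta>" "edge_tgt \<beta> = edge_tgt \<delta>"
    and g: "gv \<alpha> \<otimes> gv \<beta> = gv \<delta>"
  shows "\<exists>\<tau>. singular_simplex 2 (subtopology M A) \<tau> \<and> tri_01 \<tau> = \<alpha> \<and> tri_12 \<tau> = \<beta> \<and> tri_02 \<tau> = \<delta>"
proof -
  have ends: "edge_path \<delta> 0 = edge_path \<alpha> 0" "edge_path \<beta> 0 = edge_path \<alpha> 1" "edge_path \<delta> 1 = edge_path \<beta> 1"
    using E by (simp_all add: edge_src_eq edge_tgt_eq)
  obtain ta where ta: "continuous_on {0..1} ta" "\<And>t. t \<in> {0..1} \<Longrightarrow> edge_path \<alpha> t = Inr (cis (ta t), 1)"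
    using lift_ex[OF S(1)] by blast
  have "edge_path \<beta> 0 = Inr (cis (ta 1), 1)" using ends ta(2)[of 1] by simp
  then obtain tb where tb: "continuous_on {0..1} tb" "\<And>t. t \<in> {0..1} \<Longrightarrow> edge_path \<beta> t = Inr (cis (tb t), 1)" "tb 0 = ta 1"
    using lift_at[OF S(2)] by blast
  have "edge_path \<delta> 0 = Inr (cis (ta 0), 1)" using ends ta(2)[of 0] by simp
  then obtain td where td: "continuous_on {0..1} td" "\<And>t. t \<in> {0..1} \<Longrightarrow> edge_path \<delta> t = Inr (cis (td t), 1)" "td 0 = ta 0"
    using lift_at[OF S(3)] by blast
  have "w [^] (kk (ta 1) - kk (ta 0)) \<otimes> w [^] (kk (tb 1) - kk (tb 0)) = w [^] (kk (td 1) - kk (td 0))"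
    using g gv_lift[OF ta] gv_lift[OF tb(1,2)] gv_lift[OF td(1,2)] by simp
  then have "w [^] (kk (tb 1) - kk (ta 0)) = w [^] (kk (td 1) - kk (ta 0))"
    using int_pow_mult[OF w_carrier, of "kk (ta 1) - kk (ta 0)" "kk (tb 1) - kk (tb 0)"] tb(3) td(3) by simp
  then have "w [^] ((kk (tb 1) - kk (ta 0)) - (kk (td 1) - kk (ta 0))) = \<one>"
    using int_pow_diff[OF w_carrier, of "kk (tb 1) - kk (ta 0)" "kk (td 1) - kk (ta 0)"] w_carrier by simp
  from w_infinite[OF this] have kk: "kk (tb 1) = kk (td 1)" by simp
  have "cis (tb 1) = cis (td 1)" using ends tb(2)[of 1] td(2)[of 1] by simp
  then obtain j :: int where j: "tb 1 = td 1 + 2 * pi * of_int j" using cis_eqD by blast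
  \<comment> \<open>Angles over one point differ by whole turns, and \<open>kk\<close> counts
    them.\<close>
  then have "j = 0" using kk kk_shift[of "td 1" j] by simp
  then have e1: "tb 1 = td 1" using j by simp
  have "pathin euclideanreal (path_join ta tb)"
    by (rule pathin_path_join) (use ta tb in \<open>auto simp: pathin_def\<close>)
  then have jc: "continuous_on {0..1} (path_join ta tb)" by (simp add: pathin_def)
  show ?thesis
  proof (rule path_homotopic_tri[OF S])
    show "path_homotopic (subtopology M A) (path_join (edge_path \<alpha>) (edge_path \<beta>)) (edge_path \<delta>)"
    proof (rule path_homotopic_reparam[where C = UNIV and f = "\<lambda>a. Inr (cis a, 1)" and p = "path_join ta tb" and q = td])
      show "continuous_map (top_of_set UNIV) (subtopology M A) (\<lambda>a. Inr (cis a, 1))"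
        using continuous_map_cis_end by simp
      show "path_join (edge_path \<alpha>) (edge_path \<beta>) t = Inr (cis (path_join ta tb t), 1)" if "t \<in> {0..1}" for t
        using that by (simp add: path_join_def ta tb)
    qed (use jc td e1 in auto)
  qed (use ends in simp)
qed

lemma point_sub: "\<exists>x. singular_simplex 0 (subtopology M A) x"
proof -
  have "Inr (cis 0, 1) \<in> topspace (subtopology M A)"
    using continuous_map_cis_end by (auto simp: continuous_map_def Pi_iff simp del: cis_zero)
  then show ?thesis by (auto simp: singular_simplex_0)
qed

end

theorem theorem5p2:
  fixes F :: "('f, 'b) monoid_scheme" and R :: "'f set" and w :: "'f set" and wbar :: 'f
    and T :: "'x topology" and x0 :: 'x and phi :: "(real \<Rightarrow> 'x) set \<Rightarrow> 'f set"
    and \<gamma> :: "complex \<Rightarrow> 'x"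
  assumes "free_group F"
    and "R \<lhd> F"
    and "w \<in> carrier (F Mod R)"
    and "group.ord (F Mod R) w = 0"
    and "wbar \<in> carrier F" and "w = R #>\<^bsub>F\<^esub> wbar"
    and "K_G_1 T x0 (F Mod R) phi"
    and "represents_class T x0 phi \<gamma> w"
  shows "relative_homology_group 2 (mapping_cylinder T \<gamma>) cylinder_end \<cong>
           (subgroup_generated F ((generate F {wbar} <#>\<^bsub>F\<^esub> R) \<inter> derived F (carrier F)))
             Mod (comm_subgroup F (carrier F) R)"
proof -
  interpret R: normal R F by fact
  interpret G: group "F Mod R" by (rule R.factorgroup_is_group)
  \<comment> \<open>Order 0 encodes infinite order: the exponents of trivial powers are the
    multiples of \<open>ord\<close>.\<close>
  have inf: "k = 0" if "w [^]\<^bsub>F Mod R\<^esub> k = \<one>\<^bsub>F Mod R\<^esub>" for k :: int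
    using G.int_pow_eq_id[OF assms(3), of k] assms(4) that by simp
  interpret C: cylinder_pair "F Mod R" T x0 phi \<gamma> w
    by unfold_locales (use assms(7,8) inf in \<open>auto simp: represents_class_def simp del: one_FactGroup\<close>)
  interpret P: presented_pair F R "mapping_cylinder T \<gamma>" cylinder_end C.gv w wbar
    by unfold_locales
      (rule assms(3) inf C.gv_closed C.gv_tri C.edge_ex C.tri_ex C.tetra_ex C.gv_sub C.edge_sub C.tri_sub
        C.point_sub assms(1,2,5,6) | assumption)+
  show ?thesis
    using P.relative_homology_iso unfolding P.J_def P.K_def .
qed

end
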